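(* Let $k$ be an algebraically closed field of characteristic zero, let $R=k[x_1,\ldots,x_n]$ with $n\ge3$, and let $J=(f_1,f_2,f_3)\subseteq R$ be a $d$-equigenerated strict almost complete intersection of height $2$ and homological dimension $2$. Then: (a) If $d=2$, then $\mathrm{Bour}(J)\ne2$. (b) If $d=3$, then $\mathrm{Bour}(J)\ne5$.
   Context: A $d$-equigenerated strict almost complete intersection of height $2$ is an ideal $J$ with $\mathrm{ht}(J)=2$ minimally generated by three homogeneous forms of degree $d$ ($d\ge2$). Homological dimension $2$ means that $J$ has projective dimension $2$ as an $R$-module (equivalently $\mathrm{pd}_R(R/J)=3$); in particular $R/J$ is not Cohen--Macaulay. Bourbaki degree: $\mathrm{Syz}(J)=\{(a_1,a_2,a_3)\in R^3:\sum a_if_i=0\}$ is graded as a submodule of $R^3$ (standard grading), $e=\mathrm{indeg}(\mathrm{Syz}(J))$ is the least degree of a nonzero homogeneous syzygy, and $\nu$ is a minimal generator of $\mathrm{Syz}(J)$ of degree $e$. Since $J$ is not perfect of height two, $\mathrm{Syz}(J)/R\nu$ is isomorphic, up to shift, to an unmixed homogeneous ideal $I_\nu\subseteq R$ of height $2$, and $\mathrm{Bour}(J)=\deg(R/I_\nu)$. This is independent of $\nu$, and $\mathrm{Bour}(J)=d^2-ed+e^2-\deg(R/J)$, where $\deg(R/J)$ is the multiplicity. *)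

theory Defs
  imports
    "HOL-Analysis.Finite_Cartesian_Product"
    "HOL-Library.Numeral_Type"
    "HOL-Library.Poly_Mapping"
    "HOL-Library.Extended_Nat"
    "HOL-Computational_Algebra.Polynomial"
begin

section \<open>Ideals, primes, height\<close>

abbreviation is_ideal :: "'r::comm_ring_1 set \<Rightarrow> bool" where
  "is_ideal \<equiv> module.subspace (*)"

abbreviation ideal_gen :: "'r::comm_ring_1 set \<Rightarrow> 'r set" where
  "ideal_gen \<equiv> module.span (*)"

lemma module_times: "module ((*) :: 'r::comm_ring_1 \<Rightarrow> 'r \<Rightarrow> 'r)"
  by unfold_locales (simp_all add: algebra_simps)

definition prime_ideal :: "'r::comm_ring_1 set \<Rightarrow> bool" where
  "prime_ideal P \<longleftrightarrow> is_ideal P \<and> P \<noteq> UNIV \<and> (\<forall>a b. a * b \<in> P \<longrightarrow> a \<in> P \<or> b \<in> P)"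

definition prime_height :: "'r::comm_ring_1 set \<Rightarrow> enat" where
  "prime_height P = Sup {enat m | m. \<exists>C :: nat \<Rightarrow> 'r set.
     (\<forall>i\<le>m. prime_ideal (C i)) \<and> (\<forall>i<m. C i \<subset> C (Suc i)) \<and> C m = P}"

text \<open>The unit ideal has height \<open>\<infinity>\<close> (infimum of the empty set).\<close>

definition height :: "'r::comm_ring_1 set \<Rightarrow> enat" where
  "height I = Inf {prime_height P | P. prime_ideal P \<and> I \<subseteq> P}"

text \<open>The associated primes of \<open>R/I\<close>: prime annihilators of residue classes.\<close>

definition associated_primes :: "'r::comm_ring_1 set \<Rightarrow> 'r set set" where
  "associated_primes I = {P. prime_ideal P \<and> (\<exists>u. P = {r. r * u \<in> I})}"

definition unmixed :: "'r::comm_ring_1 set \<Rightarrow> bool" where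
  "unmixed I \<longleftrightarrow> (\<forall>P\<in>associated_primes I. prime_height P = height I)"


section \<open>Modules over a commutative ring\<close>

text \<open>A module is given by a scalar multiplication \<open>s\<close> (as in locale \<^locale>\<open>module\<close>) and a subset of
  the carrier type closed under the operations; homomorphisms are only constrained on that subset.\<close>

definition module_hom_on ::
  "('r::comm_ring_1 \<Rightarrow> 'a::ab_group_add \<Rightarrow> 'a) \<Rightarrow> ('r \<Rightarrow> 'b::ab_group_add \<Rightarrow> 'b) \<Rightarrow>
   'a set \<Rightarrow> 'b set \<Rightarrow> ('a \<Rightarrow> 'b) \<Rightarrow> bool" where
  "module_hom_on s t M N h \<longleftrightarrow> h ` M \<subseteq> N \<and>
     (\<forall>x\<in>M. \<forall>y\<in>M. h (x + y) = h x + h y) \<and> (\<forall>r. \<forall>x\<in>M. h (s r x) = t r (h x))"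

definition minimal_generating_set ::
  "('r::comm_ring_1 \<Rightarrow> 'a::ab_group_add \<Rightarrow> 'a) \<Rightarrow> 'a set \<Rightarrow> 'a set \<Rightarrow> bool" where
  "minimal_generating_set s G M \<longleftrightarrow> module.span s G = M \<and> (\<forall>H. H \<subset> G \<longrightarrow> module.span s H \<noteq> M)"

text \<open>The free module of countable rank consists of the finitely supported sequences in \<open>R\<close>.\<close>

definition fscale :: "'r::comm_ring_1 \<Rightarrow> (nat \<Rightarrow>\<^sub>0 'r) \<Rightarrow> (nat \<Rightarrow>\<^sub>0 'r)" where
  "fscale r v = Poly_Mapping.map ((*) r) v"

lemma lookup_fscale: "Poly_Mapping.lookup (fscale r v) i = r * Poly_Mapping.lookup v i"
  by (simp add: fscale_def map.rep_eq when_def)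

lemma module_fscale: "module (fscale :: 'r::comm_ring_1 \<Rightarrow> _)"
  by unfold_locales (auto intro!: poly_mapping_eqI simp: lookup_fscale Poly_Mapping.lookup_add algebra_simps)

text \<open>Every countably generated projective module is isomorphic to a direct summand of the free
  module of countable rank.\<close>

definition projective :: "(nat \<Rightarrow>\<^sub>0 'r::comm_ring_1) set \<Rightarrow> bool" where
  "projective P \<longleftrightarrow> module.subspace fscale P \<and>
     (\<exists>Q. module.subspace fscale Q \<and> P \<inter> Q = {0} \<and> (\<forall>v. \<exists>p\<in>P. \<exists>q\<in>Q. v = p + q))"

text \<open>An exact sequence
  \<open>0 \<rightarrow> P\<^sub>m \<rightarrow> \<dots> \<rightarrow> P\<^sub>1 \<rightarrow> P\<^sub>0 \<rightarrow> M \<rightarrow> 0\<close>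
  with projective \<open>P\<^sub>i\<close>, where \<open>D i : P\<^sub>i\<^sub>+\<^sub>1 \<rightarrow> P\<^sub>i\<close>. Restricting to countably generated projectives
  is harmless for the finitely generated modules \<open>M\<close> over a Noetherian ring used below.\<close>

definition has_projective_resolution ::
  "('r::comm_ring_1 \<Rightarrow> 'a::ab_group_add \<Rightarrow> 'a) \<Rightarrow> 'a set \<Rightarrow> nat \<Rightarrow> bool" where
  "has_projective_resolution s M m \<longleftrightarrow>
     (\<exists>(P :: nat \<Rightarrow> (nat \<Rightarrow>\<^sub>0 'r) set) D \<epsilon>.
        (\<forall>i. projective (P i)) \<and> (\<forall>i>m. P i = {0}) \<and>
        module_hom_on fscale s (P 0) M \<epsilon> \<and> \<epsilon> ` P 0 = M \<and>
        (\<forall>i. module_hom_on fscale fscale (P (Suc i)) (P i) (D i)) \<and>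
        D 0 ` P (Suc 0) = {x \<in> P 0. \<epsilon> x = 0} \<and>
        (\<forall>i. D (Suc i) ` P (Suc (Suc i)) = {x \<in> P (Suc i). D i x = 0}))"

definition projective_dimension ::
  "('r::comm_ring_1 \<Rightarrow> 'a::ab_group_add \<Rightarrow> 'a) \<Rightarrow> 'a set \<Rightarrow> enat" where
  "projective_dimension s M = Inf {enat m | m. has_projective_resolution s M m}"


section \<open>Polynomial rings with the standard grading\<close>

text \<open>The variables \<open>x\<^sub>1, \<dots>, x\<^sub>n\<close> are indexed by a finite linearly ordered type \<open>'n\<close> with
  \<open>n\<close> elements; the order only serves to make the library's \<^class>\<open>idom\<close> instance available.\<close>

type_synonym ('n, 'k) mpoly = "('n \<Rightarrow>\<^sub>0 nat) \<Rightarrow>\<^sub>0 'k"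

definition monomial_degree :: "('n::finite \<Rightarrow>\<^sub>0 nat) \<Rightarrow> nat" where
  "monomial_degree m = (\<Sum>i\<in>UNIV. Poly_Mapping.lookup m i)"

text \<open>The zero polynomial is homogeneous of every degree.\<close>

definition homogeneous :: "nat \<Rightarrow> ('n::finite, 'k::zero) mpoly \<Rightarrow> bool" where
  "homogeneous j p \<longleftrightarrow> (\<forall>m\<in>Poly_Mapping.keys p. monomial_degree m = j)"

definition homogeneous_ideal :: "('n::{finite,linorder}, 'k::field) mpoly set \<Rightarrow> bool" where
  "homogeneous_ideal I \<longleftrightarrow> (\<exists>G. (\<forall>g\<in>G. \<exists>j. homogeneous j g) \<and> I = ideal_gen G)"

definition kscale :: "'k::field \<Rightarrow> ('n::{finite,linorder}, 'k) mpoly \<Rightarrow> ('n, 'k) mpoly" where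
  "kscale c p = Poly_Mapping.single 0 c * p"

lemma vector_space_kscale:
  "vector_space (kscale :: 'k::field \<Rightarrow> ('n::{finite,linorder}, 'k) mpoly \<Rightarrow> ('n, 'k) mpoly)"
  by unfold_locales
     (simp_all add: kscale_def distrib_left distrib_right single_add mult_single
        flip: mult.assoc)

text \<open>\<open>dim\<^sub>k (R/I)\<^sub>j = dim\<^sub>k R\<^sub>j - dim\<^sub>k I\<^sub>j\<close> for homogeneous \<open>I\<close>; all dimensions are finite.\<close>

definition hilbert_function :: "('n::{finite,linorder}, 'k::field) mpoly set \<Rightarrow> nat \<Rightarrow> nat" where
  "hilbert_function I j =
     vector_space.dim kscale {p :: ('n, 'k) mpoly. homogeneous j p}
     - vector_space.dim kscale {p \<in> I. homogeneous j p}"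

definition hilbert_polynomial :: "('n::{finite,linorder}, 'k::field) mpoly set \<Rightarrow> rat poly" where
  "hilbert_polynomial I =
     (THE q. \<forall>\<^sub>F j in sequentially. poly q (of_nat j) = of_nat (hilbert_function I j))"

text \<open>The multiplicity \<open>deg(R/I)\<close>: if the Hilbert polynomial is nonzero it has degree
  \<open>dim(R/I) - 1\<close>; otherwise \<open>R/I\<close> has finite length, and that length is its multiplicity.\<close>

definition multiplicity_quot :: "('n::{finite,linorder}, 'k::field) mpoly set \<Rightarrow> rat" where
  "multiplicity_quot I =
     (let q = hilbert_polynomial I in
      if q \<noteq> 0 then fact (Polynomial.degree q) * lead_coeff q
      else of_nat (\<Sum>j\<in>{j. hilbert_function I j \<noteq> 0}. hilbert_function I j))"


section \<open>Three-generated ideals and the Bourbaki degree\<close>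

lemma module_vec: "module ((*s) :: 'r::comm_ring_1 \<Rightarrow> 'r ^ 'm \<Rightarrow> 'r ^ 'm)"
  by unfold_locales (simp_all add: vec_eq_iff algebra_simps)

definition ideal_of :: "'r::comm_ring_1 ^ 3 \<Rightarrow> 'r set" where
  "ideal_of f = ideal_gen {f $ i | i. True}"

text \<open>Injectivity of \<open>i \<mapsto> f\<^sub>i\<close> says that the minimal generating set has exactly three
  elements.\<close>

definition equigenerated_strict_aci2 ::
  "nat \<Rightarrow> ('n::{finite,linorder}, 'k::field) mpoly ^ 3 \<Rightarrow> bool" where
  "equigenerated_strict_aci2 d f \<longleftrightarrow> d \<ge> 2 \<and> (\<forall>i. homogeneous d (f $ i)) \<and>
     inj (\<lambda>i. f $ i) \<and> minimal_generating_set (*) {f $ i | i. True} (ideal_of f) \<and>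
     height (ideal_of f) = 2"

definition Syz :: "'r::comm_ring_1 ^ 3 \<Rightarrow> ('r ^ 3) set" where
  "Syz f = {a. (\<Sum>i\<in>UNIV. a $ i * f $ i) = 0}"

definition homogeneous_vec :: "nat \<Rightarrow> ('n::finite, 'k::zero) mpoly ^ 3 \<Rightarrow> bool" where
  "homogeneous_vec j a \<longleftrightarrow> (\<forall>i. homogeneous j (a $ i))"

definition indeg :: "(('n::finite, 'k::zero) mpoly ^ 3) set \<Rightarrow> nat" where
  "indeg M = (LEAST e. \<exists>a\<in>M. a \<noteq> 0 \<and> homogeneous_vec e a)"

text \<open>A minimal generator of a graded module is a member of some minimal generating set consisting
  of homogeneous elements.\<close>

definition minimal_generator ::
  "(('n::{finite,linorder}, 'k::field) mpoly ^ 3) set \<Rightarrow> ('n, 'k) mpoly ^ 3 \<Rightarrow> bool" where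
  "minimal_generator M \<nu> \<longleftrightarrow>
     (\<exists>G. \<nu> \<in> G \<and> (\<forall>g\<in>G. \<exists>j. homogeneous_vec j g) \<and> minimal_generating_set (*s) G M)"

text \<open>A graded isomorphism, up to a shift, from \<open>M/R\<nu>\<close> onto \<open>I\<close>, given by the
  composite \<open>\<phi> : M \<rightarrow> M/R\<nu> \<rightarrow> I\<close>: a surjection with kernel \<open>R\<nu>\<close> that
  changes degrees by a constant \<open>c\<close>, possibly negative.\<close>

definition quotient_iso_up_to_shift ::
  "(('n::{finite,linorder}, 'k::field) mpoly ^ 3) set \<Rightarrow> ('n, 'k) mpoly ^ 3 \<Rightarrow>
   ('n, 'k) mpoly set \<Rightarrow> bool" where
  "quotient_iso_up_to_shift M \<nu> I \<longleftrightarrow>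
     (\<exists>\<phi> (c::int). module_hom_on (*s) (*) M I \<phi> \<and> \<phi> ` M = I \<and>
        {a \<in> M. \<phi> a = 0} = module.span (*s) {\<nu>} \<and>
        (\<forall>j. \<forall>a\<in>M. homogeneous_vec j a \<longrightarrow>
           (\<forall>m\<in>Poly_Mapping.keys (\<phi> a). int (monomial_degree m) = int j + c)))"

definition bourbaki_ideal ::
  "('n::{finite,linorder}, 'k::field) mpoly ^ 3 \<Rightarrow> ('n, 'k) mpoly ^ 3 \<Rightarrow>
   ('n, 'k) mpoly set \<Rightarrow> bool" where
  "bourbaki_ideal f \<nu> I \<longleftrightarrow>
     minimal_generator (Syz f) \<nu> \<and> homogeneous_vec (indeg (Syz f)) \<nu> \<and>
     homogeneous_ideal I \<and> unmixed I \<and> height I = 2 \<and>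
     quotient_iso_up_to_shift (Syz f) \<nu> I"

text \<open>\<open>Bour(f\<^sub>1,f\<^sub>2,f\<^sub>3) = b\<close>, as a relation (in the style of \<open>sums\<close>, \<open>has_integral\<close>): the degree of
  a Bourbaki ideal. For the ideals considered a Bourbaki ideal exists and its degree depends
  neither on \<open>\<nu>\<close> nor on \<open>I\<close>.\<close>

definition has_Bourbaki_degree ::
  "('n::{finite,linorder}, 'k::field) mpoly ^ 3 \<Rightarrow> rat \<Rightarrow> bool" where
  "has_Bourbaki_degree f b \<longleftrightarrow> (\<exists>\<nu> I. bourbaki_ideal f \<nu> I \<and> b = multiplicity_quot I)"

end

theory Submission
  imports Defs "HOL-Analysis.Cartesian_Space"
begin

text \<open>Let \<open>e\<close> be the initial degree of \<open>Syz(J)\<close> and \<open>I\<close> a Bourbaki ideal for a syzygy \<open>\<nu>\<close> of degree \<open>e\<close>; up to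
  a unit the Bourbaki map \<open>\<phi>\<close> is given by \<open>s \<times> \<nu> = \<phi>(s) f\<close>. Applied to the Koszul syzygies this
  shows that \<open>I\<close> contains the entries of \<open>\<nu>\<close>, which have no common factor, hence two coprime forms of
  degree \<open>e\<close>; so \<open>Bour(J) \<le> e\<^sup>2\<close>. It also shows that \<open>I\<close> is generated in degrees \<open>\<ge> 2e - d\<close>. Since \<open>J\<close> has
  projective dimension two, \<open>I\<close> has a minimal graded free resolution of length one, and for the degrees
  \<open>a\<^sub>0 \<le> \<dots> \<le> a\<^sub>r\<close> of its generators and \<open>b\<^sub>0 \<le> \<dots> \<le> b\<^sub>r\<^sub>-\<^sub>1\<close> of its relations one has \<open>\<Sum>a\<^sub>i = \<Sum>b\<^sub>i\<close>,
  \<open>b\<^sub>i > a\<^sub>i\<^sub>+\<^sub>1\<close> and \<open>deg(R/I) = (\<Sum>b\<^sub>i\<^sup>2 - \<Sum>a\<^sub>i\<^sup>2)/2 \<ge> a\<^sub>0(a\<^sub>0 + 1)/2\<close>. As \<open>e \<le> d\<close>, for \<open>d = 2\<close> this leaves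
  \<open>Bour(J) \<le> 1\<close> or \<open>Bour(J) \<ge> 3\<close>, and for \<open>d = 3\<close> it leaves \<open>Bour(J) \<le> 4\<close> or \<open>Bour(J) \<ge> 6\<close>.\<close>

text \<open>The hypothesis on projective dimension yields only an ungraded resolution of J by
  arbitrary projectives, whereas the degree count needs a minimal graded free one of I. A mapping
  cone bridges the gap: lifts to Syz(J) of minimal generators of I generate it together with \<nu>,
  and minimal relations of I lift to relations among these, which gives an exact sequence R^r ->
  R^(m+1) -> R^3 -> J -> 0. Comparison with a projective resolution of length two retracts R^r onto
  the kernel of its first map. Minimality puts this kernel into \<mm>R^r, and such a retract
  vanishes, so the relations are free. The gap between the b's and the a's is a rank count: without
  it, some q independent relations would involve only q generators. Dimension theory is avoided: as
  I contains two coprime forms of degree e, the Hilbert polynomial of R/I lies eventually between 0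
  and that of a complete intersection. This kills its two top coefficients, which are governed by
  the number of relations and by the sums of the degrees, and bounds the next one by the term in
  e^2.\<close>

section \<open>Homogeneous parts of polynomials\<close>

lemma poly_mapping_add_induct [case_names single add]:
  fixes p :: "'a \<Rightarrow>\<^sub>0 'b::comm_monoid_add"
  assumes "\<And>t c. P (Poly_Mapping.single t c)" and "\<And>p q. P p \<Longrightarrow> P q \<Longrightarrow> P (p + q)"
  shows "P p"
proof (induction p rule: Poly_Mapping.update_induct)
  case const
  show ?case using assms(1)[of undefined 0] by simp
next
  case (update f a b)
  have "Poly_Mapping.update a b f = f + Poly_Mapping.single a b"
    using update(1) by (intro poly_mapping_eqI)
      (auto simp: lookup_update lookup_add lookup_single when_def in_keys_iff)
  thus ?case using assms update by simp
qed

lemma lookup_single_times: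
  fixes p :: "'a::cancel_comm_monoid_add \<Rightarrow>\<^sub>0 'b::comm_semiring_0"
  shows "Poly_Mapping.lookup (Poly_Mapping.single t c * p) (t + u) = c * Poly_Mapping.lookup p u"
  by (induction p rule: poly_mapping_add_induct)
     (simp_all add: mult_single lookup_single when_def lookup_add distrib_left)

lemma lookup_const_times:
  fixes p :: "'a::cancel_comm_monoid_add \<Rightarrow>\<^sub>0 'b::comm_semiring_0"
  shows "Poly_Mapping.lookup (Poly_Mapping.single 0 c * p) u = c * Poly_Mapping.lookup p u"
  using lookup_single_times[of 0 c p u] by simp

lemma monomial_degree_add: "monomial_degree (s + t) = monomial_degree s + monomial_degree t"
  by (simp add: monomial_degree_def lookup_add sum.distrib)

lemma monomial_degree_zero [simp]: "monomial_degree 0 = 0"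
  by (simp add: monomial_degree_def)

lemma monomial_degree_single [simp]: "monomial_degree (Poly_Mapping.single i a) = a"
  by (simp add: monomial_degree_def lookup_single when_def)

lemma monomial_degree_eq_0_iff: "monomial_degree t = 0 \<longleftrightarrow> t = 0"
  by (auto simp: monomial_degree_def intro!: poly_mapping_eqI)

text \<open>The part of degree \<open>j\<close> of \<open>p\<close>, where \<open>p\<close> is regarded as an element of the shifted module \<open>R(-s)\<close>.\<close>

definition hpart :: "nat \<Rightarrow> nat \<Rightarrow> ('n::finite, 'k::zero) mpoly \<Rightarrow> ('n, 'k) mpoly" where
  "hpart s j p = Poly_Mapping.mapp (\<lambda>t c. c when monomial_degree t + s = j) p"

lemma lookup_hpart:
  "Poly_Mapping.lookup (hpart s j p) t = (Poly_Mapping.lookup p t when monomial_degree t + s = j)"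
  by (auto simp: hpart_def lookup_mapp when_def in_keys_iff)

lemma hpart_zero [simp]: "hpart s j 0 = 0"
  by (intro poly_mapping_eqI) (simp add: lookup_hpart)

lemma hpart_add: "hpart s j (p + q) = hpart s j p + hpart s j (q::('n::finite, 'k::comm_monoid_add) mpoly)"
  by (intro poly_mapping_eqI) (simp add: lookup_hpart lookup_add when_def)

lemma hpart_sum: "hpart s j (sum p A) = (\<Sum>x\<in>A. hpart s j (p x :: ('n::finite, 'k::comm_monoid_add) mpoly))"
  by (induction A rule: infinite_finite_induct) (simp_all add: hpart_add)

lemma keys_hpart: "Poly_Mapping.keys (hpart s j p) = {t \<in> Poly_Mapping.keys p. monomial_degree t + s = j}"
  by (auto simp: in_keys_iff lookup_hpart)

lemma homogeneous_hpart: "homogeneous j (hpart 0 j p)"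
  by (simp add: homogeneous_def keys_hpart)

lemma hpart_shift: "hpart s j p = (if s \<le> j then hpart 0 (j - s) p else 0)"
  by (auto intro!: poly_mapping_eqI simp: lookup_hpart when_def)

lemma hpart_idI: "(\<And>t. t \<in> Poly_Mapping.keys p \<Longrightarrow> monomial_degree t + s = j) \<Longrightarrow> hpart s j p = p"
  by (intro poly_mapping_eqI) (auto simp: lookup_hpart when_def in_keys_iff)

lemma hpart_zeroI: "(\<And>t. t \<in> Poly_Mapping.keys p \<Longrightarrow> monomial_degree t + s \<noteq> j) \<Longrightarrow> hpart s j p = 0"
  by (intro poly_mapping_eqI) (auto simp: lookup_hpart when_def in_keys_iff)

lemma hpart_homogeneous: "homogeneous i p \<Longrightarrow> hpart 0 j p = (if i = j then p else 0)"
  by (auto intro!: hpart_idI hpart_zeroI simp: homogeneous_def)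

lemma keys_mult_degree:
  fixes p q :: "('n::finite, 'k::comm_semiring_0) mpoly"
  assumes "u \<in> Poly_Mapping.keys (p * q)"
  obtains s t where "s \<in> Poly_Mapping.keys p" "t \<in> Poly_Mapping.keys q"
    "monomial_degree u = monomial_degree s + monomial_degree t"
  using assms keys_mult[of p q] by (auto simp: monomial_degree_add)

text \<open>A monomial of \<open>p\<close> of degree i contributes to degree i + \<open>b\<close> of
  R(-s), where \<open>b\<close> is the degree of \<open>q\<close> there; so one degree of the
  product comes from one degree of \<open>p\<close>. This allows identities with homogeneous
  generators to be split by degree.\<close>

lemma hpart_mult:
  fixes p q :: "('n::finite, 'k::comm_semiring_0) mpoly"
  assumes q: "\<And>t. t \<in> Poly_Mapping.keys q \<Longrightarrow> monomial_degree t + s = b"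
  shows "hpart s j (p * q) = hpart b j p * q"
proof (induction p rule: poly_mapping_add_induct)
  case (single t c)
  have k: "monomial_degree u + s = monomial_degree t + b"
    if "u \<in> Poly_Mapping.keys (Poly_Mapping.single t c * q)" for u
    using that by (elim keys_mult_degree) (auto simp: q[symmetric] split: if_splits)
  show ?case
  proof (cases "monomial_degree t + b = j")
    case True
    have "hpart b j (Poly_Mapping.single t c) = Poly_Mapping.single t c"
      using True by (intro hpart_idI) (auto split: if_splits)
    moreover have "hpart s j (Poly_Mapping.single t c * q) = Poly_Mapping.single t c * q"
      using True k by (intro hpart_idI) auto
    ultimately show ?thesis by simp
  next
    case False
    have "hpart b j (Poly_Mapping.single t c) = 0"
      using False by (intro hpart_zeroI) (auto split: if_splits)
    moreover have "hpart s j (Poly_Mapping.single t c * q) = 0"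
      using False k by (intro hpart_zeroI) auto
    ultimately show ?thesis by simp
  qed
qed (simp add: distrib_right hpart_add)

lemma homogeneous_mult:
  fixes p q :: "('n::finite, 'k::comm_semiring_0) mpoly"
  shows "homogeneous i p \<Longrightarrow> homogeneous j q \<Longrightarrow> homogeneous (i + j) (p * q)"
  unfolding homogeneous_def by (metis keys_mult_degree)

lemma homogeneous_add:
  fixes p q :: "('n::finite, 'k::comm_monoid_add) mpoly"
  shows "homogeneous i p \<Longrightarrow> homogeneous i q \<Longrightarrow> homogeneous i (p + q)"
  unfolding homogeneous_def using keys_add[of p q] by blast

lemma homogeneous_zero [simp]: "homogeneous i 0"
  by (simp add: homogeneous_def)

lemma homogeneous_uminus [simp]: "homogeneous i (- p) = homogeneous i (p :: ('n::finite, 'k::ab_group_add) mpoly)"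
  by (simp add: homogeneous_def)

lemma homogeneous_single: "homogeneous (monomial_degree t) (Poly_Mapping.single t c)"
  by (simp add: homogeneous_def)

lemma homogeneous_sum:
  fixes p :: "'a \<Rightarrow> ('n::finite, 'k::comm_monoid_add) mpoly"
  shows "(\<And>x. x \<in> A \<Longrightarrow> homogeneous i (p x)) \<Longrightarrow> homogeneous i (sum p A)"
  by (induction A rule: infinite_finite_induct) (simp_all add: homogeneous_add)

definition tdeg :: "('n::finite, 'k::zero) mpoly \<Rightarrow> nat" where
  "tdeg p = Max (insert 0 (monomial_degree ` Poly_Mapping.keys p))"

lemma monomial_degree_le_tdeg: "t \<in> Poly_Mapping.keys p \<Longrightarrow> monomial_degree t \<le> tdeg p"
  by (simp add: tdeg_def)

lemma hpart_eq_0: "tdeg p < j \<Longrightarrow> hpart 0 j p = 0"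
  using monomial_degree_le_tdeg by (intro hpart_zeroI) fastforce

lemma hpart_tdeg_nonzero:
  assumes "p \<noteq> 0"
  shows "hpart 0 (tdeg p) p \<noteq> 0"
proof -
  have "Poly_Mapping.keys p \<noteq> {}" using assms by simp
  then obtain t where t: "t \<in> Poly_Mapping.keys p" by blast
  have "\<exists>t\<in>Poly_Mapping.keys p. monomial_degree t = tdeg p"
  proof -
    have "tdeg p \<in> insert 0 (monomial_degree ` Poly_Mapping.keys p)"
      unfolding tdeg_def by (intro Max_in) auto
    then show ?thesis using t monomial_degree_le_tdeg[OF t] by auto
  qed
  then show ?thesis by (metis (mono_tags, lifting) add_0_right empty_iff keys_hpart keys_zero mem_Collect_eq)
qed

lemma sum_hpart:
  fixes p :: "('n::finite, 'k::comm_monoid_add) mpoly"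
  assumes "tdeg p \<le> N"
  shows "(\<Sum>i\<le>N. hpart 0 i p) = p"
proof (intro poly_mapping_eqI)
  fix t
  show "Poly_Mapping.lookup (\<Sum>i\<le>N. hpart 0 i p) t = Poly_Mapping.lookup p t"
    using monomial_degree_le_tdeg[of t p] assms
    by (cases "t \<in> Poly_Mapping.keys p") (auto simp: lookup_sum lookup_hpart when_def in_keys_iff)
qed

text \<open>The shifted \<open>hpart i j q\<close> is the part of \<open>q\<close> of degree j - i
  and vanishes for i > j, so no truncated subtraction arises.\<close>

lemma hpart_eq_mult_sum:
  fixes p q :: "('n::finite, 'k::comm_semiring_0) mpoly"
  shows "hpart 0 j (p * q) = (\<Sum>i\<le>tdeg p. hpart 0 i p * hpart i j q)"
proof -
  have "hpart 0 j (p * q) = hpart 0 j (\<Sum>i\<le>tdeg p. hpart 0 i p * q)"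
    by (subst sum_hpart[of p "tdeg p", symmetric]) (simp_all add: sum_distrib_right)
  also have "\<dots> = (\<Sum>i\<le>tdeg p. hpart 0 j (q * hpart 0 i p))"
    by (simp add: hpart_sum mult.commute)
  also have "\<dots> = (\<Sum>i\<le>tdeg p. hpart i j q * hpart 0 i p)"
    by (intro sum.cong refl hpart_mult) (auto simp: keys_hpart)
  finally show ?thesis by (simp add: mult.commute)
qed

lemma hpart_mult_top:
  fixes p q :: "('n::finite, 'k::comm_semiring_0) mpoly"
  shows "hpart 0 (tdeg p + tdeg q) (p * q) = hpart 0 (tdeg p) p * hpart 0 (tdeg q) q"
proof -
  have "hpart i (tdeg p + tdeg q) q = 0" if "i < tdeg p" for i
    using that by (subst hpart_shift) (auto intro!: hpart_eq_0)
  then have "hpart 0 (tdeg p + tdeg q) (p * q)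
     = (\<Sum>i\<le>tdeg p. if i = tdeg p then hpart 0 (tdeg p) p * hpart 0 (tdeg q) q else 0)"
    unfolding hpart_eq_mult_sum
    by (intro sum.cong refl) (auto simp: hpart_shift[of "tdeg p" "tdeg p + tdeg q" q])
  then show ?thesis by simp
qed

lemma tdeg_leI: "(\<And>t. t \<in> Poly_Mapping.keys p \<Longrightarrow> monomial_degree t \<le> N) \<Longrightarrow> tdeg p \<le> N"
  by (simp add: tdeg_def)

lemma tdeg_mult:
  fixes p q :: "('n::{finite,linorder}, 'k::field) mpoly"
  assumes "p \<noteq> 0" "q \<noteq> 0"
  shows "tdeg (p * q) = tdeg p + tdeg q"
proof (rule antisym)
  show "tdeg (p * q) \<le> tdeg p + tdeg q"
    by (intro tdeg_leI, erule keys_mult_degree) (simp add: add_mono monomial_degree_le_tdeg)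
  have "hpart 0 (tdeg p + tdeg q) (p * q) \<noteq> 0"
    using hpart_tdeg_nonzero[OF assms(1)] hpart_tdeg_nonzero[OF assms(2)] by (simp add: hpart_mult_top)
  then show "tdeg p + tdeg q \<le> tdeg (p * q)"
    using hpart_eq_0 not_le by blast
qed

lemma tdeg_homogeneous: "homogeneous j p \<Longrightarrow> p \<noteq> 0 \<Longrightarrow> tdeg p = j"
  using hpart_tdeg_nonzero[of p] hpart_homogeneous[of j p] by metis

lemma homogeneous_0_imp_const:
  assumes "homogeneous 0 p"
  shows "p = Poly_Mapping.single 0 (Poly_Mapping.lookup p 0)"
proof (intro poly_mapping_eqI)
  fix t show "Poly_Mapping.lookup p t = Poly_Mapping.lookup (Poly_Mapping.single 0 (Poly_Mapping.lookup p 0)) t"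
    using assms by (cases "t = 0") (auto simp: homogeneous_def lookup_single when_def in_keys_iff monomial_degree_eq_0_iff)
qed

lemma const_dvd_one:
  fixes c :: "'k::field"
  assumes "c \<noteq> 0"
  shows "(Poly_Mapping.single 0 c :: ('n::{finite,linorder}, 'k) mpoly) dvd 1"
  using assms by (intro dvdI[of _ _ "Poly_Mapping.single 0 (inverse c)"]) (simp add: mult_single)

lemma tdeg_0_dvd_one:
  fixes p :: "('n::{finite,linorder}, 'k::field) mpoly"
  assumes "p \<noteq> 0" "tdeg p = 0"
  shows "p dvd 1"
proof -
  have "homogeneous 0 p" using assms(2) monomial_degree_le_tdeg[of _ p] by (auto simp: homogeneous_def)
  then have p: "p = Poly_Mapping.single 0 (Poly_Mapping.lookup p 0)" by (rule homogeneous_0_imp_const)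
  then have "Poly_Mapping.lookup p 0 \<noteq> 0" using assms(1) by (metis single_zero)
  then show ?thesis using const_dvd_one p by metis
qed


section \<open>Unique factorization in polynomial rings\<close>

text \<open>Divisibility, primes and factorizations are taken relative to a subset of an ambient
  domain, because variables will be adjoined one at a time inside one fixed polynomial type: the
  intermediate rings are sets, not types.\<close>

definition unital_subring :: "'a::idom set \<Rightarrow> bool" where
  "unital_subring A \<longleftrightarrow> 0 \<in> A \<and> 1 \<in> A \<and> (\<forall>a\<in>A. - a \<in> A) \<and> (\<forall>a\<in>A. \<forall>b\<in>A. a + b \<in> A \<and> a * b \<in> A)"

definition dvd_in :: "'a::idom set \<Rightarrow> 'a \<Rightarrow> 'a \<Rightarrow> bool" where
  "dvd_in A a b \<longleftrightarrow> (\<exists>c\<in>A. b = a * c)"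

definition prime_in :: "'a::idom set \<Rightarrow> 'a \<Rightarrow> bool" where
  "prime_in A p \<longleftrightarrow> p \<in> A \<and> p \<noteq> 0 \<and> \<not> dvd_in A p 1 \<and>
     (\<forall>a\<in>A. \<forall>b\<in>A. dvd_in A p (a * b) \<longrightarrow> dvd_in A p a \<or> dvd_in A p b)"

definition factors_in :: "'a::idom set \<Rightarrow> 'a \<Rightarrow> 'a \<Rightarrow> 'a list \<Rightarrow> bool" where
  "factors_in A a u ps \<longleftrightarrow> u \<in> A \<and> dvd_in A u 1 \<and> (\<forall>p\<in>set ps. prime_in A p) \<and> a = u * prod_list ps"

text \<open>The factors are required to be prime and not just irreducible; uniqueness is then
  automatic in a domain.\<close>

definition ufd :: "'a::idom set \<Rightarrow> bool" where
  "ufd A \<longleftrightarrow> unital_subring A \<and> (\<forall>a\<in>A. a \<noteq> 0 \<longrightarrow> (\<exists>u ps. factors_in A a u ps))"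

lemma unital_subringD:
  assumes "unital_subring A"
  shows "0 \<in> A" "1 \<in> A" "a \<in> A \<Longrightarrow> - a \<in> A" "a \<in> A \<Longrightarrow> b \<in> A \<Longrightarrow> a + b \<in> A"
    "a \<in> A \<Longrightarrow> b \<in> A \<Longrightarrow> a * b \<in> A" "a \<in> A \<Longrightarrow> b \<in> A \<Longrightarrow> a - b \<in> A"
  using assms by (auto simp: unital_subring_def) (metis add_uminus_conv_diff)

lemma unital_subring_sum: "unital_subring A \<Longrightarrow> (\<And>x. x \<in> S \<Longrightarrow> f x \<in> A) \<Longrightarrow> sum f S \<in> A"
  by (induction S rule: infinite_finite_induct) (auto simp: unital_subringD)

lemma unital_subring_prod_list: "unital_subring A \<Longrightarrow> set ps \<subseteq> A \<Longrightarrow> prod_list ps \<in> A"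
  by (induction ps) (auto simp: unital_subringD)

lemma unital_subring_power: "unital_subring A \<Longrightarrow> a \<in> A \<Longrightarrow> a ^ n \<in> A"
  by (induction n) (auto simp: unital_subringD)

lemma dvd_inI: "c \<in> A \<Longrightarrow> b = a * c \<Longrightarrow> dvd_in A a b"
  by (auto simp: dvd_in_def)

lemma dvd_in_trans: "unital_subring A \<Longrightarrow> dvd_in A a b \<Longrightarrow> dvd_in A b c \<Longrightarrow> dvd_in A a c"
  unfolding dvd_in_def by (metis mult.assoc unital_subringD(5))

lemma dvd_in_add: "unital_subring A \<Longrightarrow> dvd_in A a b \<Longrightarrow> dvd_in A a c \<Longrightarrow> dvd_in A a (b + c)"
  unfolding dvd_in_def by (metis distrib_left unital_subringD(4))

lemma dvd_in_diff: "unital_subring A \<Longrightarrow> dvd_in A a b \<Longrightarrow> dvd_in A a c \<Longrightarrow> dvd_in A a (b - c)"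
  unfolding dvd_in_def by (metis right_diff_distrib unital_subringD(6))

lemma dvd_in_mult: "unital_subring A \<Longrightarrow> dvd_in A a b \<Longrightarrow> c \<in> A \<Longrightarrow> dvd_in A a (b * c)"
  unfolding dvd_in_def by (metis mult.assoc unital_subringD(5))

lemma dvd_in_0: "unital_subring A \<Longrightarrow> dvd_in A a 0"
  unfolding dvd_in_def by (metis mult_zero_right unital_subringD(1))

lemma dvd_in_sum: "unital_subring A \<Longrightarrow> (\<And>x. x \<in> S \<Longrightarrow> dvd_in A a (f x)) \<Longrightarrow> dvd_in A a (sum f S)"
  by (induction S rule: infinite_finite_induct) (auto intro: dvd_in_add dvd_in_0)

lemma prime_in_carrier: "prime_in A p \<Longrightarrow> p \<in> A" and prime_in_nonzero: "prime_in A p \<Longrightarrow> p \<noteq> 0"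
  by (auto simp: prime_in_def)

lemma prime_inD:
  "prime_in A p \<Longrightarrow> a \<in> A \<Longrightarrow> b \<in> A \<Longrightarrow> dvd_in A p (a * b) \<Longrightarrow> dvd_in A p a \<or> dvd_in A p b"
  by (auto simp: prime_in_def)

lemma prime_in_not_unit: "unital_subring A \<Longrightarrow> prime_in A p \<Longrightarrow> dvd_in A u 1 \<Longrightarrow> \<not> dvd_in A p u"
  unfolding prime_in_def using dvd_in_trans by blast

text \<open>From \<open>q = p * v\<close> the prime \<open>q\<close> divides \<open>p\<close>, which
  makes \<open>v\<close> a unit, or \<open>v\<close>, which would make \<open>p\<close> a
  unit.\<close>

lemma prime_in_dvd_sym:
  assumes A: "unital_subring A" and p: "prime_in A p" and q: "prime_in A q" and "dvd_in A p q"
  shows "\<exists>v\<in>A. dvd_in A v 1 \<and> q = p * v"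
proof -
  obtain v where v: "v \<in> A" "q = p * v" using assms(4) by (auto simp: dvd_in_def)
  have "dvd_in A q (p * v)" using v unital_subringD(2)[OF A] by (auto simp: dvd_in_def)
  then consider "dvd_in A q p" | "dvd_in A q v"
    using prime_inD[OF q _ v(1)] prime_in_carrier[OF p] by blast
  then show ?thesis
  proof cases
    case 1
    then obtain w where "w \<in> A" "p = p * v * w" using v by (auto simp: dvd_in_def)
    then have "1 = v * w" using prime_in_nonzero[OF p] by (metis mult.assoc mult_cancel_left2)
    then show ?thesis using v \<open>w \<in> A\<close> by (auto simp: dvd_in_def)
  next
    case 2
    then obtain w where w: "w \<in> A" "v = p * v * w" using v by (auto simp: dvd_in_def)
    have "v \<noteq> 0" using v prime_in_nonzero[OF q] by auto
    then have "1 = p * w" using w(2) by (metis mult.assoc mult.commute mult_cancel_left2)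
    then show ?thesis using p w(1) by (auto simp: dvd_in_def prime_in_def)
  qed
qed

lemma prime_in_dvd_prod_list:
  assumes A: "unital_subring A" and p: "prime_in A p" and "factors_in A a u ps" "dvd_in A p a"
  shows "\<exists>q\<in>set ps. dvd_in A p q"
proof -
  have "set ps \<subseteq> A" "u \<in> A" "dvd_in A p (u * prod_list ps)" "\<not> dvd_in A p u"
    using assms prime_in_not_unit by (auto simp: factors_in_def prime_in_def)
  then have "dvd_in A p (prod_list ps)" "set ps \<subseteq> A"
    using prime_inD[OF p] unital_subring_prod_list[OF A] by blast+
  then show ?thesis
  proof (induction ps)
    case Nil
    then show ?case using p by (simp add: prime_in_def)
  next
    case (Cons q ps)
    then show ?case using prime_inD[OF p, of q "prod_list ps"] unital_subring_prod_list[OF A] by auto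
  qed
qed

lemma factors_in_mult:
  assumes "unital_subring A" "factors_in A a u ps" "factors_in A b v qs"
  shows "factors_in A (a * b) (u * v) (ps @ qs)"
proof -
  have "dvd_in A (u * v) 1"
  proof -
    obtain c d where "c \<in> A" "d \<in> A" "1 = u * c" "1 = v * d" using assms by (auto simp: factors_in_def dvd_in_def)
    then have "c * d \<in> A" "1 = u * v * (c * d)" using assms(1) 
      by (auto simp: unital_subringD) (metis mult.assoc mult.commute mult_1)
    then show ?thesis by (auto simp: dvd_in_def)
  qed
  then show ?thesis using assms by (auto simp: factors_in_def unital_subringD mult_ac)
qed

text \<open>A prime p of \<open>c\<close> divides \<open>x * y\<close> for every y in
  \<open>Y\<close> but misses some y, hence divides \<open>x\<close>. Removing p from both
  \<open>c\<close> and \<open>x\<close> preserves the hypotheses, so the primes of \<open>c\<close>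
  are peeled off one by one.\<close>

lemma factors_in_cancel:
  assumes A: "unital_subring A" and "factors_in A c u ps" "x \<in> A" "Y \<subseteq> A"
    and "\<And>p. p \<in> set ps \<Longrightarrow> \<exists>y\<in>Y. \<not> dvd_in A p y"
    and "\<And>y. y \<in> Y \<Longrightarrow> dvd_in A c (x * y)"
  shows "dvd_in A c x"
  using assms(2-)
proof (induction ps arbitrary: c x)
  case Nil
  then obtain v where v: "v \<in> A" "1 = u * v" by (auto simp: factors_in_def dvd_in_def)
  then have "x = c * (v * x)" using Nil(1) by (simp add: factors_in_def flip: mult.assoc)
  then show ?case using v Nil A by (metis dvd_in_def unital_subringD(5))
next
  case (Cons p ps)
  have p: "prime_in A p" "set ps \<subseteq> A" "u \<in> A" using Cons.prems(1) by (auto simp: factors_in_def prime_in_def)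
  then have pps: "u * prod_list ps \<in> A" using A unital_subring_prod_list unital_subringD(5) by blast
  have c: "c = p * (u * prod_list ps)" using Cons.prems(1) by (simp add: factors_in_def mult_ac)
  obtain y where y: "y \<in> Y" "\<not> dvd_in A p y" using Cons.prems(4)[of p] by auto
  have "dvd_in A p c" using c pps by (auto simp: dvd_in_def)
  then have "dvd_in A p (x * y)" using Cons.prems(5)[OF y(1)] dvd_in_trans[OF A] by blast
  then obtain x' where x': "x' \<in> A" "x = p * x'" using prime_inD[OF p(1) Cons.prems(2), of y] y Cons.prems(3) by (auto simp: dvd_in_def)
  have "dvd_in A (u * prod_list ps) x'"
  proof (rule Cons.IH)
    show "factors_in A (u * prod_list ps) u ps" using Cons.prems(1) by (simp add: factors_in_def)
    fix z assume "z \<in> Y"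
    then obtain w where w: "w \<in> A" "x * z = c * w" using Cons.prems(5) by (auto simp: dvd_in_def)
    then have "x' * z = u * prod_list ps * w" using prime_in_nonzero[OF p(1)]
      by (simp add: c x'(2) mult.assoc)
    then show "dvd_in A (u * prod_list ps) (x' * z)" using w(1) by (auto simp: dvd_in_def)
  qed (use Cons.prems x' in auto)
  then obtain w where "w \<in> A" "x' = u * prod_list ps * w" by (auto simp: dvd_in_def)
  then show ?case using x' c by (auto simp: dvd_in_def mult_ac)
qed

section \<open>Gauss's lemma: polynomials in one variable over a factorial subring\<close>

definition polys_over :: "'a::idom set \<Rightarrow> 'a poly set" where
  "polys_over A = {P. \<forall>i. coeff P i \<in> A}"

lemma unital_subring_polys_over: "unital_subring A \<Longrightarrow> unital_subring (polys_over A)"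
  by (auto simp: unital_subring_def polys_over_def coeff_pCons coeff_mult coeff_1 
      intro!: unital_subring_sum unital_subringD split: nat.split)

lemma const_in_polys_over: "unital_subring A \<Longrightarrow> [:a:] \<in> polys_over A \<longleftrightarrow> a \<in> A"
  by (auto simp: polys_over_def coeff_pCons unital_subringD split: nat.splits)

lemma dvd_in_const_iff:
  assumes A: "unital_subring A"
  shows "dvd_in (polys_over A) [:p:] F \<longleftrightarrow> (\<forall>i. dvd_in A p (coeff F i))"
proof
  assume "dvd_in (polys_over A) [:p:] F"
  then show "\<forall>i. dvd_in A p (coeff F i)" by (auto simp: dvd_in_def polys_over_def)
next
  assume *: "\<forall>i. dvd_in A p (coeff F i)"
  \<comment> \<open>A chosen quotient by \<open>p\<close>; the value 0 at 0 is what makes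
    \<open>map_poly g\<close> act coefficientwise.\<close>
  define g where "g a = (if a = 0 then 0 else SOME c. c \<in> A \<and> a = p * c)" for a
  have g: "g (coeff F i) \<in> A \<and> coeff F i = p * g (coeff F i)" for i
  proof (cases "coeff F i = 0")
    case False
    have "\<exists>c. c \<in> A \<and> coeff F i = p * c" using * by (auto simp: dvd_in_def)
    from someI_ex[OF this] show ?thesis using False by (simp add: g_def)
  qed (use A in \<open>simp add: g_def unital_subringD\<close>)
  have "coeff (map_poly g F) i = g (coeff F i)" for i by (simp add: coeff_map_poly g_def)
  then have "map_poly g F \<in> polys_over A" "F = [:p:] * map_poly g F"
    using g by (auto simp: polys_over_def poly_eq_iff)
  then show "dvd_in (polys_over A) [:p:] F" by (auto simp: dvd_in_def)
qed

text \<open>If \<open>p\<close> divides neither factor, take the first coefficients, of indices i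
  and j, that \<open>p\<close> does not divide. Modulo \<open>p\<close> the coefficient of index i +
  j of the product is the product of these two.\<close>

lemma prime_in_const:
  assumes A: "unital_subring A" and p: "prime_in A p"
  shows "prime_in (polys_over A) [:p:]"
  unfolding prime_in_def
proof (intro conjI ballI impI)
  show "[:p:] \<in> polys_over A" "[:p:] \<noteq> 0" "\<not> dvd_in (polys_over A) [:p:] 1"
    using p A by (auto simp: const_in_polys_over prime_in_def dvd_in_const_iff intro!: exI[of _ 0])
  fix F G assume FG: "F \<in> polys_over A" "G \<in> polys_over A" "dvd_in (polys_over A) [:p:] (F * G)"
  show "dvd_in (polys_over A) [:p:] F \<or> dvd_in (polys_over A) [:p:] G"
  proof (rule ccontr)
    assume "\<not> ?thesis"
    then have ex: "\<exists>i. \<not> dvd_in A p (coeff F i)" "\<exists>i. \<not> dvd_in A p (coeff G i)" using A by (auto simp: dvd_in_const_iff)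
    define i where "i = (LEAST i. \<not> dvd_in A p (coeff F i))"
    define j where "j = (LEAST i. \<not> dvd_in A p (coeff G i))"
    have i: "\<not> dvd_in A p (coeff F i)" "\<And>k. k < i \<Longrightarrow> dvd_in A p (coeff F k)"
      using LeastI_ex[OF ex(1)] not_less_Least unfolding i_def by blast+
    have j: "\<not> dvd_in A p (coeff G j)" "\<And>k. k < j \<Longrightarrow> dvd_in A p (coeff G k)"
      using LeastI_ex[OF ex(2)] not_less_Least unfolding j_def by blast+
    have "coeff (F * G) (i + j) = (\<Sum>k\<le>i + j. coeff F k * coeff G (i + j - k))" by (simp add: coeff_mult)
    also have "\<dots> = coeff F i * coeff G j + (\<Sum>k\<in>{..i + j} - {i}. coeff F k * coeff G (i + j - k))"
      by (subst sum.remove[of _ i]) auto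
    finally have eq: "coeff F i * coeff G j
      = coeff (F * G) (i + j) - (\<Sum>k\<in>{..i + j} - {i}. coeff F k * coeff G (i + j - k))" by simp
    have "dvd_in A p (coeff F k * coeff G (i + j - k))" if "k \<in> {..i + j} - {i}" for k
    proof (cases "k < i")
      case True
      then show ?thesis using i(2) FG dvd_in_mult[OF A] by (auto simp: polys_over_def)
    next
      case False
      then have "dvd_in A p (coeff G (i + j - k))" using that j(2) by auto
      then show ?thesis using FG dvd_in_mult[OF A, of p "coeff G (i + j - k)" "coeff F k"] 
        by (auto simp: polys_over_def mult.commute)
    qed
    then have "dvd_in A p (coeff F i * coeff G j)"
      unfolding eq using FG(3) A by (intro dvd_in_diff dvd_in_sum) (auto simp: dvd_in_const_iff)
    moreover have "coeff F i \<in> A" "coeff G j \<in> A" using FG by (auto simp: polys_over_def)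
    ultimately show False using prime_inD[OF p] i j by blast
  qed
qed

lemma factors_in_const:
  assumes A: "unital_subring A" and "factors_in A a u ps"
  shows "factors_in (polys_over A) [:a:] [:u:] (map (\<lambda>p. [:p:]) ps)"
proof -
  have "prod_list (map (\<lambda>p. [:p:]) ps) = [:prod_list ps:]" by (induction ps) auto
  moreover have "dvd_in (polys_over A) [:u:] 1"
    using assms dvd_in_0[OF A] by (auto simp: dvd_in_const_iff factors_in_def coeff_pCons split: nat.split)
  ultimately show ?thesis using assms by (auto simp: factors_in_def const_in_polys_over prime_in_const)
qed

definition primitive_in :: "'a::idom set \<Rightarrow> 'a poly \<Rightarrow> bool" where
  "primitive_in A P \<longleftrightarrow> (\<forall>p. prime_in A p \<longrightarrow> \<not> dvd_in (polys_over A) [:p:] P)"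

text \<open>Prime constants are divided out as long as possible. Each of them divides the leading
  coefficient, so the number of prime factors of that coefficient drops and the process
  stops.\<close>

lemma primitive_part_exists:
  assumes A: "ufd A" and "P \<in> polys_over A" "P \<noteq> 0"
  shows "\<exists>a P0. a \<in> A \<and> a \<noteq> 0 \<and> P0 \<in> polys_over A \<and> P = [:a:] * P0 \<and> primitive_in A P0"
proof -
  have sA: "unital_subring A" using A by (simp add: ufd_def)
  have "lead_coeff P \<in> A" "lead_coeff P \<noteq> 0" using assms by (auto simp: polys_over_def)
  then obtain u ps where "factors_in A (lead_coeff P) u ps" using A by (auto simp: ufd_def)
  then show ?thesis using assms(2-)
  proof (induction "length ps" arbitrary: P u ps rule: less_induct)
    case less
    show ?case
    proof (cases "primitive_in A P")
      case True
      then show ?thesis using less sA by (intro exI[of _ 1] exI[of _ P]) (auto simp: unital_subringD one_pCons[symmetric])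
    next
      case False
      then obtain p where p: "prime_in A p" "dvd_in (polys_over A) [:p:] P" by (auto simp: primitive_in_def)
      then obtain Q where Q: "Q \<in> polys_over A" "P = [:p:] * Q" by (auto simp: dvd_in_def)
      have "Q \<noteq> 0" using Q less by auto
      have lc: "lead_coeff P = p * lead_coeff Q" using Q by (simp add: lead_coeff_mult)
      then have "dvd_in A p (lead_coeff P)" using Q(1) by (auto simp: dvd_in_def polys_over_def)
      then obtain q where q: "q \<in> set ps" "dvd_in A p q"
        using prime_in_dvd_prod_list[OF sA p(1) less.prems(1)] by blast
      moreover have "prime_in A q" using q less.prems(1) by (auto simp: factors_in_def)
      ultimately obtain v where v: "v \<in> A" "dvd_in A v 1" "q = p * v"
        using prime_in_dvd_sym[OF sA p(1)] by blast
      \<comment> \<open>The factor \<open>q\<close> is \<open>p\<close> times a unit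
        \<open>v\<close>: cancelling \<open>p\<close> removes \<open>q\<close> from the list and
        moves \<open>v\<close> into the unit.\<close>
      have "prod_list ps = q * prod_list (remove1 q ps)" using q(1) by (induction ps) (auto simp: mult_ac)
      then have "p * lead_coeff Q = p * (u * v * prod_list (remove1 q ps))"
        using less.prems(1) v lc by (simp add: factors_in_def mult_ac)
      then have lq: "lead_coeff Q = u * v * prod_list (remove1 q ps)" using prime_in_nonzero[OF p(1)] by simp
      have "factors_in A (u * v) (u * v) []"
        using factors_in_mult[OF sA, of u u "[]" v v "[]"] less.prems(1) v by (auto simp: factors_in_def)
      then have "factors_in A (lead_coeff Q) (u * v) (remove1 q ps)"
        using less.prems(1) lq by (auto simp: factors_in_def dest: notin_set_remove1)
      moreover have "length (remove1 q ps) < length ps"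
        using q(1) by (metis One_nat_def Suc_pred length_pos_if_in_set length_remove1 lessI)
      ultimately obtain a P0 where *: "a \<in> A" "a \<noteq> 0" "P0 \<in> polys_over A" "Q = [:a:] * P0" "primitive_in A P0"
        using less.hyps Q(1) \<open>Q \<noteq> 0\<close> by blast
      then show ?thesis using Q(2) p(1) sA prime_in_nonzero[OF p(1)]
        by (intro exI[of _ "p * a"] exI[of _ P0]) (auto simp: unital_subringD prime_in_def mult.commute)
    qed
  qed
qed

text \<open>If \<open>H\<close> divides a T with cofactor Q, then a divides Q H. The primes of a
  remain prime as constant polynomials and none of them divides the primitive \<open>H\<close>, so a
  divides Q and can be cancelled.\<close>

lemma primitive_dvd_const_cancel:
  assumes A: "ufd A" and H: "H \<in> polys_over A" "primitive_in A H" and T: "T \<in> polys_over A"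
    and a: "a \<in> A" "a \<noteq> 0" and dvd: "dvd_in (polys_over A) H ([:a:] * T)"
  shows "dvd_in (polys_over A) H T"
proof -
  have sA: "unital_subring A" using A by (simp add: ufd_def)
  obtain Q where Q: "Q \<in> polys_over A" "[:a:] * T = H * Q" using dvd by (auto simp: dvd_in_def)
  obtain u ps where ps: "factors_in A a u ps" using A a by (auto simp: ufd_def)
  have "dvd_in (polys_over A) [:a:] Q"
  proof (rule factors_in_cancel[OF unital_subring_polys_over[OF sA] factors_in_const[OF sA ps], of _ "{H}"])
    fix p assume "p \<in> set (map (\<lambda>p. [:p:]) ps)"
    then obtain p' where "p = [:p':]" "prime_in A p'" using ps by (auto simp: factors_in_def)
    then show "\<exists>y\<in>{H}. \<not> dvd_in (polys_over A) p y" using H by (auto simp: primitive_in_def)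
  next
    fix y assume "y \<in> {H}"
    then show "dvd_in (polys_over A) [:a:] (Q * y)" using Q T by (metis dvd_inI mult.commute singletonD)
  qed (use Q H in auto)
  then obtain Q' where Q': "Q' \<in> polys_over A" "Q = [:a:] * Q'" by (auto simp: dvd_in_def)
  then have "[:a:] * T = [:a:] * (H * Q')" using Q(2) by (simp add: mult_ac)
  then have "T = H * Q'" using a by (metis mult_cancel_left pCons_eq_0_iff)
  then show ?thesis using Q' by (auto simp: dvd_in_def)
qed

text \<open>Powers of the leading coefficient replace division in a fraction field. A zero remainder
  is a separate case because \<open>H\<close> may be constant.\<close>

lemma pseudo_division_in:
  assumes sA: "unital_subring A" and H: "H \<in> polys_over A" "H \<noteq> 0" and "W \<in> polys_over A"
  shows "\<exists>k Q. Q \<in> polys_over A \<and>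
     ([:lead_coeff H ^ k:] * W - Q * H = 0 \<or> degree ([:lead_coeff H ^ k:] * W - Q * H) < degree H)"
  using assms(4)
proof (induction "degree W" arbitrary: W rule: less_induct)
  case less
  have sB: "unital_subring (polys_over A)" using unital_subring_polys_over[OF sA] .
  show ?case
  proof (cases "W = 0 \<or> degree W < degree H")
    case True
    then show ?thesis using sB by (intro exI[of _ 0]) (auto simp: unital_subringD one_pCons[symmetric])
  next
    case False
    define M where "M = monom (lead_coeff W) (degree W - degree H)"
    define W' where "W' = [:lead_coeff H:] * W - M * H"
    have M: "M \<in> polys_over A" using less.prems sA by (auto simp: M_def polys_over_def unital_subringD)
    have "[:lead_coeff H:] \<in> polys_over A" using sA H by (simp add: const_in_polys_over) (simp add: polys_over_def)
    then have W': "W' \<in> polys_over A" unfolding W'_def using M H less.prems sB by (intro unital_subringD) auto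
    have dM: "degree (M * H) = degree W" using False H by (simp add: M_def degree_mult_eq degree_monom_eq monom_eq_0_iff)
    have "degree W' \<le> degree W" unfolding W'_def using dM by (intro degree_diff_le) auto
    moreover have "coeff W' (degree W) = 0"
      using False by (simp add: W'_def M_def coeff_monom_mult not_less)
    ultimately have "W' = 0 \<or> degree W' < degree W"
      using le_neq_implies_less leading_coeff_0_iff by metis
    then show ?thesis
    proof
      assume "W' = 0"
      then show ?thesis using M by (intro exI[of _ 1] exI[of _ M]) (simp add: W'_def)
    next
      assume "degree W' < degree W"
      then obtain k Q where kQ: "Q \<in> polys_over A"
        "[:lead_coeff H ^ k:] * W' - Q * H = 0 \<or> degree ([:lead_coeff H ^ k:] * W' - Q * H) < degree H"
        using less.hyps W' by blast
      have "[:lead_coeff H ^ k:] \<in> polys_over A" using sA H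
        by (simp add: const_in_polys_over) (simp add: polys_over_def unital_subring_power)
      then have "[:lead_coeff H ^ k:] * M + Q \<in> polys_over A" using M kQ sB by (intro unital_subringD) auto
      moreover have "[:lead_coeff H ^ k:] * W' - Q * H
         = [:lead_coeff H ^ Suc k:] * W - ([:lead_coeff H ^ k:] * M + Q) * H"
        unfolding W'_def by (simp add: algebra_simps smult_diff_right)
      ultimately show ?thesis using kQ(2) by metis
    qed
  qed
qed

text \<open>Gauss's lemma without fraction fields: for \<open>P\<close> not dividing \<open>F\<close>, a nonzero element of least
  degree in the ideal \<open>(P, F)\<close> has, by pseudo-division, a primitive part dividing every element of
  the ideal, so that it must be a constant.\<close>

lemma prime_in_polys_over:
  assumes A: "ufd A" and P: "P \<in> polys_over A" "degree P > 0" "primitive_in A P"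
    and irr: "\<And>S T. S \<in> polys_over A \<Longrightarrow> T \<in> polys_over A \<Longrightarrow> P = S * T \<Longrightarrow> degree S = 0 \<or> degree T = 0"
  shows "prime_in (polys_over A) P"
proof -
  let ?B = "polys_over A"
  have sA: "unital_subring A" using A by (simp add: ufd_def)
  have sB: "unital_subring ?B" using unital_subring_polys_over[OF sA] .
  have P0: "P \<noteq> 0" using P by auto
  have "\<not> dvd_in ?B P 1"
  proof
    assume "dvd_in ?B P 1"
    then obtain Q where "1 = P * Q" by (auto simp: dvd_in_def)
    moreover from this have "Q \<noteq> 0" by auto
    ultimately have "degree P + degree Q = 0" using P0 by (metis degree_1 degree_mult_eq)
    then show False using P by simp
  qed
  moreover have "dvd_in ?B P F \<or> dvd_in ?B P G"
    if F: "F \<in> ?B" and G: "G \<in> ?B" and FG: "dvd_in ?B P (F * G)" for F G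
  proof -
    define S where "S = {U * P + V * F | U V. U \<in> ?B \<and> V \<in> ?B}"
    have PS: "P \<in> S" unfolding S_def using sB by (intro CollectI exI[of _ 1] exI[of _ 0]) (auto simp: unital_subringD)
    have FS: "F \<in> S" unfolding S_def using sB by (intro CollectI exI[of _ 0] exI[of _ 1]) (auto simp: unital_subringD)
    have SB: "S \<subseteq> ?B" unfolding S_def using P F sB by (auto intro!: unital_subringD)
    have lin: "X * W - Y * W' \<in> S" if asm: "W \<in> S" "W' \<in> S" "X \<in> ?B" "Y \<in> ?B" for W W' X Y
    proof -
      obtain U V U' V' where *: "W = U * P + V * F" "W' = U' * P + V' * F" "U \<in> ?B" "V \<in> ?B" "U' \<in> ?B" "V' \<in> ?B"
        using asm unfolding S_def by blast
      have "X * W - Y * W' = (X * U - Y * U') * P + (X * V - Y * V') * F"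
        by (simp add: * algebra_simps)
      moreover have "X * U - Y * U' \<in> ?B" "X * V - Y * V' \<in> ?B" using * that sB by (auto intro!: unital_subringD)
      ultimately show ?thesis unfolding S_def by blast
    qed
    obtain h where h: "h \<in> S" "h \<noteq> 0" "\<And>W. W \<in> S \<Longrightarrow> W \<noteq> 0 \<Longrightarrow> degree h \<le> degree W"
      using ex_has_least_nat[of "\<lambda>W. W \<in> S \<and> W \<noteq> 0" P degree] PS P0 by auto
    have hB: "h \<in> ?B" using h SB by auto
    obtain a h0 where h0: "a \<in> A" "a \<noteq> 0" "h0 \<in> ?B" "h = [:a:] * h0" "primitive_in A h0"
      using primitive_part_exists[OF A hB h(2)] by blast
    have aB: "[:a:] \<in> ?B" using h0 sA by (simp add: const_in_polys_over)
    have h0_dvd: "dvd_in ?B h0 W" if W: "W \<in> S" for W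
    proof -
      have WB: "W \<in> ?B" using W SB by auto
      obtain k Q where kQ: "Q \<in> ?B" "[:lead_coeff h ^ k:] * W - Q * h = 0 \<or> degree ([:lead_coeff h ^ k:] * W - Q * h) < degree h"
        using pseudo_division_in[OF sA hB h(2) WB] by blast
      have cA: "lead_coeff h ^ k \<in> A" using hB sA by (simp add: polys_over_def unital_subring_power)
      then have "[:lead_coeff h ^ k:] * W - Q * h \<in> S" using W h(1) kQ(1) sA by (intro lin) (simp_all add: const_in_polys_over)
      then have "[:lead_coeff h ^ k:] * W - Q * h = 0" using h(3) kQ(2) not_le by blast
      then have "[:lead_coeff h ^ k:] * W = h0 * ([:a:] * Q)" by (simp add: h0(4) mult_ac)
      then have "dvd_in ?B h0 ([:lead_coeff h ^ k:] * W)" using aB kQ(1) sB by (metis dvd_inI unital_subringD(5))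
      then show ?thesis using primitive_dvd_const_cancel[OF A h0(3,5) WB cA] h(2) by simp
    qed
    obtain Q where Q: "Q \<in> ?B" "P = h0 * Q" using h0_dvd[OF PS] by (auto simp: dvd_in_def)
    \<comment> \<open>If \<open>h0\<close> is constant, then so is \<open>h = U * P + V * F\<close>;
      hence \<open>P\<close> divides \<open>h * G\<close> and, being primitive, \<open>G\<close>. If
      \<open>Q\<close> is constant, it is a unit by primitivity of \<open>P\<close>, so
      \<open>P\<close> is associated to \<open>h0\<close>, which divides \<open>F\<close>.\<close>
    consider "degree h0 = 0" | "degree Q = 0" using irr[OF h0(3) Q] by metis
    then show ?thesis
    proof cases
      case 1
      then obtain g' where "h0 = [:g':]" by (meson degree_eq_zeroE)
      then have hg: "h = [:a * g':]" using h0(4) by simp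
      obtain U V where UV: "U \<in> ?B" "V \<in> ?B" "h = U * P + V * F" using h(1) by (auto simp: S_def)
      obtain Z where Z: "Z \<in> ?B" "F * G = P * Z" using FG by (auto simp: dvd_in_def)
      have "h * G = P * (U * G) + V * (F * G)" using UV(3) by (simp add: algebra_simps)
      then have "h * G = P * (U * G + V * Z)" using Z(2) by (simp add: algebra_simps)
      moreover have "U * G + V * Z \<in> ?B" using UV Z G sB by (intro unital_subringD) auto
      ultimately have "dvd_in ?B P ([:a * g':] * G)" using hg by (auto simp: dvd_in_def)
      moreover have "a * g' \<in> A" using hB hg sA by (simp add: const_in_polys_over)
      ultimately have "dvd_in ?B P G" using primitive_dvd_const_cancel[OF A P(1,3) G] h(2) hg by auto
      then show ?thesis ..
    next
      case 2
      then obtain b where b: "Q = [:b:]" by (meson degree_eq_zeroE)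
      have bA: "b \<in> A" "b \<noteq> 0" using Q b sA P0 by (auto simp: const_in_polys_over)
      then obtain u ps where ups: "factors_in A b u ps" using A by (auto simp: ufd_def)
      have "ps = []"
      proof (rule ccontr)
        assume "ps \<noteq> []"
        then obtain p ps' where p: "ps = p # ps'" by (cases ps) auto
        have "prime_in A p" using ups p by (auto simp: factors_in_def)
        moreover have "b = p * (u * prod_list ps')" using ups p by (simp add: factors_in_def mult_ac)
        moreover have "u * prod_list ps' \<in> A"
        proof -
          have "set ps' \<subseteq> A" "u \<in> A" using ups p by (auto simp: factors_in_def prime_in_def)
          then show ?thesis using sA unital_subring_prod_list unital_subringD(5) by blast
        qed
        ultimately have "prime_in A p" "dvd_in A p b" by (auto simp: dvd_in_def)
        moreover have "coeff P i = b * coeff h0 i" for i using Q b by (simp add: mult.commute)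
        ultimately have "dvd_in ?B [:p:] P" using h0(3) unfolding dvd_in_const_iff[OF sA]
          by (simp add: polys_over_def dvd_in_mult[OF sA])
        then show False using P(3) \<open>prime_in A p\<close> by (auto simp: primitive_in_def)
      qed
      then obtain v where v: "v \<in> A" "1 = b * v" using ups by (auto simp: factors_in_def dvd_in_def)
      have "P * [:v:] = h0 * ([:b:] * [:v:])" using Q b by (simp only: mult.assoc)
      also have "[:b:] * [:v:] = 1" using v(2) by (simp add: one_pCons mult.commute)
      finally have "h0 = P * [:v:]" by simp
      then have "dvd_in ?B P h0" using v sA by (metis dvd_inI const_in_polys_over)
      then show ?thesis using h0_dvd[OF FS] dvd_in_trans[OF sB] by blast
    qed
  qed
  ultimately show ?thesis using P P0 by (auto simp: prime_in_def)
qed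

text \<open>Content and primitive part are factored separately. A primitive polynomial of positive
  degree either splits into factors of smaller degree or is prime by
  \<open>prime_in_polys_over\<close>.\<close>

theorem ufd_polys_over:
  assumes A: "ufd A"
  shows "ufd (polys_over A)"
proof -
  let ?B = "polys_over A"
  have sA: "unital_subring A" using A by (simp add: ufd_def)
  have sB: "unital_subring ?B" using unital_subring_polys_over[OF sA] .
  have const: "\<exists>u ps. factors_in ?B [:a:] u ps" if "a \<in> A" "a \<noteq> 0" for a
    using that A factors_in_const[OF sA] unfolding ufd_def by blast
  have "\<exists>u ps. factors_in ?B P u ps" if "P \<in> ?B" "P \<noteq> 0" for P
    using that
  proof (induction "degree P" arbitrary: P rule: less_induct)
    case less
    obtain a P0 where P0: "a \<in> A" "a \<noteq> 0" "P0 \<in> ?B" "P = [:a:] * P0" "primitive_in A P0"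
      using primitive_part_exists[OF A less.prems] by blast
    have deg: "degree P0 = degree P" using P0 by simp
    have nz: "P0 \<noteq> 0" using P0 less.prems by auto
    have "\<exists>u ps. factors_in ?B P0 u ps"
    proof (cases "degree P0 = 0")
      case True
      then obtain c where c: "P0 = [:c:]" by (meson degree_eq_zeroE)
      then show ?thesis using const[of c] P0(3) nz sA by (auto simp: const_in_polys_over)
    next
      case False
      show ?thesis
      proof (cases "\<exists>S T. S \<in> ?B \<and> T \<in> ?B \<and> P0 = S * T \<and> degree S \<noteq> 0 \<and> degree T \<noteq> 0")
        case True
        then obtain S T where ST: "S \<in> ?B" "T \<in> ?B" "P0 = S * T" "degree S \<noteq> 0" "degree T \<noteq> 0" by blast
        have "S \<noteq> 0" "T \<noteq> 0" using nz ST by auto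
        then have "degree S + degree T = degree P" using deg ST(3) by (simp add: degree_mult_eq)
        then have "degree S < degree P" "degree T < degree P" using ST by linarith+
        then show ?thesis using less.hyps ST \<open>S \<noteq> 0\<close> \<open>T \<noteq> 0\<close> factors_in_mult[OF sB] by metis
      next
        case False': False
        then have "prime_in ?B P0" using False P0 by (intro prime_in_polys_over[OF A]) auto
        then have "factors_in ?B P0 1 [P0]" using sB
          by (auto simp: factors_in_def unital_subringD dvd_in_def)
        then show ?thesis by blast
      qed
    qed
    then show ?case using const[OF P0(1,2)] factors_in_mult[OF sB] P0(4) by metis
  qed
  then show ?thesis using sB by (simp add: ufd_def)
qed

text \<open>Injectivity is asked on \<open>B\<close> only: evaluation at a new variable is injective
  on polynomials whose coefficients avoid that variable, but not on all polynomials.\<close>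

lemma ufd_image:
  assumes B: "ufd B" and inj: "\<And>x. x \<in> B \<Longrightarrow> h x = 0 \<Longrightarrow> x = 0"
    and hom: "h 1 = 1" "\<And>x y. x \<in> B \<Longrightarrow> y \<in> B \<Longrightarrow> h (x + y) = h x + h y"
      "\<And>x y. x \<in> B \<Longrightarrow> y \<in> B \<Longrightarrow> h (x * y) = h x * h y"
  shows "ufd (h ` B)"
proof -
  have sB: "unital_subring B" using B by (simp add: ufd_def)
  note [simp] = unital_subringD[OF sB]
  have h0: "h 0 = 0" using hom(2)[of 0 0] by (metis \<open>0 \<in> B\<close> add_0 add_cancel_right_right)
  have neg: "h (- x) = - h x" if "x \<in> B" for x using hom(2)[of x "- x"] that h0 by (simp add: eq_neg_iff_add_eq_0 add.commute)
  have inj': "x = y" if "h x = h y" "x \<in> B" "y \<in> B" for x y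
  proof -
    have "h (x - y) = 0" using hom(2)[of x "- y"] neg that by simp
    then show ?thesis using inj[of "x - y"] that by simp
  qed
  have s: "unital_subring (h ` B)"
    unfolding unital_subring_def
  proof (intro conjI ballI)
    show "0 \<in> h ` B" using h0 by (metis image_eqI \<open>0 \<in> B\<close>)
    show "1 \<in> h ` B" using hom(1) by (metis image_eqI \<open>1 \<in> B\<close>)
  next
    fix a assume "a \<in> h ` B"
    then obtain x where "x \<in> B" "a = h x" by auto
    then show "- a \<in> h ` B" using neg by (intro image_eqI[of _ _ "- x"]) auto
  next
    fix a b assume "a \<in> h ` B" "b \<in> h ` B"
    then obtain x y where *: "x \<in> B" "a = h x" "y \<in> B" "b = h y" by auto
    show "a + b \<in> h ` B" using * hom by (intro image_eqI[of _ _ "x + y"]) auto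
    show "a * b \<in> h ` B" using * hom by (intro image_eqI[of _ _ "x * y"]) auto
  qed
  have dvd: "dvd_in (h ` B) (h x) (h y) \<longleftrightarrow> dvd_in B x y" if "x \<in> B" "y \<in> B" for x y
  proof
    assume "dvd_in (h ` B) (h x) (h y)"
    then obtain c where "c \<in> B" "h y = h x * h c" by (auto simp: dvd_in_def)
    then have "y = x * c" using hom(3) that by (intro inj') auto
    then show "dvd_in B x y" using \<open>c \<in> B\<close> by (auto simp: dvd_in_def)
  qed (use hom(3) that in \<open>auto simp: dvd_in_def\<close>)
  have pr: "prime_in (h ` B) (h p)" if p: "prime_in B p" for p
    unfolding prime_in_def
  proof (intro conjI ballI impI)
    have pB: "p \<in> B" using p by (simp add: prime_in_def)
    show "h p \<in> h ` B" "h p \<noteq> 0" using p inj by (auto simp: prime_in_def)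
    show "\<not> dvd_in (h ` B) (h p) 1" using dvd[OF pB, of 1] p hom(1) by (simp add: prime_in_def)
    fix a b assume "a \<in> h ` B" "b \<in> h ` B" "dvd_in (h ` B) (h p) (a * b)"
    then obtain x y where *: "x \<in> B" "a = h x" "y \<in> B" "b = h y" by auto
    then have "dvd_in B p (x * y)" using \<open>dvd_in (h ` B) (h p) (a * b)\<close> dvd[OF pB, of "x * y"] hom by simp
    then show "dvd_in (h ` B) (h p) a \<or> dvd_in (h ` B) (h p) b"
      using prime_inD[OF p] * dvd[OF pB] by auto
  qed
  have "\<exists>u ps. factors_in (h ` B) a u ps" if a: "a \<in> h ` B" "a \<noteq> 0" for a
  proof -
    obtain x where x: "x \<in> B" "a = h x" "x \<noteq> 0" using a h0 by auto
    then obtain u ps where f: "factors_in B x u ps" using B by (auto simp: ufd_def)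
    have "set ps \<subseteq> B" using f by (auto simp: factors_in_def prime_in_def)
    then have "h (prod_list ps) = prod_list (map h ps)"
      by (induction ps) (auto simp: hom unital_subring_prod_list[OF sB])
    then have "h x = h u * prod_list (map h ps)"
      using f hom(3) unital_subring_prod_list[OF sB \<open>set ps \<subseteq> B\<close>] by (simp add: factors_in_def)
    then have "factors_in (h ` B) a (h u) (map h ps)"
      using f x pr dvd[of u 1] hom(1) by (auto simp: factors_in_def)
    then show ?thesis by blast
  qed
  then show ?thesis using s by (simp add: ufd_def)
qed

section \<open>Factoriality of the polynomial ring in several variables\<close>

definition mpolys_in :: "'n set \<Rightarrow> ('n::{finite,linorder}, 'k::field) mpoly set" where
  "mpolys_in V = {p. \<forall>t\<in>Poly_Mapping.keys p. Poly_Mapping.keys t \<subseteq> V}"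

lemma unital_subring_mpolys_in: "unital_subring (mpolys_in V :: ('n::{finite,linorder}, 'k::field) mpoly set)"
proof -
  have "p * q \<in> mpolys_in V" if "p \<in> mpolys_in V" "q \<in> mpolys_in V" for p q :: "('n, 'k) mpoly"
    unfolding mpolys_in_def
  proof (intro CollectI ballI)
    fix t assume "t \<in> Poly_Mapping.keys (p * q)"
    then obtain a b where "t = a + b" "a \<in> Poly_Mapping.keys p" "b \<in> Poly_Mapping.keys q"
      using keys_mult[of p q] by auto
    then show "Poly_Mapping.keys t \<subseteq> V" using that keys_add[of a b] by (fastforce simp: mpolys_in_def)
  qed
  moreover have "p + q \<in> mpolys_in V" if "p \<in> mpolys_in V" "q \<in> mpolys_in V" for p q :: "('n, 'k) mpoly"
    using that keys_add[of p q] by (auto simp: mpolys_in_def)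
  moreover have "0 \<in> mpolys_in V" "1 \<in> mpolys_in V" by (auto simp: mpolys_in_def)
  moreover have "- p \<in> mpolys_in V" if "p \<in> mpolys_in V" for p :: "('n, 'k) mpoly"
    using that by (simp add: mpolys_in_def)
  ultimately show ?thesis unfolding unital_subring_def by blast
qed

lemma poly_mapping_sum_single: "(\<Sum>t\<in>Poly_Mapping.keys p. Poly_Mapping.single t (Poly_Mapping.lookup p t)) = p"
  by (intro poly_mapping_eqI) (auto simp: lookup_sum lookup_single when_def in_keys_iff)

text \<open>A variable \<open>x\<close> is adjoined by evaluating univariate polynomials over the
  smaller ring at \<open>x\<close>. This is injective because the exponent of \<open>x\<close> in a
  monomial tells which coefficient it came from.\<close>

lemma ufd_mpolys_in: "finite V \<Longrightarrow> ufd (mpolys_in V :: ('n::{finite,linorder}, 'k::field) mpoly set)"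
proof (induction V rule: finite_induct)
  case empty
  have "factors_in (mpolys_in {}) p p []" if p: "p \<in> mpolys_in {}" "p \<noteq> 0" for p :: "('n, 'k) mpoly"
  proof -
    have "homogeneous 0 p" using p by (auto simp: mpolys_in_def homogeneous_def)
    then obtain c where c: "p = Poly_Mapping.single 0 c" using homogeneous_0_imp_const by blast
    then have "c \<noteq> 0" using p by auto
    then have "Poly_Mapping.single 0 (inverse c) \<in> mpolys_in {}" "1 = p * Poly_Mapping.single 0 (inverse c)"
      by (auto simp: c mult_single mpolys_in_def)
    then show ?thesis using p by (auto simp: factors_in_def dvd_in_def)
  qed
  then show ?case unfolding ufd_def using unital_subring_mpolys_in by blast
next
  case (insert x V)
  define X where "X i = (Poly_Mapping.single (Poly_Mapping.single x i) 1 :: ('n, 'k) mpoly)" for i :: nat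
  define h where "h P = poly P (X 1)" for P :: "('n, 'k) mpoly poly"
  have X: "X 1 ^ i = X i" for i by (induction i) (simp_all add: X_def mult_single flip: single_add)
  have h: "h P = (\<Sum>i\<le>degree P. coeff P i * X i)" for P unfolding h_def poly_altdef X ..
  let ?B = "polys_over (mpolys_in V) :: ('n, 'k) mpoly poly set"
  have key: "Poly_Mapping.lookup w x = i"
    if asm: "q \<in> mpolys_in V" "w \<in> Poly_Mapping.keys (q * X i)" for q w i
  proof -
    obtain a where a: "a \<in> Poly_Mapping.keys q" "w = a + Poly_Mapping.single x i"
      using asm(2) keys_mult[of q "X i"] by (auto simp: X_def)
    have "x \<notin> Poly_Mapping.keys a" using asm(1) a(1) insert by (auto simp: mpolys_in_def)
    then show ?thesis using a by (simp add: lookup_add in_keys_iff)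
  qed
  have "ufd (h ` ?B)"
  proof (rule ufd_image[OF ufd_polys_over[OF insert.IH]])
    fix P assume P: "P \<in> ?B" "h P = 0"
    have "Poly_Mapping.lookup (coeff P j) t = 0" for j t
    proof (rule ccontr)
      assume *: "\<not> ?thesis"
      then have t: "t \<in> Poly_Mapping.keys (coeff P j)" by (simp add: in_keys_iff)
      have "Poly_Mapping.keys t \<subseteq> V" using P t by (auto simp: polys_over_def mpolys_in_def)
      then have tx: "Poly_Mapping.lookup t x = 0" using insert by (auto simp: in_keys_iff)
      \<comment> \<open>Only the summand of index \<open>j\<close> in \<open>h P\<close> has
        monomials with exponent \<open>j\<close> at \<open>x\<close>, so the coefficient at
        \<open>?w\<close> isolates that of \<open>t\<close> in \<open>coeff P j\<close>.\<close>
      let ?w = "Poly_Mapping.single x j + t"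
      have "Poly_Mapping.lookup (coeff P i * X i) ?w = 0" if "i \<noteq> j" for i
        using key[of "coeff P i" ?w i] P that tx
        by (auto simp: polys_over_def lookup_add in_keys_iff)
      then have "Poly_Mapping.lookup (h P) ?w = (\<Sum>i\<le>degree P. if i = j then Poly_Mapping.lookup (coeff P j * X j) ?w else 0)"
        unfolding h lookup_sum by (intro sum.cong) auto
      also have "\<dots> = Poly_Mapping.lookup (coeff P j * X j) ?w"
        using * by (cases "j \<le> degree P") (auto simp: coeff_eq_0)
      also have "\<dots> = Poly_Mapping.lookup (coeff P j) t"
        by (simp add: X_def mult.commute[of "coeff P j"] lookup_single_times)
      finally show False using P * by simp
    qed
    then show "P = 0" by (intro poly_eqI poly_mapping_eqI) simp
  qed (auto simp: h_def)
  moreover have "h ` ?B = mpolys_in (insert x V)"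
  proof
    have Xi: "X i \<in> mpolys_in (insert x V)" for i by (auto simp: X_def mpolys_in_def split: if_splits)
    have mono: "mpolys_in V \<subseteq> (mpolys_in (insert x V) :: ('n, 'k) mpoly set)" by (auto simp: mpolys_in_def)
    have "h P \<in> mpolys_in (insert x V)" if "P \<in> ?B" for P
      unfolding h using that mono Xi
      by (intro unital_subring_sum[OF unital_subring_mpolys_in] unital_subringD(5)[OF unital_subring_mpolys_in])
         (auto simp: polys_over_def)
    then show "h ` ?B \<subseteq> mpolys_in (insert x V)" by auto
    show "mpolys_in (insert x V) \<subseteq> h ` ?B"
    proof
      fix p :: "('n, 'k) mpoly" assume p: "p \<in> mpolys_in (insert x V)"
      have sub: "unital_subring (h ` ?B)" using \<open>ufd (h ` ?B)\<close> by (simp add: ufd_def)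
      have "Poly_Mapping.single t c \<in> h ` ?B" if t: "Poly_Mapping.keys t \<subseteq> insert x V" for t c
      proof -
        \<comment> \<open>A monomial is split into its power of \<open>x\<close> and a cofactor free
          of \<open>x\<close>, which is an admissible coefficient.\<close>
        define t' where "t' = Poly_Mapping.update x 0 t"
        define i where "i = Poly_Mapping.lookup t x"
        have tt: "t = t' + Poly_Mapping.single x i"
          by (intro poly_mapping_eqI) (simp add: t'_def i_def lookup_update lookup_add lookup_single when_def)
        have "Poly_Mapping.keys t' \<subseteq> Poly_Mapping.keys t - {x}"
          by (auto simp: t'_def in_keys_iff lookup_update split: if_splits)
        then have "Poly_Mapping.keys t' \<subseteq> V" using t by blast
        then have "monom (Poly_Mapping.single t' c) i \<in> ?B"
          by (auto simp: polys_over_def mpolys_in_def split: if_splits)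
        moreover have "h (monom (Poly_Mapping.single t' c) i) = Poly_Mapping.single t c"
          unfolding h_def poly_monom X by (simp add: X_def mult_single tt)
        ultimately show ?thesis by (metis image_eqI)
      qed
      then have "(\<Sum>t\<in>Poly_Mapping.keys p. Poly_Mapping.single t (Poly_Mapping.lookup p t)) \<in> h ` ?B"
        using p by (intro unital_subring_sum[OF sub]) (auto simp: mpolys_in_def)
      then show "p \<in> h ` ?B" by (simp add: poly_mapping_sum_single)
    qed
  qed
  ultimately show ?case by simp
qed

lemma prime_in_UNIV: "prime_in UNIV p \<longleftrightarrow> prime_elem p"
  by (auto simp: prime_in_def prime_elem_def dvd_in_def dvd_def)

lemma dvd_in_UNIV: "dvd_in UNIV p q \<longleftrightarrow> p dvd q"
  by (auto simp: dvd_in_def dvd_def)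

lemma mpoly_prime_factorization:
  fixes p :: "('n::{finite,linorder}, 'k::field) mpoly"
  assumes "p \<noteq> 0"
  obtains u ps where "u dvd 1" "\<And>q. q \<in> set ps \<Longrightarrow> prime_elem q" "p = u * prod_list ps"
proof -
  have "mpolys_in UNIV = (UNIV :: ('n, 'k) mpoly set)" by (auto simp: mpolys_in_def)
  then have "ufd (UNIV :: ('n, 'k) mpoly set)" using ufd_mpolys_in[of "UNIV :: 'n set", where 'k = 'k] by simp
  then obtain u ps where "factors_in UNIV p u ps" using assms by (auto simp: ufd_def)
  then show ?thesis using that by (auto simp: factors_in_def prime_in_UNIV dvd_in_UNIV)
qed

text \<open>In the applications \<open>Y\<close> consists of the entries of a vector without common
  prime factor, and the lemma clears the denominator \<open>c\<close> of a factor of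
  proportionality.\<close>

lemma mpoly_primitive_dvd:
  fixes c x :: "('n::{finite,linorder}, 'k::field) mpoly"
  assumes "c \<noteq> 0" and "\<And>p. prime_elem p \<Longrightarrow> \<exists>y\<in>Y. \<not> p dvd y" and "\<And>y. y \<in> Y \<Longrightarrow> c dvd x * y"
  shows "c dvd x"
proof -
  obtain u ps where ps: "u dvd 1" "\<And>q. q \<in> set ps \<Longrightarrow> prime_elem q" "c = u * prod_list ps"
    using mpoly_prime_factorization[OF assms(1)] by blast
  have "unital_subring (UNIV :: ('n, 'k) mpoly set)" by (simp add: unital_subring_def)
  moreover have "factors_in UNIV c u ps" using ps by (auto simp: factors_in_def prime_in_UNIV dvd_in_UNIV)
  ultimately have "dvd_in UNIV c x"
    by (rule factors_in_cancel[where Y = Y]) (use assms ps in \<open>auto simp: dvd_in_UNIV\<close>)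
  then show ?thesis by (simp add: dvd_in_UNIV)
qed

lemma mpoly_prime_divisor_exists:
  fixes p :: "('n::{finite,linorder}, 'k::field) mpoly"
  assumes "p \<noteq> 0" "\<not> p dvd 1"
  obtains q where "prime_elem q" "q dvd p"
proof -
  obtain u ps where ps: "u dvd 1" "\<And>q. q \<in> set ps \<Longrightarrow> prime_elem q" "p = u * prod_list ps"
    using mpoly_prime_factorization[OF assms(1)] by blast
  with assms(2) obtain q qs where "ps = q # qs" by (cases ps) auto
  then show ?thesis using ps that[of q] by auto
qed


section \<open>Graded submodules of free modules\<close>

interpretation fmod: module "fscale :: 'r::comm_ring_1 \<Rightarrow> _"
  by (rule module_fscale)

text \<open>Homogeneity in the graded free module
  \<open>R(-a\<^sub>0) \<oplus> R(-a\<^sub>1) \<oplus> \<dots>\<close>.\<close>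

definition hvec :: "(nat \<Rightarrow> nat) \<Rightarrow> nat \<Rightarrow> (nat \<Rightarrow>\<^sub>0 ('n::finite, 'k::zero) mpoly) \<Rightarrow> bool" where
  "hvec a j v \<longleftrightarrow>
     (\<forall>i. \<forall>t\<in>Poly_Mapping.keys (Poly_Mapping.lookup v i). monomial_degree t + a i = j)"

definition vpart :: "(nat \<Rightarrow> nat) \<Rightarrow> nat \<Rightarrow> (nat \<Rightarrow>\<^sub>0 ('n::finite, 'k::zero) mpoly) \<Rightarrow> (nat \<Rightarrow>\<^sub>0 ('n, 'k) mpoly)" where
  "vpart a j v = Poly_Mapping.mapp (\<lambda>i. hpart (a i) j) v"

text \<open>R^m inside the free module of countable rank, the type in which
  \<open>projective\<close> and the resolutions are formulated.\<close>

definition free :: "nat \<Rightarrow> (nat \<Rightarrow>\<^sub>0 'r::zero) set" where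
  "free m = {v. Poly_Mapping.keys v \<subseteq> {..<m}}"

definition graded_submodule ::
  "(nat \<Rightarrow> nat) \<Rightarrow> nat \<Rightarrow> (nat \<Rightarrow>\<^sub>0 ('n::{finite,linorder}, 'k::field) mpoly) set \<Rightarrow> bool" where
  "graded_submodule a m M \<longleftrightarrow> module.subspace fscale M \<and> M \<subseteq> free m \<and> (\<forall>v\<in>M. \<forall>j. vpart a j v \<in> M)"

lemma mem_free_iff: "v \<in> free m \<longleftrightarrow> (\<forall>i\<ge>m. Poly_Mapping.lookup v i = 0)"
  by (auto simp: free_def in_keys_iff subset_iff) (meson not_le)

lemma subspace_free: "module.subspace fscale (free m :: (nat \<Rightarrow>\<^sub>0 'r::comm_ring_1) set)"
  by (auto simp: fmod.subspace_def mem_free_iff lookup_add lookup_fscale)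

lemma single_in_free: "i < m \<Longrightarrow> Poly_Mapping.single i p \<in> free m"
  by (auto simp: free_def)

lemma lookup_vpart: "Poly_Mapping.lookup (vpart a j v) i = hpart (a i) j (Poly_Mapping.lookup v i)"
  by (auto simp: vpart_def lookup_mapp when_def in_keys_iff)

lemma vpart_hvec: "hvec a j v \<Longrightarrow> vpart a j v = v"
  by (intro poly_mapping_eqI) (simp add: lookup_vpart hvec_def hpart_idI)

lemma vpart_zero [simp]: "vpart a j 0 = 0"
  by (intro poly_mapping_eqI) (simp add: lookup_vpart)

lemma hvec_vpart: "hvec a j (vpart a j v)"
  by (auto simp: hvec_def lookup_vpart keys_hpart)

text \<open>With homogeneous \<open>k l\<close>, taking the part of degree j acts on the
  coefficients alone. Hence relations and representations can be replaced by homogeneous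
  ones.\<close>

lemma vpart_sum_fscale:
  fixes k :: "'a \<Rightarrow> (nat \<Rightarrow>\<^sub>0 ('n::{finite,linorder}, 'k::field) mpoly)"
  assumes "\<And>l. l \<in> L \<Longrightarrow> hvec a (b l) (k l)"
  shows "vpart a j (\<Sum>l\<in>L. fscale (c l) (k l)) = (\<Sum>l\<in>L. fscale (hpart (b l) j (c l)) (k l))"
proof (rule poly_mapping_eqI)
  fix i show "Poly_Mapping.lookup (vpart a j (\<Sum>l\<in>L. fscale (c l) (k l))) i
      = Poly_Mapping.lookup (\<Sum>l\<in>L. fscale (hpart (b l) j (c l)) (k l)) i"
    using assms by (auto simp: lookup_vpart lookup_sum lookup_fscale hpart_sum hvec_def intro!: sum.cong hpart_mult)
qed

lemma hvec_add:
  fixes v w :: "nat \<Rightarrow>\<^sub>0 ('n::{finite,linorder}, 'k::field) mpoly"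
  shows "hvec a j v \<Longrightarrow> hvec a j w \<Longrightarrow> hvec a j (v + w)"
  unfolding hvec_def lookup_add using keys_add by (metis (no_types, lifting) UnE subsetD)

lemma hvec_uminus:
  fixes v :: "nat \<Rightarrow>\<^sub>0 ('n::{finite,linorder}, 'k::field) mpoly"
  shows "hvec a j v \<Longrightarrow> hvec a j (- v)"
  by (simp add: hvec_def)

lemma hvec_fscale:
  fixes v :: "nat \<Rightarrow>\<^sub>0 ('n::{finite,linorder}, 'k::field) mpoly"
  assumes "homogeneous i p" "hvec a j v"
  shows "hvec a (i + j) (fscale p v)"
  unfolding hvec_def lookup_fscale
proof (intro allI ballI)
  fix l t assume "t \<in> Poly_Mapping.keys (p * Poly_Mapping.lookup v l)"
  then show "monomial_degree t + a l = i + j"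
    by (elim keys_mult_degree) (use assms in \<open>auto simp: hvec_def homogeneous_def\<close>)
qed

lemma vec_eq_sum_vpart:
  fixes v :: "nat \<Rightarrow>\<^sub>0 ('n::{finite,linorder}, 'k::field) mpoly"
  obtains N where "v = (\<Sum>j\<le>N. vpart a j v)"
proof -
  define N where "N = (\<Sum>i\<in>Poly_Mapping.keys v. tdeg (Poly_Mapping.lookup v i) + a i)"
  have "Poly_Mapping.lookup (Poly_Mapping.lookup v i) t
      = (\<Sum>j\<le>N. Poly_Mapping.lookup (hpart (a i) j (Poly_Mapping.lookup v i)) t)" for i t
  proof (cases "t \<in> Poly_Mapping.keys (Poly_Mapping.lookup v i)")
    case True
    then have "i \<in> Poly_Mapping.keys v" by (metis empty_iff in_keys_iff keys_zero)
    then have "tdeg (Poly_Mapping.lookup v i) + a i \<le> N"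
      unfolding N_def by (intro member_le_sum) auto
    then have "monomial_degree t + a i \<le> N" using monomial_degree_le_tdeg[OF True] by simp
    then show ?thesis by (auto simp: lookup_hpart when_def)
  qed (auto simp: lookup_hpart in_keys_iff)
  then have "v = (\<Sum>j\<le>N. vpart a j v)"
    by (intro poly_mapping_eqI) (simp add: lookup_sum lookup_vpart)
  then show ?thesis by (rule that)
qed

section \<open>Dickson's lemma and finite generation of graded submodules\<close>

lemma nat_mono_subseq:
  fixes s :: "nat \<Rightarrow> nat"
  obtains f :: "nat \<Rightarrow> nat" where "strict_mono f" "mono (s \<circ> f)"
proof -
  obtain f where f: "strict_mono f" "monoseq (\<lambda>n. s (f n))" using seq_monosub by blast
  show ?thesis
  proof (cases "\<forall>m n. m \<le> n \<longrightarrow> s (f m) \<le> s (f n)")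
    case True
    then show ?thesis using f(1) that[of f] by (simp add: mono_def)
  next
    case False
    then have dec: "s (f n) \<le> s (f m)" if "m \<le> n" for m n using f(2) that by (auto simp: monoseq_def)
    obtain N where N: "\<And>n. s (f N) \<le> s (f n)"
      using ex_has_least_nat[of "\<lambda>_. True" 0 "\<lambda>n. s (f n)"] by auto
    \<comment> \<open>The subsequence is non-increasing and attains its minimum at \<open>N\<close>,
      so its tail is constant.\<close>
    have "s (f (N + n)) = s (f N)" for n using dec[of N "N + n"] N[of "N + n"] by simp
    then have "mono (s \<circ> (\<lambda>n. f (N + n)))" by (auto simp: mono_def)
    moreover have "strict_mono (\<lambda>n. f (N + n))" using f(1) by (simp add: strict_mono_def)
    ultimately show ?thesis using that by blast
  qed
qed

lemma dickson_mono_subseq: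
  fixes s :: "nat \<Rightarrow> 'a \<Rightarrow> nat"
  assumes "finite V"
  shows "\<exists>f :: nat \<Rightarrow> nat. strict_mono f \<and> (\<forall>x\<in>V. mono (\<lambda>n. s (f n) x))"
  using assms
proof (induction V rule: finite_induct)
  case empty
  show ?case by (auto intro!: exI[of _ id] simp: strict_mono_def)
next
  case (insert x V)
  then obtain f :: "nat \<Rightarrow> nat" where f: "strict_mono f" "\<And>y. y \<in> V \<Longrightarrow> mono (\<lambda>n. s (f n) y)" by blast
  obtain g :: "nat \<Rightarrow> nat" where g: "strict_mono g" "mono ((\<lambda>n. s (f n) x) \<circ> g)" using nat_mono_subseq by blast
  have "strict_mono (f \<circ> g)" using f(1) g(1) by (rule strict_mono_o)
  moreover have "mono (\<lambda>n. s ((f \<circ> g) n) y)" if "y \<in> insert x V" for y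
  proof (cases "y = x")
    case False
    then show ?thesis using that f(2)[of y] strict_mono_mono[OF g(1)] by (simp add: mono_def)
  qed (use g(2) in \<open>simp add: comp_def\<close>)
  ultimately show ?case by blast
qed

text \<open>\<open>T0\<close> consists of the elements minimal for divisibility. If it were
  infinite, a sequence of distinct members would have a subsequence along which every exponent is
  monotone, and one member would divide another.\<close>

lemma dickson:
  fixes T :: "('n::finite \<Rightarrow>\<^sub>0 nat) set"
  obtains T0 where "finite T0" "T0 \<subseteq> T" "\<And>t. t \<in> T \<Longrightarrow> \<exists>t0\<in>T0. \<exists>u. t = t0 + u"
proof -
  define T0 where "T0 = {t \<in> T. \<forall>t'\<in>T. \<forall>u. t = t' + u \<longrightarrow> t' = t}"
  have "finite T0"
  proof (rule ccontr)
    assume "infinite T0"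
    then obtain s :: "nat \<Rightarrow> _" where s: "inj s" "range s \<subseteq> T0"
      using infinite_countable_subset by blast
    obtain f :: "nat \<Rightarrow> nat" where f: "strict_mono f" "\<And>x. mono (\<lambda>n. Poly_Mapping.lookup (s (f n)) x)"
      using dickson_mono_subseq[OF finite_class.finite_UNIV, of "\<lambda>n. Poly_Mapping.lookup (s n)"] by auto
    have "s (f 1) = s (f 0) + (s (f 1) - s (f 0))"
      by (intro poly_mapping_eqI) (use monoD[OF f(2), of 0 1] in \<open>simp add: lookup_add lookup_minus\<close>)
    then have "s (f 0) = s (f 1)" using s(2) unfolding T0_def by blast
    moreover have "f 0 \<noteq> f 1" using strict_monoD[OF f(1), of 0 1] by simp
    ultimately show False using s(1) by (simp add: inj_eq)
  qed
  moreover have "\<exists>t0\<in>T0. \<exists>u. t = t0 + u" if "t \<in> T" for t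
    using that
  proof (induction "monomial_degree t" arbitrary: t rule: less_induct)
    case less
    show ?case
    proof (cases "t \<in> T0")
      case True
      then show ?thesis by (metis add.right_neutral)
    next
      case False
      then obtain t' u where t': "t' \<in> T" "t = t' + u" "t' \<noteq> t" using less.prems unfolding T0_def by blast
      then have "u \<noteq> 0" by auto
      then have "monomial_degree u \<noteq> 0" by (simp add: monomial_degree_eq_0_iff)
      then have "monomial_degree t' < monomial_degree t" using t'(2) by (simp add: monomial_degree_add)
      from less.hyps[OF this t'(1)] show ?thesis using t'(2) by (metis add.assoc)
    qed
  qed
  ultimately show ?thesis using that unfolding T0_def by blast
qed

lemma finite_monomials: "finite {t :: 'n::finite \<Rightarrow>\<^sub>0 nat. monomial_degree t + s = j}"
proof (rule finite_subset)
  show "{t :: 'n \<Rightarrow>\<^sub>0 nat. monomial_degree t + s = j}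
     \<subseteq> Abs_poly_mapping ` (PiE UNIV (\<lambda>_. {..j}))"
  proof
    fix t :: "'n \<Rightarrow>\<^sub>0 nat" assume "t \<in> {t. monomial_degree t + s = j}"
    then have "Poly_Mapping.lookup t x \<le> j" for x
      using member_le_sum[of x UNIV "Poly_Mapping.lookup t"] by (simp add: monomial_degree_def)
    then show "t \<in> Abs_poly_mapping ` (PiE UNIV (\<lambda>_. {..j}))"
      by (intro image_eqI[of _ _ "Poly_Mapping.lookup t"]) auto
  qed
qed (intro finite_imageI finite_PiE; simp)

lemma keys_single_times:
  fixes p :: "('n::finite, 'k::field) mpoly"
  assumes "t \<in> Poly_Mapping.keys (Poly_Mapping.single s c * p)"
  shows "\<exists>u\<in>Poly_Mapping.keys p. t = s + u"
  using assms keys_mult[of "Poly_Mapping.single s c" p] by (auto split: if_splits)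

text \<open>Reduction with respect to leading monomials of the last coordinate; Dickson's lemma provides
  finitely many of them, and only finitely many monomials occur in each degree.\<close>

lemma graded_submodule_finite_gen:
  "graded_submodule a m M \<Longrightarrow> \<exists>G. finite G \<and> G \<subseteq> M \<and> (\<forall>g\<in>G. \<exists>j. hvec a j g) \<and> module.span fscale G = M"
proof (induction m arbitrary: M)
  case 0
  have "v = 0" if "v \<in> M" for v
    using 0 that by (intro poly_mapping_eqI) (auto simp: graded_submodule_def mem_free_iff)
  moreover have "0 \<in> M" using 0 fmod.subspace_0 by (auto simp: graded_submodule_def)
  ultimately show ?case by (intro exI[of _ "{}"]) auto
next
  case (Suc m)
  have sM: "fmod.subspace M" and MF: "M \<subseteq> free (Suc m)" and Mv: "\<And>v j. v \<in> M \<Longrightarrow> vpart a j v \<in> M"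
    using Suc.prems by (auto simp: graded_submodule_def)
  have "graded_submodule a m (M \<inter> free m)"
    unfolding graded_submodule_def
    using fmod.subspace_inter[OF sM subspace_free] Mv by (auto simp: mem_free_iff lookup_vpart)
  then obtain G' where G': "finite G'" "G' \<subseteq> M \<inter> free m" "\<And>g. g \<in> G' \<Longrightarrow> \<exists>j. hvec a j g"
    "fmod.span G' = M \<inter> free m" using Suc.IH by meson
  \<comment> \<open>The maximum refers to the linear order on monomials; reduction works because
    that order is compatible with addition.\<close>
  define lm where "lm v = Max (Poly_Mapping.keys (Poly_Mapping.lookup v m))" for v :: "nat \<Rightarrow>\<^sub>0 ('a, 'b) mpoly"
  define H where "H = {v \<in> M. Poly_Mapping.lookup v m \<noteq> 0 \<and> (\<exists>j. hvec a j v)}"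
  obtain T0 where T0: "finite T0" "T0 \<subseteq> lm ` H" "\<And>t. t \<in> lm ` H \<Longrightarrow> \<exists>t0\<in>T0. \<exists>u. t = t0 + u"
    using dickson by blast
  then obtain G'' where G'': "G'' \<subseteq> H" "finite G''" "T0 = lm ` G''"
    using finite_subset_image by metis
  let ?G = "G' \<union> G''"
  have lm_in: "lm v \<in> Poly_Mapping.keys (Poly_Mapping.lookup v m)" if "Poly_Mapping.lookup v m \<noteq> 0" for v
    unfolding lm_def using that by (intro Max_in) auto
  have lm_ge: "t \<le> lm v" if "t \<in> Poly_Mapping.keys (Poly_Mapping.lookup v m)" for v t
    unfolding lm_def using that by (intro Max_ge) auto
  have hom: "v \<in> fmod.span ?G" if "v \<in> M" "hvec a j v" for v j
    using that
  proof (induction "card {u. monomial_degree u + a m = j \<and> u < lm v}" arbitrary: v rule: less_induct)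
    case less
    have span': "w \<in> fmod.span ?G" if "w \<in> M" "Poly_Mapping.lookup w m = 0" for w
    proof -
      have "w \<in> free m" using that MF by (auto simp: mem_free_iff) (metis Suc_leI le_neq_implies_less subsetD mem_free_iff)
      then show ?thesis using G'(4) that fmod.span_mono[of G' ?G] by auto
    qed
    show ?case
    proof (cases "Poly_Mapping.lookup v m = 0")
      case True
      then show ?thesis using span' less.prems by blast
    next
      case False
      then have "v \<in> H" using less.prems by (auto simp: H_def)
      then obtain g s where g: "g \<in> G''" "lm v = lm g + s" using T0(3) G''(3) by blast
      then have gH: "g \<in> M" "Poly_Mapping.lookup g m \<noteq> 0" using G'' by (auto simp: H_def)
      obtain jg where jg: "hvec a jg g" using g G'' by (auto simp: H_def)
      define c where "c = Poly_Mapping.lookup (Poly_Mapping.lookup v m) (lm v)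
                         / Poly_Mapping.lookup (Poly_Mapping.lookup g m) (lm g)"
      define q where "q = Poly_Mapping.single s c"
      define w where "w = v + - fscale q g"
      have deg: "monomial_degree (lm v) + a m = j" "monomial_degree (lm g) + a m = jg"
        using less.prems(2) jg lm_in False gH(2) by (auto simp: hvec_def)
      have "monomial_degree s + jg = j" using deg g(2) by (simp add: monomial_degree_add)
      then have "hvec a j (fscale q g)" using hvec_fscale[OF homogeneous_single jg, of s c] by (simp add: q_def)
      then have hw: "hvec a j w" unfolding w_def using less.prems(2) by (intro hvec_add hvec_uminus)
      have wM: "w \<in> M" unfolding w_def using less.prems(1) gH(1) sM
        by (intro fmod.subspace_add fmod.subspace_neg fmod.subspace_scale)
      have "w \<in> fmod.span ?G"
      proof (cases "Poly_Mapping.lookup w m = 0")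
        case True
        then show ?thesis using span' wM by blast
      next
        case wm: False
        have lw: "Poly_Mapping.lookup w m = Poly_Mapping.lookup v m - q * Poly_Mapping.lookup g m"
          by (simp add: w_def lookup_minus lookup_fscale)
        have "lm w \<le> lm v"
        proof -
          have "lm w \<in> Poly_Mapping.keys (Poly_Mapping.lookup v m) \<union> Poly_Mapping.keys (q * Poly_Mapping.lookup g m)"
            using lm_in[OF wm] unfolding lw by (auto simp: in_keys_iff lookup_minus)
          then show ?thesis
          proof
            assume "lm w \<in> Poly_Mapping.keys (q * Poly_Mapping.lookup g m)"
            then obtain u where "u \<in> Poly_Mapping.keys (Poly_Mapping.lookup g m)" "lm w = s + u"
              unfolding q_def using keys_single_times by blast
            then show ?thesis using lm_ge[of u g] g(2) by (simp add: add.commute add_left_mono)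
          qed (rule lm_ge)
        qed
        moreover have "lm w \<noteq> lm v"
        proof
          assume "lm w = lm v"
          moreover have "Poly_Mapping.lookup (q * Poly_Mapping.lookup g m) (lm v)
              = c * Poly_Mapping.lookup (Poly_Mapping.lookup g m) (lm g)"
            unfolding q_def g(2) by (subst add.commute) (rule lookup_single_times)
          ultimately have "Poly_Mapping.lookup (Poly_Mapping.lookup w m) (lm w) = 0"
            using lm_in[OF gH(2)] unfolding lw by (simp add: lookup_minus c_def in_keys_iff)
          then show False using lm_in[OF wm] by (simp add: in_keys_iff)
        qed
        ultimately have lt: "lm w < lm v" by simp
        have "monomial_degree (lm w) + a m = j" using hw lm_in[OF wm] by (auto simp: hvec_def)
        then have "{u. monomial_degree u + a m = j \<and> u < lm w} \<subset> {u. monomial_degree u + a m = j \<and> u < lm v}"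
          using lt by auto
        then have "card {u. monomial_degree u + a m = j \<and> u < lm w} < card {u. monomial_degree u + a m = j \<and> u < lm v}"
          by (intro psubset_card_mono finite_subset[OF _ finite_monomials[of "a m" j]]) auto
        then show ?thesis using less.hyps wM hw by blast
      qed
      moreover have "fscale q g \<in> fmod.span ?G" using g(1) by (intro fmod.span_scale fmod.span_base) auto
      ultimately have "w + fscale q g \<in> fmod.span ?G" by (rule fmod.span_add)
      then show ?thesis by (simp add: w_def)
    qed
  qed
  have "v \<in> fmod.span ?G" if "v \<in> M" for v
  proof -
    obtain N where N: "v = (\<Sum>j\<le>N. vpart a j v)" using vec_eq_sum_vpart .
    have "(\<Sum>j\<le>N. vpart a j v) \<in> fmod.span ?G"
      using hom Mv that hvec_vpart by (intro fmod.span_sum) blast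
    then show ?thesis using N by simp
  qed
  moreover have GM: "?G \<subseteq> M" using G' G'' by (auto simp: H_def)
  moreover have "fmod.span ?G \<subseteq> M" using fmod.span_minimal[OF GM sM] .
  moreover have "\<And>g. g \<in> ?G \<Longrightarrow> \<exists>j. hvec a j g" using G' G'' by (auto simp: H_def)
  ultimately show ?case using G'(1) G''(2) by (intro exI[of _ ?G]) blast
qed

text \<open>Minimality takes the form needed later: no relation has a coefficient with nonzero
  constant term, that is, all relations lie in \<mm>R^r. A homogeneous generating set of least
  cardinality, sorted by degree, has this property.\<close>

lemma minimal_homogeneous_generators:
  fixes M :: "(nat \<Rightarrow>\<^sub>0 ('n::{finite,linorder}, 'k::field) mpoly) set"
  assumes M: "graded_submodule a m M"
  obtains r :: nat and k b where "\<And>l. l < r \<Longrightarrow> k l \<in> M" "\<And>l. l < r \<Longrightarrow> hvec a (b l) (k l)"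
    "\<And>l l'. l \<le> l' \<Longrightarrow> l' < r \<Longrightarrow> b l \<le> b l'"
    "\<And>v. v \<in> M \<Longrightarrow> \<exists>c. v = (\<Sum>l<r. fscale (c l) (k l))"
    "\<And>c l. (\<Sum>l<r. fscale (c l) (k l)) = 0 \<Longrightarrow> l < r \<Longrightarrow> Poly_Mapping.lookup (c l) 0 = (0::'k)"
proof -
  let ?P = "\<lambda>G. finite G \<and> G \<subseteq> M \<and> (\<forall>g\<in>G. \<exists>j. hvec a j g) \<and> fmod.span G = M"
  from graded_submodule_finite_gen[OF M] obtain G0 where "?P G0" ..
  from ex_has_least_nat[of ?P, OF this, of card]
  obtain G where G_min: "?P G \<and> (\<forall>G'. ?P G' \<longrightarrow> card G \<le> card G')" ..
  have G: "?P G" by (rule G_min[THEN conjunct1])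
  have min: "card G \<le> card G'" if "?P G'" for G' by (rule G_min[THEN conjunct2, THEN spec, THEN mp, OF that])
  obtain b where b: "\<And>g. g \<in> G \<Longrightarrow> hvec a (b g) g" using G by metis
  obtain ys where ys: "set ys = G" "distinct ys" using finite_distinct_list G by blast
  define xs where "xs = sort_key b ys"
  have xs: "set xs = G" "distinct xs" "sorted (map b xs)" using ys by (simp_all add: xs_def)
  have reindex: "(\<Sum>l<length xs. f (xs ! l)) = sum f G" for f :: "_ \<Rightarrow> (nat \<Rightarrow>\<^sub>0 ('n, 'k) mpoly)"
    using sum.reindex_bij_betw[OF bij_betw_nth[OF xs(2) refl refl], of f] xs(1) by simp
  have inG: "xs ! l \<in> G" if "l < length xs" for l using xs(1) that by auto
  show ?thesis
  proof (rule that[of "length xs" "\<lambda>l. xs ! l" "\<lambda>l. b (xs ! l)"])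
    fix l assume l: "l < length xs"
    show "xs ! l \<in> M" "hvec a (b (xs ! l)) (xs ! l)" using inG[OF l] G b by auto
  next
    fix l l' assume "l \<le> l'" "l' < length xs"
    then show "b (xs ! l) \<le> b (xs ! l')" using sorted_nth_mono[OF xs(3), of l l'] by simp
  next
    fix v assume "v \<in> M"
    then have "v \<in> fmod.span G" using G by simp
    then obtain c where "v = (\<Sum>g\<in>G. fscale (c g) g)" using G fmod.span_finite[of G] by auto
    then show "\<exists>c. v = (\<Sum>l<length xs. fscale (c l) (xs ! l))"
      using reindex[of "\<lambda>g. fscale (c g) g"] by (intro exI[of _ "\<lambda>l. c (xs ! l)"]) simp
  next
    fix c l assume rel: "(\<Sum>l<length xs. fscale (c l) (xs ! l)) = 0" and l: "l < length xs"
    show "Poly_Mapping.lookup (c l) 0 = (0::'k)"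
    proof (rule ccontr)
      assume nz: "Poly_Mapping.lookup (c l) 0 \<noteq> 0"
      let ?j = "b (xs ! l)"
      \<comment> \<open>In the part of the relation of degree \<open>b (xs ! l)\<close>, the
        coefficient of \<open>xs ! l\<close> is its nonzero constant term, hence invertible, and
        this generator is redundant.\<close>
      define c' where "c' i = hpart (b (xs ! i)) ?j (c i)" for i
      have "(\<Sum>i<length xs. fscale (c' i) (xs ! i)) = vpart a ?j (\<Sum>l<length xs. fscale (c l) (xs ! l))"
        unfolding c'_def using b inG by (subst vpart_sum_fscale[of _ a "\<lambda>i. b (xs ! i)"]) auto
      also have "\<dots> = 0" using rel by simp
      finally have rel': "(\<Sum>i<length xs. fscale (c' i) (xs ! i)) = 0" .
      have c'l: "c' l = Poly_Mapping.single 0 (Poly_Mapping.lookup (c l) 0)"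
        unfolding c'_def
        by (intro poly_mapping_eqI) (auto simp: lookup_hpart lookup_single when_def monomial_degree_eq_0_iff)
      let ?G' = "G - {xs ! l}"
      have "fscale (c' l) (xs ! l) = - (\<Sum>i\<in>{..<length xs} - {l}. fscale (c' i) (xs ! i))"
        using rel' l by (subst (asm) sum.remove[of _ l]) (auto simp: eq_neg_iff_add_eq_0)
      moreover have "(\<Sum>i\<in>{..<length xs} - {l}. fscale (c' i) (xs ! i)) \<in> fmod.span ?G'"
        using inG xs(2) l by (intro fmod.span_sum fmod.span_scale fmod.span_base) (auto simp: nth_eq_iff_index_eq)
      ultimately have "fscale (c' l) (xs ! l) \<in> fmod.span ?G'" by (simp add: fmod.span_neg)
      then have "fscale (Poly_Mapping.single 0 (inverse (Poly_Mapping.lookup (c l) 0))) (fscale (c' l) (xs ! l)) \<in> fmod.span ?G'"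
        by (rule fmod.span_scale)
      then have "xs ! l \<in> fmod.span ?G'" using nz by (simp add: c'l mult_single)
      then have "G \<subseteq> fmod.span ?G'" using fmod.span_superset[of ?G'] by blast
      moreover have "?G' \<subseteq> fmod.span G" using fmod.span_superset[of G] by blast
      ultimately have "fmod.span ?G' = M" using G by (metis fmod.span_eq)
      then have "card G \<le> card ?G'" using G by (intro min) auto
      moreover have "card ?G' < card G" using G inG[OF l] by (intro psubset_card_mono) auto
      ultimately show False by simp
    qed
  qed
qed


section \<open>Comparison of projective resolutions\<close>

lemma module_hom_on_zero:
  assumes "module_hom_on s t M N h" "0 \<in> M"
  shows "h 0 = 0"
proof -
  have "h (0 + 0) = h 0 + h 0" using assms unfolding module_hom_on_def by blast
  then show ?thesis by simp
qed

lemma module_hom_on_add: "module_hom_on s t M N h \<Longrightarrow> x \<in> M \<Longrightarrow> y \<in> M \<Longrightarrow> h (x + y) = h x + h y"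
  and module_hom_on_scale: "module_hom_on s t M N h \<Longrightarrow> x \<in> M \<Longrightarrow> h (s r x) = t r (h x)"
  and module_hom_on_in: "module_hom_on s t M N h \<Longrightarrow> x \<in> M \<Longrightarrow> h x \<in> N"
  by (auto simp: module_hom_on_def)

lemma module_hom_on_sum:
  assumes s: "module s" and h: "module_hom_on s t M N h" and M: "module.subspace s M" and x: "\<And>i. i \<in> A \<Longrightarrow> x i \<in> M"
  shows "h (\<Sum>i\<in>A. s (c i) (x i)) = (\<Sum>i\<in>A. t (c i) (h (x i)))"
proof -
  interpret module s by (rule s)
  have "h (\<Sum>i\<in>A. s (c i) (x i)) = (\<Sum>i\<in>A. t (c i) (h (x i))) \<and> (\<Sum>i\<in>A. s (c i) (x i)) \<in> M"
    using x
  proof (induction A rule: infinite_finite_induct)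
    case (insert i A)
    then show ?case
      using module_hom_on_add[OF h] module_hom_on_scale[OF h] subspace_add[OF M] subspace_scale[OF M] by simp
  qed (use module_hom_on_zero[OF h] subspace_0[OF M] in auto)
  then show ?thesis ..
qed

lemma module_hom_on_diff:
  assumes s: "module s" and h: "module_hom_on s t M N h" and M: "module.subspace s M" and "x \<in> M" "y \<in> M"
  shows "h (x - y) = h x - h y"
proof -
  interpret module s by (rule s)
  have "h (x - y) + h y = h (x - y + y)"
    using assms subspace_diff[OF M] by (intro module_hom_on_add[OF h, symmetric]) auto
  then show ?thesis by (simp add: eq_diff_eq)
qed

lemma fvec_eq_sum:
  fixes v :: "nat \<Rightarrow>\<^sub>0 'r::comm_ring_1"
  assumes "Poly_Mapping.keys v \<subseteq> S" "finite S"
  shows "v = (\<Sum>i\<in>S. fscale (Poly_Mapping.lookup v i) (Poly_Mapping.single i 1))"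
proof (rule poly_mapping_eqI)
  fix j
  have "Poly_Mapping.lookup (\<Sum>i\<in>S. fscale (Poly_Mapping.lookup v i) (Poly_Mapping.single i 1)) j
     = (\<Sum>i\<in>S. if i = j then Poly_Mapping.lookup v j else 0)"
    unfolding lookup_sum by (intro sum.cong) (auto simp: lookup_fscale lookup_single when_def)
  then show "Poly_Mapping.lookup v j = Poly_Mapping.lookup (\<Sum>i\<in>S. fscale (Poly_Mapping.lookup v i) (Poly_Mapping.single i 1)) j"
    using assms by (auto simp: in_keys_iff)
qed

lemma sum_keys_superset:
  fixes v :: "nat \<Rightarrow>\<^sub>0 'r::comm_ring_1"
  assumes t: "module t" and "Poly_Mapping.keys v \<subseteq> S" "finite S"
  shows "(\<Sum>i\<in>Poly_Mapping.keys v. t (Poly_Mapping.lookup v i) (y i)) = (\<Sum>i\<in>S. t (Poly_Mapping.lookup v i) (y i))"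
  using assms by (intro sum.mono_neutral_left) (auto simp: in_keys_iff module.scale_zero_left)

lemma projective_subspace: "projective P \<Longrightarrow> module.subspace fscale P"
  by (simp add: projective_def)

lemma module_hom_on_lincomb:
  assumes t: "module t"
  shows "module_hom_on fscale t (free m) UNIV (\<lambda>v. \<Sum>i<m. t (Poly_Mapping.lookup v i) (y i))"
proof -
  interpret module t by (rule t)
  show ?thesis
    by (auto simp: module_hom_on_def lookup_add lookup_fscale scale_left_distrib sum.distrib scale_sum_right)
qed

text \<open>Let \<open>p i\<close> be the component in \<open>P\<close> of the i-th basis vector and
  \<open>y i\<close> a preimage of \<open>h (p i)\<close>. The lift sends v to the combination of
  the \<open>y i\<close> with the coordinates of v. It is correct on \<open>P\<close>, where v is
  the same combination of the \<open>p i\<close>: the difference lies in both \<open>P\<close> and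
  the complement \<open>Q\<close>.\<close>

lemma projective_lift:
  fixes P M :: "(nat \<Rightarrow>\<^sub>0 'r::comm_ring_1) set"
  assumes P: "projective P" and h: "module_hom_on fscale t P N h"
    and M: "module.subspace fscale M" and g: "module_hom_on fscale t M N' g" and hg: "h ` P \<subseteq> g ` M"
  shows "\<exists>\<phi>. module_hom_on fscale fscale P M \<phi> \<and> (\<forall>x\<in>P. g (\<phi> x) = h x)"
proof -
  have sP: "fmod.subspace P" using P by (rule projective_subspace)
  obtain Q where Q: "fmod.subspace Q" "P \<inter> Q = {0}" "\<And>v. \<exists>p\<in>P. \<exists>q\<in>Q. v = p + q"
    using P by (auto simp: projective_def)
  have "\<forall>i. \<exists>p. p \<in> P \<and> (\<exists>q\<in>Q. Poly_Mapping.single i 1 = p + q)" using Q(3) by blast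
  then obtain p where p: "\<And>i. p i \<in> P" "\<And>i. \<exists>q\<in>Q. Poly_Mapping.single i 1 = p i + q"
    by (auto dest!: choice)
  have diffQ: "Poly_Mapping.single i 1 - p i \<in> Q" for i using p(2)[of i] by auto
  have "\<forall>i. \<exists>y. y \<in> M \<and> g y = h (p i)" using p(1) hg by (metis (no_types, lifting) image_iff subset_iff)
  then obtain y where y: "\<And>i. y i \<in> M" "\<And>i. g (y i) = h (p i)" by (auto dest!: choice)
  define \<phi> where "\<phi> v = (\<Sum>i\<in>Poly_Mapping.keys v. fscale (Poly_Mapping.lookup v i) (y i))" for v
  have \<phi>: "\<phi> v = (\<Sum>i\<in>S. fscale (Poly_Mapping.lookup v i) (y i))" if "Poly_Mapping.keys v \<subseteq> S" "finite S" for v S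
    unfolding \<phi>_def using that by (intro sum_keys_superset[OF module_fscale])
  have v_eq: "v = (\<Sum>i\<in>Poly_Mapping.keys v. fscale (Poly_Mapping.lookup v i) (p i))" if v: "v \<in> P" for v
  proof -
    let ?w = "\<Sum>i\<in>Poly_Mapping.keys v. fscale (Poly_Mapping.lookup v i) (p i)"
    have "v - ?w = (\<Sum>i\<in>Poly_Mapping.keys v. fscale (Poly_Mapping.lookup v i) (Poly_Mapping.single i 1 - p i))"
      by (subst (1) fvec_eq_sum[OF order_refl]) (simp_all add: fmod.scale_right_diff_distrib sum_subtractf)
    also have "\<dots> \<in> Q" using diffQ by (intro fmod.subspace_sum[OF Q(1)] fmod.subspace_scale[OF Q(1)])
    finally have "v - ?w \<in> Q" .
    moreover have "v - ?w \<in> P"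
      using v p(1) by (intro fmod.subspace_diff[OF sP] fmod.subspace_sum[OF sP] fmod.subspace_scale[OF sP])
    ultimately have "v - ?w = 0" using Q(2) by blast
    then show ?thesis by simp
  qed
  have "g (\<phi> v) = h v" if v: "v \<in> P" for v
  proof -
    have "g (\<phi> v) = (\<Sum>i\<in>Poly_Mapping.keys v. t (Poly_Mapping.lookup v i) (g (y i)))"
      unfolding \<phi>_def using y(1) by (intro module_hom_on_sum[OF module_fscale g M])
    also have "\<dots> = (\<Sum>i\<in>Poly_Mapping.keys v. t (Poly_Mapping.lookup v i) (h (p i)))" by (simp add: y(2))
    also have "\<dots> = h (\<Sum>i\<in>Poly_Mapping.keys v. fscale (Poly_Mapping.lookup v i) (p i))"
      using p(1) by (intro module_hom_on_sum[OF module_fscale h sP, symmetric])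
    finally show ?thesis using v_eq[OF v] by simp
  qed
  moreover have "module_hom_on fscale fscale P M \<phi>"
    unfolding module_hom_on_def
  proof (intro conjI ballI allI)
    show "\<phi> ` P \<subseteq> M" unfolding \<phi>_def
      using y(1) by (auto intro!: fmod.subspace_sum[OF M] fmod.subspace_scale[OF M])
  next
    fix v w
    show "\<phi> (v + w) = \<phi> v + \<phi> w"
      using keys_add[of v w]
      by (subst (1 2 3) \<phi>[of _ "Poly_Mapping.keys v \<union> Poly_Mapping.keys w"])
         (auto simp: lookup_add fmod.scale_left_distrib sum.distrib)
  next
    fix r v
    show "\<phi> (fscale r v) = fscale r (\<phi> v)"
      by (subst (1 2) \<phi>[of _ "Poly_Mapping.keys v"])
         (auto simp: lookup_fscale in_keys_iff fmod.scale_sum_right)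
  qed
  ultimately show ?thesis by blast
qed

lemma module_hom_on_comp:
  "module_hom_on s t M N h \<Longrightarrow> module_hom_on t u N K g \<Longrightarrow> module_hom_on s u M K (\<lambda>x. g (h x))"
  unfolding module_hom_on_def by (auto simp: image_subset_iff)

lemma module_hom_on_plus_minus:
  fixes M K :: "(nat \<Rightarrow>\<^sub>0 'r::comm_ring_1) set"
  assumes "module_hom_on fscale fscale M K h" "module_hom_on fscale fscale M K g" "module.subspace fscale K"
  shows "module_hom_on fscale fscale M K (\<lambda>x. h x + g x)" "module_hom_on fscale fscale M K (\<lambda>x. h x - g x)"
  using assms unfolding module_hom_on_def
  by (auto simp: image_subset_iff fmod.scale_right_distrib fmod.scale_right_diff_distrib
      fmod.subspace_add fmod.subspace_diff)

lemma module_hom_on_id: "module_hom_on s s M M (\<lambda>x. x)"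
  by (simp add: module_hom_on_def)

text \<open>Comparison of resolutions: a chain map to a projective resolution of length two and back is
  homotopic to the identity, and on \<open>ker d\<^sub>2\<close> its degree-two component vanishes.\<close>

lemma resolution_retract:
  fixes F0 F1 F2 :: "(nat \<Rightarrow>\<^sub>0 'r::comm_ring_1) set"
  assumes F: "projective F0" "projective F1" "projective F2"
    and e: "module_hom_on fscale s F0 J e" "e ` F0 = J"
    and d1: "module_hom_on fscale fscale F1 F0 d1" "d1 ` F1 = {x \<in> F0. e x = 0}"
    and d2: "module_hom_on fscale fscale F2 F1 d2" "d2 ` F2 = {x \<in> F1. d1 x = 0}"
    and res: "has_projective_resolution s J 2"
  shows "\<exists>\<Lambda>. module_hom_on fscale fscale F2 F2 \<Lambda> \<and> (\<forall>x\<in>F2. d2 (\<Lambda> x) = 0) \<and> (\<forall>x\<in>F2. d2 x = 0 \<longrightarrow> \<Lambda> x = x)"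
proof -
  obtain P :: "nat \<Rightarrow> (nat \<Rightarrow>\<^sub>0 'r) set" and D \<epsilon> where
    "(\<forall>i. projective (P i)) \<and> (\<forall>i>2. P i = {0}) \<and>
        module_hom_on fscale s (P 0) J \<epsilon> \<and> \<epsilon> ` P 0 = J \<and>
        (\<forall>i. module_hom_on fscale fscale (P (Suc i)) (P i) (D i)) \<and>
        D 0 ` P (Suc 0) = {x \<in> P 0. \<epsilon> x = 0} \<and>
        (\<forall>i. D (Suc i) ` P (Suc (Suc i)) = {x \<in> P (Suc i). D i x = 0})"
    using res unfolding has_projective_resolution_def by (elim exE)
  note * = this
  note H1 = *[THEN conjunct1] and * = *[THEN conjunct2]
  note H2 = *[THEN conjunct1] and * = *[THEN conjunct2]
  note \<epsilon>1 = *[THEN conjunct1] and * = *[THEN conjunct2]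
  note \<epsilon>2 = *[THEN conjunct1] and * = *[THEN conjunct2]
  note H3 = *[THEN conjunct1] and * = *[THEN conjunct2]
  note D0 = *[THEN conjunct1] and H4 = *[THEN conjunct2]
  note P = H1[THEN spec] H2[THEN spec, THEN mp] and \<epsilon> = \<epsilon>1 \<epsilon>2 and D = H3[THEN spec] and DS = H4[THEN spec]
  note sP = projective_subspace[OF P(1)]
  note sF = F[THEN projective_subspace]
  note z = fmod.subspace_0[OF sP] sF[THEN fmod.subspace_0]
  have inF: "d1 x \<in> F0" "e (d1 x) = 0" if "x \<in> F1" for x using that d1(2) by auto
  have inF2: "d2 x \<in> F1" "d1 (d2 x) = 0" if "x \<in> F2" for x using that d2(2) by auto
  have inP: "D 0 x \<in> P 0" "\<epsilon> (D 0 x) = 0" if "x \<in> P (Suc 0)" for x using that D0 by auto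
  have inP2: "D (Suc 0) x \<in> P (Suc 0)" "D 0 (D (Suc 0) x) = 0" if "x \<in> P (Suc (Suc 0))" for x
    using that DS[of 0] by auto
  \<comment> \<open>The third module is zero, so exactness makes the last map injective; this is how
    length two enters.\<close>
  have injD: "x = 0" if "x \<in> P (Suc (Suc 0))" "D (Suc 0) x = 0" for x
  proof -
    have "x \<in> D (Suc (Suc 0)) ` P (Suc (Suc (Suc 0)))" using that DS[of "Suc 0"] by auto
    then have "x = D (Suc (Suc 0)) 0" using P(2)[of "Suc (Suc (Suc 0))"] by auto
    then show ?thesis using module_hom_on_zero[OF D z(1)] by simp
  qed
  \<comment> \<open>The chain maps \<alpha> and \<beta> lift the identity of \<open>J\<close> in the
    two directions.\<close>
  obtain \<alpha>0 where \<alpha>0: "module_hom_on fscale fscale F0 (P 0) \<alpha>0" "\<And>x. x \<in> F0 \<Longrightarrow> \<epsilon> (\<alpha>0 x) = e x"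
    using projective_lift[OF F(1) e(1) sP \<epsilon>(1)] e(2) \<epsilon>(2) by auto
  note \<alpha>0_in = module_hom_on_in[OF \<alpha>0(1)]
  obtain \<alpha>1 where \<alpha>1: "module_hom_on fscale fscale F1 (P (Suc 0)) \<alpha>1" "\<And>x. x \<in> F1 \<Longrightarrow> D 0 (\<alpha>1 x) = \<alpha>0 (d1 x)"
  proof -
    have "(\<lambda>x. \<alpha>0 (d1 x)) ` F1 \<subseteq> D 0 ` P (Suc 0)" using \<alpha>0 inF \<alpha>0_in unfolding D0 by auto
    from projective_lift[OF F(2) module_hom_on_comp[OF d1(1) \<alpha>0(1)] sP D this] show ?thesis using that by blast
  qed
  note \<alpha>1_in = module_hom_on_in[OF \<alpha>1(1)]
  obtain \<alpha>2 where \<alpha>2: "module_hom_on fscale fscale F2 (P (Suc (Suc 0))) \<alpha>2" "\<And>x. x \<in> F2 \<Longrightarrow> D (Suc 0) (\<alpha>2 x) = \<alpha>1 (d2 x)"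
  proof -
    have "(\<lambda>x. \<alpha>1 (d2 x)) ` F2 \<subseteq> D (Suc 0) ` P (Suc (Suc 0))"
      using \<alpha>1 inF2 \<alpha>1_in module_hom_on_zero[OF \<alpha>0(1) z(2)] unfolding DS[of 0] by auto
    from projective_lift[OF F(3) module_hom_on_comp[OF d2(1) \<alpha>1(1)] sP D this] show ?thesis using that by blast
  qed
  note \<alpha>2_in = module_hom_on_in[OF \<alpha>2(1)]
  obtain \<beta>0 where \<beta>0: "module_hom_on fscale fscale (P 0) F0 \<beta>0" "\<And>x. x \<in> P 0 \<Longrightarrow> e (\<beta>0 x) = \<epsilon> x"
    using projective_lift[OF P(1) \<epsilon>(1) sF(1) e(1)] e(2) \<epsilon>(2) by auto
  note \<beta>0_in = module_hom_on_in[OF \<beta>0(1)]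
  obtain \<beta>1 where \<beta>1: "module_hom_on fscale fscale (P (Suc 0)) F1 \<beta>1" "\<And>x. x \<in> P (Suc 0) \<Longrightarrow> d1 (\<beta>1 x) = \<beta>0 (D 0 x)"
  proof -
    have "(\<lambda>x. \<beta>0 (D 0 x)) ` P (Suc 0) \<subseteq> d1 ` F1" using \<beta>0 inP \<beta>0_in unfolding d1(2) by auto
    from projective_lift[OF P(1) module_hom_on_comp[OF D \<beta>0(1)] sF(2) d1(1) this] show ?thesis using that by blast
  qed
  note \<beta>1_in = module_hom_on_in[OF \<beta>1(1)]
  obtain \<beta>2 where \<beta>2: "module_hom_on fscale fscale (P (Suc (Suc 0))) F2 \<beta>2" "\<And>x. x \<in> P (Suc (Suc 0)) \<Longrightarrow> d2 (\<beta>2 x) = \<beta>1 (D (Suc 0) x)"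
  proof -
    have "(\<lambda>x. \<beta>1 (D (Suc 0) x)) ` P (Suc (Suc 0)) \<subseteq> d2 ` F2"
      using \<beta>1 inP2 \<beta>1_in module_hom_on_zero[OF \<beta>0(1) z(1)] unfolding d2(2) by auto
    from projective_lift[OF P(1) module_hom_on_comp[OF D \<beta>1(1)] sF(3) d2(1) this] show ?thesis using that by blast
  qed
  note \<beta>2_in = module_hom_on_in[OF \<beta>2(1)]
  note diff_e = module_hom_on_diff[OF module_fscale e(1) sF(1)]
  note diff_d1 = module_hom_on_diff[OF module_fscale d1(1) sF(2)]
  note diff_d2 = module_hom_on_diff[OF module_fscale d2(1) sF(3)]
  \<comment> \<open>\<open>h0\<close> and \<open>h1\<close> form a homotopy between the composite of
    \<alpha> and \<beta> and the identity, in degrees zero and one.\<close>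
  obtain h0 where h0: "module_hom_on fscale fscale F0 F1 h0" "\<And>x. x \<in> F0 \<Longrightarrow> d1 (h0 x) = \<beta>0 (\<alpha>0 x) - x"
  proof -
    have hom: "module_hom_on fscale fscale F0 F0 (\<lambda>x. \<beta>0 (\<alpha>0 x) - x)"
      by (intro module_hom_on_plus_minus(2) module_hom_on_comp[OF \<alpha>0(1) \<beta>0(1)] module_hom_on_id sF)
    have "(\<lambda>x. \<beta>0 (\<alpha>0 x) - x) ` F0 \<subseteq> d1 ` F1"
      unfolding d1(2) using module_hom_on_in[OF hom] diff_e \<beta>0 \<alpha>0 \<beta>0_in \<alpha>0_in by auto
    from projective_lift[OF F(1) hom sF(2) d1(1) this] show ?thesis using that by blast
  qed
  note h0_in = module_hom_on_in[OF h0(1)]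
  obtain h1 where h1: "module_hom_on fscale fscale F1 F2 h1" "\<And>x. x \<in> F1 \<Longrightarrow> d2 (h1 x) = \<beta>1 (\<alpha>1 x) - x - h0 (d1 x)"
  proof -
    have hom: "module_hom_on fscale fscale F1 F1 (\<lambda>x. \<beta>1 (\<alpha>1 x) - x - h0 (d1 x))"
      by (intro module_hom_on_plus_minus(2) module_hom_on_comp[OF \<alpha>1(1) \<beta>1(1)] module_hom_on_id
          module_hom_on_comp[OF d1(1) h0(1)] sF)
    have "d1 (\<beta>1 (\<alpha>1 x) - x - h0 (d1 x)) = 0" if x: "x \<in> F1" for x
      using x \<alpha>1_in[OF x] \<beta>1_in[OF \<alpha>1_in[OF x]] inF[OF x] h0_in[OF inF(1)[OF x]] fmod.subspace_diff[OF sF(2)]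
      by (simp add: diff_d1 h0(2) \<beta>1(2) \<alpha>1(2))
    then have "(\<lambda>x. \<beta>1 (\<alpha>1 x) - x - h0 (d1 x)) ` F1 \<subseteq> d2 ` F2"
      unfolding d2(2) using module_hom_on_in[OF hom] by auto
    from projective_lift[OF F(2) hom sF(3) d2(1) this] show ?thesis using that by blast
  qed
  note h1_in = module_hom_on_in[OF h1(1)]
  \<comment> \<open>Applying \<open>d2\<close>, the homotopy relation for \<open>h1\<close> turns
    the first two terms into \<open>\<beta>1 (\<alpha>1 (d2 x))\<close>, which the last term
    cancels. On the kernel of \<open>d2\<close> the middle term vanishes, and
    \<open>\<alpha>2 x = 0\<close> by injectivity of the last map.\<close>
  define \<Lambda> where "\<Lambda> x = x + h1 (d2 x) - \<beta>2 (\<alpha>2 x)" for x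
  have "module_hom_on fscale fscale F2 F2 \<Lambda>"
    unfolding \<Lambda>_def[abs_def] by (intro module_hom_on_plus_minus module_hom_on_id module_hom_on_comp[OF d2(1) h1(1)]
        module_hom_on_comp[OF \<alpha>2(1) \<beta>2(1)] sF)
  moreover have "d2 (\<Lambda> x) = 0" if x: "x \<in> F2" for x
  proof -
    note m = h1_in[OF inF2(1)[OF x]] \<beta>2_in[OF \<alpha>2_in[OF x]]
    have "d2 (\<Lambda> x) = d2 x + d2 (h1 (d2 x)) - d2 (\<beta>2 (\<alpha>2 x))"
      unfolding \<Lambda>_def using x m fmod.subspace_add[OF sF(3)]
      by (simp add: diff_d2 module_hom_on_add[OF d2(1)])
    also have "\<dots> = 0"
      using x inF2[OF x] \<alpha>2_in[OF x] module_hom_on_zero[OF h0(1) z(2)]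
      by (simp add: h1(2) \<beta>2(2) \<alpha>2(2))
    finally show ?thesis .
  qed
  moreover have "\<Lambda> x = x" if x: "x \<in> F2" "d2 x = 0" for x
  proof -
    have "D (Suc 0) (\<alpha>2 x) = 0" using \<alpha>2(2)[OF x(1)] x(2) module_hom_on_zero[OF \<alpha>1(1) z(3)] by simp
    then have "\<alpha>2 x = 0" by (rule injD[OF \<alpha>2_in[OF x(1)]])
    then show ?thesis
      using x module_hom_on_zero[OF h1(1) z(3)] module_hom_on_zero[OF \<beta>2(1) z(1)] by (simp add: \<Lambda>_def)
  qed
  ultimately show ?thesis by blast
qed

lemma projective_free: "projective (free m :: (nat \<Rightarrow>\<^sub>0 'r::comm_ring_1) set)"
  unfolding projective_def
proof (intro conjI exI allI)
  let ?Q = "{v :: nat \<Rightarrow>\<^sub>0 'r. \<forall>i<m. Poly_Mapping.lookup v i = 0}"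
  show "fmod.subspace (free m :: (nat \<Rightarrow>\<^sub>0 'r) set)" by (rule subspace_free)
  show "fmod.subspace ?Q" by (auto simp: fmod.subspace_def lookup_add lookup_fscale)
  show "free m \<inter> ?Q = {0}"
    by (auto simp: mem_free_iff intro!: poly_mapping_eqI) (metis not_le)
  fix v :: "nat \<Rightarrow>\<^sub>0 'r"
  let ?p = "Poly_Mapping.mapp (\<lambda>i c. c when i < m) v"
  have "?p \<in> free m" "v - ?p \<in> ?Q" by (auto simp: mem_free_iff lookup_mapp lookup_minus when_def in_keys_iff)
  moreover have "v = ?p + (v - ?p)" by simp
  ultimately show "\<exists>p\<in>free m. \<exists>q\<in>?Q. v = p + q" by blast
qed

text \<open>The submodule \<open>L\<close> lies in \<open>\<mm>\<^sup>N R\<^sup>r\<close> for all \<open>N\<close>, where \<open>\<mm>\<close> is the irrelevant ideal.\<close>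

lemma retract_into_irrelevant_zero:
  fixes \<Lambda> :: "(nat \<Rightarrow>\<^sub>0 ('n::{finite,linorder}, 'k::field) mpoly) \<Rightarrow> (nat \<Rightarrow>\<^sub>0 ('n, 'k) mpoly)"
  assumes hom: "module_hom_on fscale fscale (free r) (free r) \<Lambda>" and L: "\<And>x. x \<in> free r \<Longrightarrow> \<Lambda> x \<in> L"
    and id: "\<And>x. x \<in> L \<Longrightarrow> \<Lambda> x = x" and LF: "L \<subseteq> free r"
    and const: "\<And>x l. x \<in> L \<Longrightarrow> l < r \<Longrightarrow> Poly_Mapping.lookup (Poly_Mapping.lookup x l) 0 = 0"
    and x: "x \<in> L"
  shows "x = 0"
proof -
  have ord: "monomial_degree t \<ge> N"
    if "t \<in> Poly_Mapping.keys (Poly_Mapping.lookup x i)" for N t i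
    using that
  proof (induction N arbitrary: t i)
    case (Suc N)
    \<comment> \<open>As \<Lambda> fixes \<open>x\<close>, each entry of \<open>x\<close> is a
      combination of entries of the \<open>?y l\<close> with coefficients from \<open>x\<close>. The
      \<open>?y l\<close> lie in \<open>L\<close> and have no constant terms, so the order of
      vanishing rises by one in each round.\<close>
    let ?y = "\<lambda>l. \<Lambda> (Poly_Mapping.single l 1)"
    have "x = (\<Sum>l<r. fscale (Poly_Mapping.lookup x l) (Poly_Mapping.single l 1))"
      using x LF by (intro fvec_eq_sum) (auto simp: free_def)
    then have "x = \<Lambda> (\<Sum>l<r. fscale (Poly_Mapping.lookup x l) (Poly_Mapping.single l 1))"
      using id[OF x] by simp
    also have "\<dots> = (\<Sum>l<r. fscale (Poly_Mapping.lookup x l) (?y l))"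
      using module_hom_on_sum[OF module_fscale hom subspace_free, of "{..<r}"] by (simp add: single_in_free)
    finally have "Poly_Mapping.lookup x i = (\<Sum>l<r. Poly_Mapping.lookup x l * Poly_Mapping.lookup (?y l) i)"
      by (metis (no_types, lifting) lookup_fscale lookup_sum sum.cong)
    then have "Poly_Mapping.lookup (\<Sum>l<r. Poly_Mapping.lookup x l * Poly_Mapping.lookup (?y l) i) t \<noteq> 0"
      using Suc.prems by (simp add: in_keys_iff)
    then obtain l where l: "l < r" "t \<in> Poly_Mapping.keys (Poly_Mapping.lookup x l * Poly_Mapping.lookup (?y l) i)"
      unfolding lookup_sum by (metis (no_types, lifting) in_keys_iff lessThan_iff sum.neutral)
    then obtain u w where uw: "u \<in> Poly_Mapping.keys (Poly_Mapping.lookup x l)"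
      "w \<in> Poly_Mapping.keys (Poly_Mapping.lookup (?y l) i)" "monomial_degree t = monomial_degree u + monomial_degree w"
      by (elim keys_mult_degree)
    have yL: "?y l \<in> L" using l(1) by (intro L single_in_free)
    have "i < r" using uw(2) yL LF by (metis empty_iff in_mono keys_zero mem_free_iff not_le)
    then have "w \<noteq> 0" using const[OF yL] uw(2) by (auto simp: in_keys_iff)
    then have "monomial_degree w \<ge> 1" by (metis less_one monomial_degree_eq_0_iff not_le)
    then show ?case using uw(3) Suc.IH[OF uw(1)] by simp
  qed simp
  have "Poly_Mapping.lookup x i = 0" for i
  proof (rule ccontr)
    assume "\<not> ?thesis"
    then obtain t where "t \<in> Poly_Mapping.keys (Poly_Mapping.lookup x i)" by (meson ex_in_conv keys_eq_empty)
    then show False using ord[of t i "Suc (monomial_degree t)"] by simp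
  qed
  then show ?thesis by (intro poly_mapping_eqI[of x 0]) simp
qed


section \<open>Hilbert functions of presented ideals\<close>

text \<open>The full modules are infinite-dimensional over the field, so dimensions are compared on
  a subspace inside a finite span, such as a graded component. A basis of the kernel is extended to
  one of \<open>S\<close>.\<close>

lemma rank_nullity_on:
  fixes s1 :: "'k::field \<Rightarrow> 'b::ab_group_add \<Rightarrow> 'b" and s2 :: "'k \<Rightarrow> 'c::ab_group_add \<Rightarrow> 'c"
  assumes f: "Vector_Spaces.linear s1 s2 f" and S: "module.subspace s1 S" "S \<subseteq> module.span s1 W" "finite W"
  shows "vector_space.dim s1 S = vector_space.dim s2 (f ` S) + vector_space.dim s1 {x \<in> S. f x = 0}"
proof -
  interpret f: Vector_Spaces.linear s1 s2 f by (rule f)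
  let ?K = "{x \<in> S. f x = 0}"
  obtain B where B: "B \<subseteq> ?K" "f.vs1.independent B" "?K \<subseteq> f.vs1.span B" "card B = f.vs1.dim ?K"
    using f.vs1.basis_exists .
  obtain C where C: "B \<subseteq> C" "C \<subseteq> S" "f.vs1.independent C" "S \<subseteq> f.vs1.span C"
    using f.vs1.maximal_independent_subset_extend[of B S] B by auto
  have fin: "finite C" using f.vs1.independent_span_bound[OF S(3) C(3)] C(2) S(2) by auto
  have dimS: "f.vs1.dim S = card C" using f.vs1.basis_card_eq_dim[of C S] C by simp
  \<comment> \<open>The coordinates of such a vector with respect to \<open>C\<close> are supported
    both inside and outside \<open>B\<close>.\<close>
  have inter: "z = 0" if z: "z \<in> f.vs1.span (C - B)" "z \<in> f.vs1.span B" for z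
  proof -
    have "f.vs1.representation C z = f.vs1.representation (C - B) z"
      "f.vs1.representation C z = f.vs1.representation B z"
      using f.vs1.representation_extend[OF C(3) z(1)] f.vs1.representation_extend[OF C(3) z(2) C(1)] by blast+
    then have "f.vs1.representation C z b = 0" for b
      by (metis DiffD2 f.vs1.representation_ne_zero)
    moreover have "z \<in> f.vs1.span C" using z(1) f.vs1.span_mono[of "C - B" C] by auto
    ultimately show ?thesis using f.vs1.sum_nonzero_representation_eq[OF C(3), of z] by simp
  qed
  have inj: "inj_on f (f.vs1.span (C - B))"
  proof (rule inj_onI)
    fix x y assume xy: "x \<in> f.vs1.span (C - B)" "y \<in> f.vs1.span (C - B)" "f x = f y"
    then have d: "x - y \<in> f.vs1.span (C - B)" by (intro f.vs1.span_diff)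
    moreover have "f.vs1.span (C - B) \<subseteq> S" using C(2) S(1) by (intro f.vs1.span_minimal) auto
    ultimately have "x - y \<in> ?K" using xy(3) by (auto simp: f.diff)
    then have "x - y = 0" using d B(3) by (intro inter) auto
    then show "x = y" by simp
  qed
  have ind: "f.vs2.independent (f ` (C - B))"
    using f.dependent_inj_imageD[OF _ inj] f.vs1.dependent_mono[of "C - B" C] C(3) by auto
  have "f ` S \<subseteq> f.vs2.span (f ` (C - B))"
  proof -
    have "f ` S \<subseteq> f.vs2.span (f ` C)" using C(4) by (auto simp: f.span_image)
    also have "\<dots> \<subseteq> f.vs2.span (insert 0 (f ` (C - B)))" using B(1) by (intro f.vs2.span_mono) auto
    finally show ?thesis by simp
  qed
  moreover have "f ` (C - B) \<subseteq> f ` S" using C(2) by auto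
  ultimately have "f.vs2.dim (f ` S) = card (f ` (C - B))"
    using f.vs2.basis_card_eq_dim[OF _ _ ind] by simp
  also have "\<dots> = card (C - B)"
    using inj f.vs1.span_superset by (intro card_image inj_on_subset[OF inj])
  also have "\<dots> = card C - card B" using C(1) fin by (intro card_Diff_subset) (auto dest: finite_subset)
  finally show ?thesis using dimS B(4) card_mono[OF fin C(1)] by simp
qed

lemma dim_subset_on:
  assumes "vector_space s" "S \<subseteq> T" "T \<subseteq> module.span s W" "finite W"
  shows "vector_space.dim s S \<le> vector_space.dim s T"
proof -
  interpret vector_space s by (rule assms)
  obtain B where B: "B \<subseteq> S" "independent B" "S \<subseteq> span B" "card B = dim S" using basis_exists .
  obtain C where C: "C \<subseteq> T" "independent C" "T \<subseteq> span C" "card C = dim T" using basis_exists .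
  have "finite C" using independent_span_bound[OF assms(4) C(2)] C(1) assms(3) by auto
  then have "card B \<le> card C" using independent_span_bound[of C B] B C assms(2) by auto
  then show ?thesis using B C by simp
qed

definition fkscale :: "'k::field \<Rightarrow> (nat \<Rightarrow>\<^sub>0 ('n::{finite,linorder}, 'k) mpoly) \<Rightarrow> (nat \<Rightarrow>\<^sub>0 ('n, 'k) mpoly)" where
  "fkscale c v = fscale (Poly_Mapping.single 0 c) v"

lemma lookup_fkscale: "Poly_Mapping.lookup (fkscale c v) i = kscale c (Poly_Mapping.lookup v i)"
  by (simp add: fkscale_def lookup_fscale kscale_def)

lemma lookup_kscale: "Poly_Mapping.lookup (kscale c p) t = c * Poly_Mapping.lookup p t"
  by (simp add: kscale_def lookup_const_times)

lemma vector_space_fkscale: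
  "vector_space (fkscale :: 'k::field \<Rightarrow> (nat \<Rightarrow>\<^sub>0 ('n::{finite,linorder}, 'k) mpoly) \<Rightarrow> _)"
  by unfold_locales
     (simp_all add: fkscale_def fmod.scale_right_distrib single_add fmod.scale_left_distrib mult_single)

interpretation kspace: vector_space "kscale :: 'k::field \<Rightarrow> ('n::{finite,linorder}, 'k) mpoly \<Rightarrow> _"
  by (rule vector_space_kscale)

interpretation fkspace: vector_space "fkscale :: 'k::field \<Rightarrow> (nat \<Rightarrow>\<^sub>0 ('n::{finite,linorder}, 'k) mpoly) \<Rightarrow> _"
  by (rule vector_space_fkscale)

definition hfree :: "(nat \<Rightarrow> nat) \<Rightarrow> nat \<Rightarrow> nat \<Rightarrow> (nat \<Rightarrow>\<^sub>0 ('n::{finite,linorder}, 'k::field) mpoly) set" where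
  "hfree a m j = {v \<in> free m. hvec a j v}"

text \<open>The dimension of R(-s) in degree j. The condition is written as a sum so that the value
  is 0 for s > j.\<close>

definition nmonom :: "'n::finite itself \<Rightarrow> nat \<Rightarrow> nat \<Rightarrow> nat" where
  "nmonom _ j s = card {t :: 'n \<Rightarrow>\<^sub>0 nat. monomial_degree t + s = j}"

lemma hvec_fkscale: "hvec a j v \<Longrightarrow> hvec a j (fkscale c v)"
  unfolding fkscale_def using hvec_fscale[of 0 "Poly_Mapping.single 0 c" a j v]
  by (simp add: homogeneous_def)

lemma hvec_zero [simp]: "hvec a j 0"
  by (simp add: hvec_def)

lemma subspace_hfree: "fkspace.subspace (hfree a m j)"
  unfolding fkspace.subspace_def hfree_def
  by (auto simp: hvec_add hvec_fkscale mem_free_iff lookup_add lookup_fkscale kscale_def)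

lemma hfree_basis:
  fixes a :: "nat \<Rightarrow> nat" and m j :: nat
  defines "e \<equiv> \<lambda>(i, t). Poly_Mapping.single i (Poly_Mapping.single t 1) :: nat \<Rightarrow>\<^sub>0 ('n::{finite,linorder}, 'k::field) mpoly"
  defines "T \<equiv> (SIGMA i:{..<m}. {t. monomial_degree t + a i = j})"
  shows "finite T" "hfree a m j \<subseteq> fkspace.span (e ` T)" "fkspace.independent (e ` T)" "e ` T \<subseteq> hfree a m j" "inj_on e T"
proof -
  show fin: "finite T" unfolding T_def by (intro finite_SigmaI finite_monomials) auto
  show "e ` T \<subseteq> hfree a m j"
    by (auto simp: e_def T_def hfree_def hvec_def free_def lookup_single when_def split: if_splits)
  have look: "Poly_Mapping.lookup (Poly_Mapping.lookup (e (i, t)) i') t' = (if (i, t) = (i', t') then 1 else 0)" for i t i' t'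
    by (simp add: e_def lookup_single when_def)
  then have inj: "inj e" by (auto simp: inj_def) (metis prod.inject zero_neq_one)+
  then show "inj_on e T" using inj_on_subset by blast
  show "hfree a m j \<subseteq> fkspace.span (e ` T)"
  proof
    fix v assume v: "v \<in> (hfree a m j :: (nat \<Rightarrow>\<^sub>0 ('n, 'k) mpoly) set)"
    have "v = (\<Sum>x\<in>T. fkscale (Poly_Mapping.lookup (Poly_Mapping.lookup v (fst x)) (snd x)) (e x))" (is "v = ?s")
    proof (intro poly_mapping_eqI)
      fix i t
      have inT: "(i, t) \<in> T" if nz: "Poly_Mapping.lookup (Poly_Mapping.lookup v i) t \<noteq> 0"
      proof -
        have "t \<in> Poly_Mapping.keys (Poly_Mapping.lookup v i)" using nz by (simp add: in_keys_iff)
        then have "monomial_degree t + a i = j" using v by (auto simp: hfree_def hvec_def)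
        moreover have "i < m" using v nz by (auto simp: hfree_def mem_free_iff) (metis not_le lookup_zero)
        ultimately show ?thesis by (simp add: T_def)
      qed
      have "Poly_Mapping.lookup (Poly_Mapping.lookup ?s i) t
         = (\<Sum>x\<in>T. if x = (i, t) then Poly_Mapping.lookup (Poly_Mapping.lookup v i) t else 0)"
        unfolding lookup_sum lookup_fkscale lookup_kscale
        by (intro sum.cong refl) (auto simp: look split: prod.splits if_splits)
      also have "\<dots> = (if (i, t) \<in> T then Poly_Mapping.lookup (Poly_Mapping.lookup v i) t else 0)"
        using fin by simp
      also have "\<dots> = Poly_Mapping.lookup (Poly_Mapping.lookup v i) t"
        using inT by auto
      finally show "Poly_Mapping.lookup (Poly_Mapping.lookup v i) t = Poly_Mapping.lookup (Poly_Mapping.lookup ?s i) t" by simp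
    qed
    moreover have "?s \<in> fkspace.span (e ` T)"
      by (intro fkspace.span_sum fkspace.span_scale fkspace.span_base) auto
    ultimately show "v \<in> fkspace.span (e ` T)" by simp
  qed
  show "fkspace.independent (e ` T)"
    unfolding fkspace.independent_explicit_module
  proof (intro allI impI)
    fix A u v assume A: "finite A" "A \<subseteq> e ` T" "(\<Sum>v\<in>A. fkscale (u v) v) = 0" "v \<in> A"
    then obtain i t where v: "v = e (i, t)" by auto
    have "0 = Poly_Mapping.lookup (Poly_Mapping.lookup (\<Sum>v\<in>A. fkscale (u v) v) i) t" using A(3) by simp
    also have "\<dots> = (\<Sum>w\<in>A. if w = v then u v else 0)"
      unfolding lookup_sum lookup_fkscale lookup_kscale
    proof (intro sum.cong refl)
      fix w assume "w \<in> A"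
      then obtain i' t' where w: "w = e (i', t')" using A(2) by auto
      show "u w * Poly_Mapping.lookup (Poly_Mapping.lookup w i) t = (if w = v then u v else 0)"
        unfolding w v look using inj_eq[OF inj] by auto
    qed
    also have "\<dots> = u v" using A by simp
    finally show "u v = 0" by simp
  qed
qed

lemma dim_hfree:
  "fkspace.dim (hfree a m j :: (nat \<Rightarrow>\<^sub>0 ('n::{finite,linorder}, 'k::field) mpoly) set) = (\<Sum>i<m. nmonom TYPE('n) j (a i))"
  using fkspace.basis_card_eq_dim[OF hfree_basis(4,2,3)[where 'n = 'n and 'k = 'k]]
    card_image[OF hfree_basis(5)[where 'n = 'n and 'k = 'k]]
  by (simp add: nmonom_def card_SigmaI finite_monomials)

lemma hfree_spanned:
  obtains W where "finite W" "hfree a m j \<subseteq> fkspace.span (W :: (nat \<Rightarrow>\<^sub>0 ('n::{finite,linorder}, 'k::field) mpoly) set)"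
  using that[OF finite_imageI[OF hfree_basis(1)] hfree_basis(2)] .

lemma lincomb_linear:
  "Vector_Spaces.linear fkscale kscale (\<lambda>v. \<Sum>i<m. Poly_Mapping.lookup v i * g i :: ('n::{finite,linorder}, 'k::field) mpoly)"
  unfolding Vector_Spaces.linear_iff
  by (intro conjI allI vector_space_kscale vector_space_fkscale)
     (simp_all add: lookup_add lookup_fkscale distrib_right sum.distrib sum_distrib_left kscale_def mult.assoc)

lemma lincomb_fscale_linear:
  "Vector_Spaces.linear fkscale fkscale (\<lambda>v. \<Sum>l<r. fscale (Poly_Mapping.lookup v l) (k l)
      :: nat \<Rightarrow>\<^sub>0 ('n::{finite,linorder}, 'k::field) mpoly)"
  unfolding Vector_Spaces.linear_iff
  by (intro conjI allI vector_space_fkscale)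
     (simp_all add: lookup_add fmod.scale_left_distrib sum.distrib fkscale_def lookup_fscale fmod.scale_sum_right)

definition vec_of :: "nat \<Rightarrow> (nat \<Rightarrow> 'r::comm_ring_1) \<Rightarrow> (nat \<Rightarrow>\<^sub>0 'r)" where
  "vec_of m c = (\<Sum>i<m. Poly_Mapping.single i (c i))"

lemma lookup_vec_of: "Poly_Mapping.lookup (vec_of m c) i = (if i < m then c i else 0)"
  by (auto simp: vec_of_def lookup_sum lookup_single when_def)

lemma vec_of_in_free: "vec_of m c \<in> free m"
  by (simp add: mem_free_iff lookup_vec_of)

lemma dim_zero_space: "vector_space s \<Longrightarrow> vector_space.dim s {0} = 0"
proof -
  assume "vector_space s"
  then interpret vector_space s .
  show ?thesis using dim_span_eq_card_independent[OF independent_empty] by simp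
qed

text \<open>Rank-nullity is applied twice, in degree j, to the exact sequence of graded modules in
  which the free module on the relations \<open>k\<close> maps injectively to the free module on the
  generators \<open>g\<close>, with cokernel the ideal. Homogeneity makes every map respect the
  degrees.\<close>

lemma dim_presentation:
  fixes g :: "nat \<Rightarrow> ('n::{finite,linorder}, 'k::field) mpoly" and b :: "nat \<Rightarrow> nat"
  assumes g: "\<And>i. i < m \<Longrightarrow> homogeneous (a i) (g i)"
    and k: "\<And>l. l < r \<Longrightarrow> k l \<in> free m" "\<And>l. l < r \<Longrightarrow> hvec a (b l) (k l)"
      "\<And>l. l < r \<Longrightarrow> (\<Sum>i<m. Poly_Mapping.lookup (k l) i * g i) = 0"
    and rel: "\<And>v. v \<in> free m \<Longrightarrow> (\<Sum>i<m. Poly_Mapping.lookup v i * g i) = 0 \<Longrightarrow> \<exists>c. v = (\<Sum>l<r. fscale (c l) (k l))"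
    and indep: "\<And>c l. (\<Sum>l<r. fscale (c l) (k l)) = 0 \<Longrightarrow> l < r \<Longrightarrow> c l = 0"
  shows "kspace.dim {p. homogeneous j p \<and> (\<exists>c. p = (\<Sum>i<m. c i * g i))} + (\<Sum>l<r. nmonom TYPE('n) j (b l))
       = (\<Sum>i<m. nmonom TYPE('n) j (a i))"
proof -
  let ?pi = "\<lambda>v. \<Sum>i<m. Poly_Mapping.lookup v i * g i"
  let ?de = "\<lambda>v. \<Sum>l<r. fscale (Poly_Mapping.lookup v l) (k l)"
  have img: "?pi ` hfree a m j = {p. homogeneous j p \<and> (\<exists>c. p = (\<Sum>i<m. c i * g i))}"
  proof (intro equalityI subsetI)
    fix p assume "p \<in> ?pi ` hfree a m j"
    then obtain v where v: "v \<in> free m" "hvec a j v" "p = ?pi v" by (auto simp: hfree_def)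
    have "homogeneous j (Poly_Mapping.lookup v i * g i)" if "i < m" for i
      unfolding homogeneous_def
    proof
      fix t assume "t \<in> Poly_Mapping.keys (Poly_Mapping.lookup v i * g i)"
      then show "monomial_degree t = j"
        by (elim keys_mult_degree) (use v(2) g[OF that] in \<open>auto simp: hvec_def homogeneous_def\<close>)
    qed
    then show "p \<in> {p. homogeneous j p \<and> (\<exists>c. p = (\<Sum>i<m. c i * g i))}"
      using v(3) by (auto intro: homogeneous_sum)
  next
    fix p assume "p \<in> {p. homogeneous j p \<and> (\<exists>c. p = (\<Sum>i<m. c i * g i))}"
    then obtain c where c: "homogeneous j p" "p = (\<Sum>i<m. c i * g i)" by auto
    have "p = hpart 0 j p" using hpart_homogeneous[OF c(1), of j] by simp
    also have "\<dots> = (\<Sum>i<m. hpart 0 j (c i * g i))" by (simp add: c(2) hpart_sum)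
    also have "\<dots> = (\<Sum>i<m. hpart (a i) j (c i) * g i)"
      using g by (intro sum.cong refl hpart_mult) (auto simp: homogeneous_def)
    finally have "p = ?pi (vec_of m (\<lambda>i. hpart (a i) j (c i)))" by (simp add: lookup_vec_of)
    moreover have "vec_of m (\<lambda>i. hpart (a i) j (c i)) \<in> hfree a m j"
      by (auto simp: hfree_def vec_of_in_free hvec_def lookup_vec_of keys_hpart split: if_splits)
    ultimately show "p \<in> ?pi ` hfree a m j" by blast
  qed
  have ker: "{v \<in> hfree a m j. ?pi v = 0} = ?de ` hfree b r j"
  proof (intro equalityI subsetI)
    fix v assume "v \<in> {v \<in> hfree a m j. ?pi v = 0}"
    then have v: "v \<in> free m" "hvec a j v" "?pi v = 0" by (auto simp: hfree_def)
    then obtain c where c: "v = (\<Sum>l<r. fscale (c l) (k l))" using rel by blast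
    have "v = vpart a j v" using vpart_hvec[OF v(2)] by simp
    also have "\<dots> = (\<Sum>l<r. fscale (hpart (b l) j (c l)) (k l))"
      unfolding c using k(2) by (intro vpart_sum_fscale) auto
    finally have "v = ?de (vec_of r (\<lambda>l. hpart (b l) j (c l)))" by (simp add: lookup_vec_of)
    moreover have "vec_of r (\<lambda>l. hpart (b l) j (c l)) \<in> hfree b r j"
      by (auto simp: hfree_def vec_of_in_free hvec_def lookup_vec_of keys_hpart split: if_splits)
    ultimately show "v \<in> ?de ` hfree b r j" by blast
  next
    fix v assume "v \<in> ?de ` hfree b r j"
    then obtain w where w: "w \<in> free r" "hvec b j w" "v = ?de w" by (auto simp: hfree_def)
    have "v \<in> free m" unfolding w(3) using k(1)
      by (intro fmod.subspace_sum[OF subspace_free] fmod.subspace_scale[OF subspace_free]) auto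
    moreover have "hvec a j v"
    proof -
      have "vpart a j v = (\<Sum>l<r. fscale (hpart (b l) j (Poly_Mapping.lookup w l)) (k l))"
        unfolding w(3) using k(2) by (intro vpart_sum_fscale) auto
      also have "\<dots> = v" unfolding w(3) using w(2) by (intro sum.cong refl) (simp add: hpart_idI hvec_def)
      finally show ?thesis using hvec_vpart by metis
    qed
    moreover have "?pi v = 0"
    proof -
      have "?pi v = (\<Sum>l<r. Poly_Mapping.lookup w l * (\<Sum>i<m. Poly_Mapping.lookup (k l) i * g i))"
        unfolding w(3) lookup_sum lookup_fscale sum_distrib_right sum_distrib_left mult.assoc
        by (rule sum.swap)
      also have "\<dots> = 0" using k(3) by simp
      finally show ?thesis .
    qed
    ultimately show "v \<in> {v \<in> hfree a m j. ?pi v = 0}" by (simp add: hfree_def)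
  qed
  have ker0: "{w \<in> hfree b r j. ?de w = 0} = {0}"
  proof (intro equalityI subsetI)
    fix w assume "w \<in> {w \<in> hfree b r j. ?de w = 0}"
    then have w: "w \<in> free r" "?de w = 0" by (auto simp: hfree_def)
    have "Poly_Mapping.lookup w l = 0" for l
      using indep[OF w(2)] w(1) by (cases "l < r") (auto simp: mem_free_iff)
    then show "w \<in> {0}" using poly_mapping_eqI[of w 0] by simp
  qed (auto simp: hfree_def free_def)
  obtain W where W: "finite W" "hfree a m j \<subseteq> fkspace.span (W :: (nat \<Rightarrow>\<^sub>0 ('n, 'k) mpoly) set)"
    by (rule hfree_spanned)
  obtain W' where W': "finite W'" "hfree b r j \<subseteq> fkspace.span (W' :: (nat \<Rightarrow>\<^sub>0 ('n, 'k) mpoly) set)"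
    by (rule hfree_spanned)
  have "fkspace.dim (hfree a m j :: (nat \<Rightarrow>\<^sub>0 ('n, 'k) mpoly) set) = kspace.dim (?pi ` hfree a m j) + fkspace.dim {v \<in> hfree a m j. ?pi v = 0}"
    using rank_nullity_on[OF lincomb_linear[of g m] subspace_hfree W(2,1)] by blast
  moreover have "fkspace.dim (hfree b r j :: (nat \<Rightarrow>\<^sub>0 ('n, 'k) mpoly) set) = fkspace.dim (?de ` hfree b r j) + fkspace.dim {w \<in> hfree b r j. ?de w = 0}"
    using rank_nullity_on[OF lincomb_fscale_linear[of k r] subspace_hfree W'(2,1)] by blast
  ultimately show ?thesis
    unfolding img ker ker0 dim_hfree dim_zero_space[OF vector_space_fkscale] by simp
qed

lemma forms_spanned:
  obtains W where "finite W" "{p :: ('n::{finite,linorder}, 'k::field) mpoly. homogeneous j p} \<subseteq> kspace.span W"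
proof
  let ?W = "(\<lambda>t. Poly_Mapping.single t 1 :: ('n, 'k) mpoly) ` {t. monomial_degree t + 0 = j}"
  show "finite ?W" by (intro finite_imageI finite_monomials)
  show "{p :: ('n, 'k) mpoly. homogeneous j p} \<subseteq> kspace.span ?W"
  proof
    fix p :: "('n, 'k) mpoly" assume p: "p \<in> {p. homogeneous j p}"
    have "(\<Sum>t\<in>Poly_Mapping.keys p. kscale (Poly_Mapping.lookup p t) (Poly_Mapping.single t 1)) \<in> kspace.span ?W"
      using p by (intro kspace.span_sum kspace.span_scale kspace.span_base) (auto simp: homogeneous_def)
    also have "(\<Sum>t\<in>Poly_Mapping.keys p. kscale (Poly_Mapping.lookup p t) (Poly_Mapping.single t 1)) = p"
      using poly_mapping_sum_single[of p] by (simp add: kscale_def mult_single)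
    finally show "p \<in> kspace.span ?W" .
  qed
qed

text \<open>The whole ring is the ideal generated by 1 with no relations, so the preceding count
  applies.\<close>

lemma dim_forms:
  "kspace.dim {p :: ('n::{finite,linorder}, 'k::field) mpoly. homogeneous j p} = nmonom TYPE('n) j 0"
proof -
  have "kspace.dim {p :: ('n, 'k) mpoly. homogeneous j p \<and> (\<exists>c. p = (\<Sum>i<1::nat. c i * 1))}
      + (\<Sum>l<0::nat. nmonom TYPE('n) j 0) = (\<Sum>i<1::nat. nmonom TYPE('n) j 0)"
  proof (rule dim_presentation[where k = "\<lambda>_. 0"])
    fix v :: "nat \<Rightarrow>\<^sub>0 ('n, 'k) mpoly"
    assume v: "v \<in> free 1" "(\<Sum>i<1. Poly_Mapping.lookup v i * 1) = 0"
    have "Poly_Mapping.lookup v i = 0" for i using v by (cases i) (auto simp: mem_free_iff)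
    then show "\<exists>c. v = (\<Sum>l<0. fscale (c l) 0)" using poly_mapping_eqI[of v 0] by simp
  qed (auto simp: homogeneous_def)
  moreover have "\<exists>c :: nat \<Rightarrow> ('n, 'k) mpoly. p = c 0" for p by (rule exI[of _ "\<lambda>_. p"]) simp
  ultimately show ?thesis by simp
qed

lemma nmonom_shift: "nmonom T j s = (if s \<le> j then nmonom T (j - s) 0 else 0)"
proof -
  have "monomial_degree t + s = j \<longleftrightarrow> monomial_degree t + 0 = j - s" if "s \<le> j" for t using that by auto
  then show ?thesis by (auto simp: nmonom_def intro!: arg_cong[where f = card])
qed

text \<open>Stars and bars, with monomials read as exponent lists. The lower index of the binomial
  is constant, so the count is polynomial in j.\<close>

lemma nmonom_eq_binomial: "nmonom TYPE('n::finite) j 0 = (j + (CARD('n) - 1)) choose (CARD('n) - 1)"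
proof -
  obtain xs :: "'n list" where xs: "set xs = UNIV" "distinct xs" using finite_distinct_list[of "UNIV :: 'n set"] by auto
  have len: "length xs = CARD('n)" using distinct_card[OF xs(2)] xs(1) by simp
  have pos: "CARD('n) > 0" by simp
  have "bij_betw (\<lambda>t. map (Poly_Mapping.lookup t) xs) {t :: 'n \<Rightarrow>\<^sub>0 nat. monomial_degree t + 0 = j}
     {l. length l = CARD('n) \<and> sum_list l = j}"
    unfolding bij_betw_def
  proof
    show "inj_on (\<lambda>t. map (Poly_Mapping.lookup t) xs) {t :: 'n \<Rightarrow>\<^sub>0 nat. monomial_degree t + 0 = j}"
      by (rule inj_onI) (use xs(1) in \<open>auto intro!: poly_mapping_eqI simp: map_eq_conv\<close>)
    show "(\<lambda>t. map (Poly_Mapping.lookup t) xs) ` {t :: 'n \<Rightarrow>\<^sub>0 nat. monomial_degree t + 0 = j}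
      = {l. length l = CARD('n) \<and> sum_list l = j}" (is "?f ` ?A = ?B")
    proof (intro equalityI subsetI)
      fix l assume "l \<in> ?f ` ?A"
      then show "l \<in> ?B" using len xs by (auto simp: sum_list_distinct_conv_sum_set monomial_degree_def)
    next
      fix l assume l: "l \<in> ?B"
      define t :: "'n \<Rightarrow>\<^sub>0 nat" where
        "t = Abs_poly_mapping (\<lambda>x. l ! inv_into {..<length xs} ((!) xs) x)"
      have t: "Poly_Mapping.lookup t x = l ! inv_into {..<length xs} ((!) xs) x" for x
        by (simp add: t_def)
      have "inj_on ((!) xs) {..<length xs}" using xs(2) by (simp add: inj_on_nth)
      then have eq: "map (Poly_Mapping.lookup t) xs = l"
        using l len by (intro nth_equalityI) (auto simp: t inv_into_f_f)
      moreover have "monomial_degree t = j"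
        using l xs sum_list_distinct_conv_sum_set[OF xs(2), of "Poly_Mapping.lookup t"] eq
        by (simp add: monomial_degree_def)
      ultimately show "l \<in> ?f ` ?A" by (intro image_eqI[of _ _ t]) auto
    qed
  qed
  then have "nmonom TYPE('n) j 0 = (j + CARD('n) - 1) choose j"
    unfolding nmonom_def by (simp add: bij_betw_same_card card_length_sum_list)
  also have "j + CARD('n) - 1 = j + (CARD('n) - 1)" using pos by linarith
  also have "(j + (CARD('n) - 1)) choose j = (j + (CARD('n) - 1)) choose (CARD('n) - 1)"
    by (metis add_diff_cancel_left' binomial_symmetric le_add1)
  finally show ?thesis .
qed

text \<open>For coprime forms the only relations are the multiples of the Koszul relation, so the
  ideal they generate has generators in degree e, e and one free relation in degree 2e. This ideal
  is contained in \<open>I\<close>.\<close>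

lemma koszul_dim_bound:
  fixes g1 g2 :: "('n::{finite,linorder}, 'k::field) mpoly"
  assumes g: "homogeneous e g1" "homogeneous e g2" "g1 \<noteq> 0" "g2 \<noteq> 0"
    and coprime: "\<And>p. prime_elem p \<Longrightarrow> \<not> (p dvd g1 \<and> p dvd g2)"
    and I: "is_ideal I" "g1 \<in> I" "g2 \<in> I"
  shows "2 * nmonom TYPE('n) j e \<le> kspace.dim {p \<in> I. homogeneous j p} + nmonom TYPE('n) j (2 * e)"
proof -
  interpret R: module "(*) :: ('n, 'k) mpoly \<Rightarrow> _" by (rule module_times)
  define g where "g i = (if i = 0 then g1 else g2)" for i :: nat
  define k where "k = Poly_Mapping.single 0 g2 - Poly_Mapping.single (Suc 0) g1"
  have lk: "Poly_Mapping.lookup k i = (if i = 0 then g2 else if i = 1 then - g1 else 0)" for i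
    by (simp add: k_def lookup_minus lookup_single when_def)
  have two: "{..<2::nat} = {0, 1}" by auto
  have "kspace.dim {p. homogeneous j p \<and> (\<exists>c. p = (\<Sum>i<2. c i * g i))} + (\<Sum>l<1::nat. nmonom TYPE('n) j (2 * e))
       = (\<Sum>i<2::nat. nmonom TYPE('n) j e)"
  proof (rule dim_presentation[where k = "\<lambda>_. k" and g = g and a = "\<lambda>_. e" and b = "\<lambda>_. 2 * e"])
    show "homogeneous e (g i)" for i using g by (simp add: g_def)
    show "k \<in> free 2" by (simp add: mem_free_iff lk)
    show "hvec (\<lambda>_. e) (2 * e) k" using g(1,2) by (auto simp: hvec_def lk homogeneous_def)
    show "(\<Sum>i<2. Poly_Mapping.lookup k i * g i) = 0" by (simp add: two lk g_def)
  next
    fix v :: "nat \<Rightarrow>\<^sub>0 ('n, 'k) mpoly"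
    assume v: "v \<in> free 2" "(\<Sum>i<2. Poly_Mapping.lookup v i * g i) = 0"
    define u where "u = Poly_Mapping.lookup v 0"
    define w where "w = Poly_Mapping.lookup v 1"
    have sum0: "u * g1 + w * g2 = 0" using v(2) by (simp add: two g_def u_def w_def)
    then have eq: "u * g1 = g2 * (- w)" by (simp add: eq_neg_iff_add_eq_0 mult.commute)
    have "g2 dvd u"
    proof (rule mpoly_primitive_dvd[OF g(4), of "{g1, g2}"])
      show "\<exists>y\<in>{g1, g2}. \<not> p dvd y" if "prime_elem p" for p using coprime[OF that] by auto
    qed (use eq in auto)
    then obtain c where c: "u = g2 * c" by (elim dvdE)
    have "g2 * (c * g1 + w) = u * g1 + w * g2" by (simp only: c distrib_left mult.assoc mult.commute[of g2 w])
    then have "g2 * (c * g1 + w) = 0" using sum0 by simp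
    then have w: "w = - (c * g1)" using g(4) by (simp add: eq_neg_iff_add_eq_0 add.commute)
    have "v = fscale c k"
    proof (rule poly_mapping_eqI)
      fix i :: nat
      consider "i = 0" | "i = 1" | "i \<ge> 2" by linarith
      then show "Poly_Mapping.lookup v i = Poly_Mapping.lookup (fscale c k) i"
        using v(1) c w by cases (auto simp: lookup_fscale lk mem_free_iff u_def w_def)
    qed
    then show "\<exists>c. v = (\<Sum>l<1::nat. fscale (c l) k)" by auto
  next
    fix c :: "nat \<Rightarrow> ('n, 'k) mpoly" and l :: nat
    assume c: "(\<Sum>l<1::nat. fscale (c l) k) = 0" "l < 1"
    then have "Poly_Mapping.lookup (fscale (c 0) k) 0 = 0" by simp
    then show "c l = 0" using g(4) c(2) by (simp add: lookup_fscale lk)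
  qed
  moreover have "kspace.dim {p. homogeneous j p \<and> (\<exists>c. p = (\<Sum>i<2. c i * g i))} \<le> kspace.dim {p \<in> I. homogeneous j p}"
  proof -
    obtain W where W: "finite W" "{p :: ('n, 'k) mpoly. homogeneous j p} \<subseteq> kspace.span W" by (rule forms_spanned)
    have "c 0 * g1 + c 1 * g2 \<in> I" for c :: "nat \<Rightarrow> ('n, 'k) mpoly"
      using I by (intro R.subspace_add R.subspace_scale)
    then have "{p. homogeneous j p \<and> (\<exists>c. p = (\<Sum>i<2. c i * g i))} \<subseteq> {p \<in> I. homogeneous j p}"
      by (auto simp: two g_def)
    then show ?thesis using W by (intro dim_subset_on[OF vector_space_kscale]) auto
  qed
  ultimately show ?thesis by simp
qed

text \<open>The natural number subtraction in \<open>hilbert_function\<close> is never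
  truncated.\<close>

lemma dim_plus_hilbert_function:
  fixes I :: "('n::{finite,linorder}, 'k::field) mpoly set"
  shows "kspace.dim {p \<in> I. homogeneous j p} + hilbert_function I j = nmonom TYPE('n) j 0"
proof -
  obtain W where W: "finite W" "{p :: ('n, 'k) mpoly. homogeneous j p} \<subseteq> kspace.span W" by (rule forms_spanned)
  then have "kspace.dim {p \<in> I. homogeneous j p} \<le> kspace.dim {p :: ('n, 'k) mpoly. homogeneous j p}"
    by (intro dim_subset_on[OF vector_space_kscale]) auto
  then show ?thesis by (simp add: hilbert_function_def dim_forms)
qed


section \<open>Multiplicity from a resolution\<close>

text \<open>A uniform bound c is what carries the induction over a + x p: mere positivity of p would
  not ensure that j p(j) outgrows -a.\<close>

lemma poly_eventually_ge:
  fixes P :: "rat poly"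
  assumes "lead_coeff P > 0"
  shows "\<exists>c>0. \<forall>\<^sub>F j in sequentially. poly P (of_nat j) \<ge> c"
  using assms
proof (induction P)
  case (pCons a p)
  show ?case
  proof (cases "p = 0")
    case True
    then show ?thesis using pCons.prems by (intro exI[of _ a]) auto
  next
    case False
    then obtain c where c: "c > 0" "\<forall>\<^sub>F j in sequentially. poly p (of_nat j) \<ge> c"
      using pCons by auto
    obtain N :: nat where N: "(1 - a) / c \<le> of_nat N" using real_arch_simple by blast
    have "\<forall>\<^sub>F j in sequentially. poly (pCons a p) (of_nat j) \<ge> 1"
      using c(2) eventually_ge_at_top[of N]
    proof eventually_elim
      case (elim j)
      have "(1 - a) / c \<le> of_nat j" using N elim(2) by (meson of_nat_le_iff order_trans)
      then have "1 - a \<le> of_nat j * c" using c(1) by (simp add: pos_divide_le_eq)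
      also have "\<dots> \<le> of_nat j * poly p (of_nat j)" using elim(1) by (intro mult_left_mono) auto
      finally show ?case by simp
    qed
    then show ?thesis by (intro exI[of _ 1]) auto
  qed
qed simp

text \<open>A negative coefficient at \<open>k\<close> would be the leading one and make the values
  eventually negative.\<close>

lemma coeff_nonneg_if_eventually_nonneg:
  fixes P :: "rat poly"
  assumes "\<forall>\<^sub>F j in sequentially. poly P (of_nat j) \<ge> 0" "\<And>i. i > k \<Longrightarrow> coeff P i = 0"
  shows "coeff P k \<ge> 0"
proof (rule ccontr)
  assume neg: "\<not> ?thesis"
  then have "degree P = k" using assms(2) by (metis le_degree less_le not_le order_refl leading_coeff_0_iff coeff_0 nat_neq_iff)
  then have "lead_coeff (- P) > 0" using neg by simp
  then obtain c where "c > 0" "\<forall>\<^sub>F j in sequentially. poly (- P) (of_nat j) \<ge> c"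
    using poly_eventually_ge by blast
  from eventually_conj[OF assms(1) this(2)]
  obtain j :: nat where "poly P (of_nat j) \<ge> 0 \<and> poly (- P) (of_nat j) \<ge> c"
    by (auto simp: eventually_sequentially)
  then show False using \<open>c > 0\<close> by simp
qed

lemma rat_poly_eqI_eventually:
  fixes P Q :: "rat poly"
  assumes "\<forall>\<^sub>F j in sequentially. poly P (of_nat j) = poly Q (of_nat j)"
  shows "P = Q"
proof (rule ccontr)
  assume "P \<noteq> Q"
  then have "finite {x. poly (P - Q) x = 0}" by (intro poly_roots_finite) simp
  moreover obtain N where N: "\<And>j. j \<ge> N \<Longrightarrow> poly P (of_nat j) = poly Q (of_nat j)"
    using assms by (auto simp: eventually_sequentially)
  have "(of_nat :: nat \<Rightarrow> rat) ` {N..} \<subseteq> {x. poly (P - Q) x = 0}" using N by auto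
  ultimately have "finite ((of_nat :: nat \<Rightarrow> rat) ` {N..})" using finite_subset by blast
  then have "finite {N..}" by (rule finite_imageD) (simp add: inj_on_def)
  then show False by (simp add: infinite_Ici)
qed

text \<open>The binomial coefficient (x + D choose D) as a polynomial in x: the Hilbert polynomial
  of a polynomial ring in D + 1 variables.\<close>

definition binom_poly :: "nat \<Rightarrow> rat poly" where
  "binom_poly D = smult (1 / fact D) (\<Prod>i\<in>{0..<D}. [:1 + of_nat i, 1:])"

text \<open>The Hilbert polynomial of R(-s).\<close>

definition shift_poly :: "nat \<Rightarrow> nat \<Rightarrow> rat poly" where
  "shift_poly D s = pcompose (binom_poly D) [:- of_nat s, 1:]"

lemma poly_binom_poly: "poly (binom_poly D) (of_nat j) = of_nat ((j + D) choose D)"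
proof -
  have "of_nat ((j + D) choose D) = (of_nat (j + D) gchoose D :: rat)" by (rule binomial_gbinomial)
  also have "\<dots> = pochhammer (of_nat j + 1) D / fact D" by (simp add: gbinomial_pochhammer')
  also have "\<dots> = poly (binom_poly D) (of_nat j)"
    by (simp add: binom_poly_def poly_prod pochhammer_prod add_ac)
  finally show ?thesis by simp
qed

lemma poly_shift_poly:
  assumes "s \<le> j" and "CARD('n::finite) = Suc D"
  shows "poly (shift_poly D s) (of_nat j) = of_nat (nmonom TYPE('n) j s)"
proof -
  have "poly (shift_poly D s) (of_nat j) = poly (binom_poly D) (of_nat (j - s))"
    using assms(1) by (simp add: shift_poly_def poly_pcompose of_nat_diff)
  also have "\<dots> = of_nat (nmonom TYPE('n) j s)"
    unfolding poly_binom_poly using assms nmonom_shift[of "TYPE('n)" j s] nmonom_eq_binomial[where 'n = 'n] by simp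
  finally show ?thesis .
qed

lemma degree_binom_poly: "degree (binom_poly D) = D" and coeff_binom_poly: "coeff (binom_poly D) D = 1 / fact D"
proof -
  let ?P = "\<Prod>i\<in>{0..<D}. [:1 + of_nat i, 1:] :: rat poly"
  have "degree ?P = (\<Sum>i\<in>{0..<D}. degree [:1 + of_nat i, 1 :: rat:])"
    by (intro degree_prod_eq_sum_degree) auto
  then have deg: "degree ?P = D" by simp
  have "lead_coeff ?P = 1" by (simp add: lead_coeff_prod)
  then show "degree (binom_poly D) = D" "coeff (binom_poly D) D = 1 / fact D"
    using deg by (simp_all add: binom_poly_def)
qed

lemma pcompose_eq_sum:
  fixes P :: "rat poly"
  assumes "degree P \<le> N"
  shows "pcompose P Q = (\<Sum>i\<le>N. smult (coeff P i) (Q ^ i))"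
proof -
  have "poly (pcompose P Q) x = poly (\<Sum>i\<le>N. smult (coeff P i) (Q ^ i)) x" for x
  proof -
    have "poly (pcompose P Q) x = (\<Sum>i\<le>degree P. coeff P i * poly Q x ^ i)"
      unfolding poly_pcompose poly_altdef[of P] ..
    also have "\<dots> = (\<Sum>i\<le>N. coeff P i * poly Q x ^ i)"
      using assms by (intro sum.mono_neutral_left) (auto simp: coeff_eq_0 not_le)
    finally show ?thesis by (simp add: poly_sum)
  qed
  then show ?thesis by (simp add: poly_eq_poly_eq_iff[symmetric] fun_eq_iff)
qed

lemma coeff_linear_power: "coeff ([:c, 1 :: rat:] ^ i) j = (if j \<le> i then of_nat (i choose j) * c ^ (i - j) else 0)"
proof (cases "j \<le> i")
  case True
  then show ?thesis by (simp add: coeff_linear_poly_power)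
next
  case False
  have "degree ([:c, 1:] ^ i) \<le> i" using degree_power_le[of "[:c, 1:]" i] by simp
  then show ?thesis using False by (simp add: coeff_eq_0)
qed

text \<open>The three top coefficients have degrees 0, 1 and 2 in s. Hence an alternating sum of
  shifts involves, in these places, only the number, the sum and the sum of squares of the
  degrees.\<close>

lemma coeff_shift_poly:
  fixes E :: nat
  defines "D \<equiv> Suc (Suc E)"
  shows "i > D \<Longrightarrow> coeff (shift_poly D s) i = 0"
    and "coeff (shift_poly D s) D = 1 / fact D"
    and "coeff (shift_poly D s) (Suc E) = coeff (binom_poly D) (Suc E) - of_nat D / fact D * of_nat s"
    and "coeff (shift_poly D s) E = coeff (binom_poly D) E - of_nat (Suc E) * coeff (binom_poly D) (Suc E) * of_nat s
           + of_nat (s ^ 2) / (2 * fact E)"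
proof -
  have c: "coeff (shift_poly D s) j = (\<Sum>i\<le>D. coeff (binom_poly D) i * coeff ([:- of_nat s, 1:] ^ i) j)" for j
    unfolding shift_poly_def by (subst pcompose_eq_sum[of _ D]) (simp_all add: degree_binom_poly coeff_sum)
  have lo: "(\<Sum>i<j. coeff (binom_poly D) i * coeff ([:- of_nat s, 1:] ^ i) j) = 0" for j
    by (intro sum.neutral) (auto simp: coeff_linear_power)
  show "coeff (shift_poly D s) i = 0" if "i > D"
    using that by (simp add: c coeff_linear_power)
  show "coeff (shift_poly D s) D = 1 / fact D"
    unfolding c lessThan_Suc_atMost[symmetric] sum.lessThan_Suc lo by (simp add: coeff_linear_power coeff_binom_poly)
  have c1: "coeff (shift_poly D s) (Suc E) = coeff (binom_poly D) (Suc E) - of_nat D * coeff (binom_poly D) D * of_nat s"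
    unfolding c unfolding lessThan_Suc_atMost[symmetric] D_def sum.lessThan_Suc lo[unfolded D_def] coeff_linear_power
    by simp
  then show "coeff (shift_poly D s) (Suc E) = coeff (binom_poly D) (Suc E) - of_nat D / fact D * of_nat s"
    by (simp add: coeff_binom_poly)
  have ch: "Suc (Suc E) choose E = Suc (Suc E) choose 2" using binomial_symmetric[of E "Suc (Suc E)"] by simp
  have two: "(of_nat (Suc (Suc E) choose 2) :: rat) = of_nat (Suc (Suc E)) * of_nat (Suc E) / 2"
  proof -
    have "2 * (Suc (Suc E) choose 2) = Suc (Suc E) * Suc E"
      using Suc_times_binomial[of 1 "Suc E"] by (simp add: numeral_2_eq_2)
    then have "(2 * of_nat (Suc (Suc E) choose 2) :: rat) = of_nat (Suc (Suc E)) * of_nat (Suc E)"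
      by (metis of_nat_mult of_nat_numeral)
    then show ?thesis by simp
  qed
  have "coeff (shift_poly D s) E = coeff (binom_poly D) E - of_nat (Suc E) * coeff (binom_poly D) (Suc E) * of_nat s
     + of_nat (D choose 2) * coeff (binom_poly D) D * (of_nat s)\<^sup>2"
    unfolding c unfolding lessThan_Suc_atMost[symmetric] D_def sum.lessThan_Suc lo[unfolded D_def] coeff_linear_power
    by (simp add: ch power2_eq_square Suc_diff_le)
  also have "of_nat (D choose 2) * coeff (binom_poly D) D = (1 / (2 * fact E) :: rat)"
    unfolding coeff_binom_poly D_def two by (simp add: field_simps del: of_nat_Suc)
  finally show "coeff (shift_poly D s) E = coeff (binom_poly D) E - of_nat (Suc E) * coeff (binom_poly D) (Suc E) * of_nat s
           + of_nat (s ^ 2) / (2 * fact E)" by simp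
qed

text \<open>The Hilbert polynomial of \<open>R/I\<close> is read off a length-one resolution of \<open>I\<close>. Its three top
  coefficients are compared with those for a complete intersection of two forms of degree \<open>e\<close>.\<close>

lemma multiplicity_from_resolution:
  fixes I :: "('n::{finite,linorder}, 'k::field) mpoly set" and a b :: "nat \<Rightarrow> nat"
  assumes n: "CARD('n) \<ge> 3"
    and hilb: "\<And>j. kspace.dim {p \<in> I. homogeneous j p} + (\<Sum>l<r. nmonom TYPE('n) j (b l)) = (\<Sum>i<m. nmonom TYPE('n) j (a i))"
    and bound: "\<And>j. 2 * nmonom TYPE('n) j e \<le> kspace.dim {p \<in> I. homogeneous j p} + nmonom TYPE('n) j (2 * e)"
  shows "m = Suc r" "(\<Sum>i<m. a i) = (\<Sum>l<r. b l)"
    "(\<Sum>l<r. (b l)\<^sup>2) \<le> (\<Sum>i<m. (a i)\<^sup>2) + 2 * e\<^sup>2"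
    "(\<Sum>l<r. (b l)\<^sup>2) \<noteq> (\<Sum>i<m. (a i)\<^sup>2) \<Longrightarrow>
       multiplicity_quot I = (of_nat (\<Sum>l<r. (b l)\<^sup>2) - of_nat (\<Sum>i<m. (a i)\<^sup>2)) / 2"
proof -
  obtain E where E: "CARD('n) = Suc (Suc (Suc E))" using n by (metis add_eq_if le_Suc_ex numeral_3_eq_3 plus_nat.simps(2))
  define D where "D = Suc (Suc E)"
  have cardD: "CARD('n) = Suc D" by (simp add: E D_def)
  \<comment> \<open>\<open>q\<close> and \<open>ci\<close> are the Hilbert polynomials of R/I and of
    a complete intersection of two forms of degree \<open>e\<close>. From \<open>N\<close> on, all
    shifts involved agree with actual dimensions.\<close>
  define q where "q = shift_poly D 0 - (\<Sum>i<m. shift_poly D (a i)) + (\<Sum>l<r. shift_poly D (b l))"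
  define ci where "ci = shift_poly D 0 - smult 2 (shift_poly D e) + shift_poly D (2 * e)"
  define N where "N = (\<Sum>i<m. a i) + (\<Sum>l<r. b l) + 2 * e"
  have aN: "a i \<le> N" if "i < m" for i using member_le_sum[of i "{..<m}" a] that by (simp add: N_def)
  have bN: "b l \<le> N" if "l < r" for l using member_le_sum[of l "{..<r}" b] that by (simp add: N_def)
  have eN: "e \<le> N" "2 * e \<le> N" by (simp_all add: N_def)
  have val: "poly (shift_poly D s) (of_nat j) = of_nat (nmonom TYPE('n) j s)" if "s \<le> j" for s j
    using poly_shift_poly[OF that cardD] .
  have q_val: "poly q (of_nat j) = of_nat (hilbert_function I j)" if "j \<ge> N" for j
  proof -
    have "(of_nat (kspace.dim {p \<in> I. homogeneous j p}) :: rat) + of_nat (\<Sum>l<r. nmonom TYPE('n) j (b l))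
       = of_nat (\<Sum>i<m. nmonom TYPE('n) j (a i))" 
      using arg_cong[OF hilb[of j], of "of_nat :: nat \<Rightarrow> rat"] by (simp only: of_nat_add)
    moreover have "(of_nat (kspace.dim {p \<in> I. homogeneous j p}) :: rat) + of_nat (hilbert_function I j)
       = of_nat (nmonom TYPE('n) j 0)" 
      using arg_cong[OF dim_plus_hilbert_function[of I j], of "of_nat :: nat \<Rightarrow> rat"] by (simp only: of_nat_add)
    moreover have "(\<Sum>i<m. poly (shift_poly D (a i)) (of_nat j)) = of_nat (\<Sum>i<m. nmonom TYPE('n) j (a i))"
      unfolding of_nat_sum using aN that by (intro sum.cong refl val) (auto intro: order_trans)
    moreover have "(\<Sum>l<r. poly (shift_poly D (b l)) (of_nat j)) = of_nat (\<Sum>l<r. nmonom TYPE('n) j (b l))"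
      unfolding of_nat_sum using bN that by (intro sum.cong refl val) (auto intro: order_trans)
    ultimately show ?thesis by (simp add: q_def poly_sum val[of 0])
  qed
  have ci_val: "poly ci (of_nat j) \<ge> of_nat (hilbert_function I j)" if "j \<ge> N" for j
  proof -
    have "2 * nmonom TYPE('n) j e + hilbert_function I j \<le> nmonom TYPE('n) j 0 + nmonom TYPE('n) j (2 * e)"
      using bound[of j] dim_plus_hilbert_function[of I j] by linarith
    then have "(of_nat (2 * nmonom TYPE('n) j e + hilbert_function I j) :: rat) \<le> of_nat (nmonom TYPE('n) j 0 + nmonom TYPE('n) j (2 * e))"
      by (simp only: of_nat_le_iff)
    then show ?thesis using that eN by (simp add: ci_def val)
  qed
  have ev_q: "\<forall>\<^sub>F j in sequentially. poly q (of_nat j) \<ge> 0"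
    using eventually_ge_at_top[of N] by eventually_elim (simp add: q_val)
  have ev_ci: "\<forall>\<^sub>F j in sequentially. poly (ci - q) (of_nat j) \<ge> 0"
    using eventually_ge_at_top[of N] by eventually_elim (use q_val ci_val in auto)
  note cs = coeff_shift_poly[of E, folded D_def]
  define B where "B = binom_poly D"
  have q_hi: "coeff q i = 0" if "i > D" for i using cs(1)[OF that] by (simp add: q_def coeff_sum)
  have ci_hi: "coeff ci i = 0" if "i > Suc E" for i
  proof (cases "i = D")
    case True
    then show ?thesis by (simp add: ci_def cs(2))
  next
    case False
    then show ?thesis using that cs(1)[of i] by (simp add: ci_def D_def)
  qed
  have ci_1: "coeff ci (Suc E) = 0" by (simp add: ci_def cs(3) algebra_simps)
  have ci_0: "coeff ci E = 2 * of_nat (e\<^sup>2) / (2 * fact E)" by (simp add: ci_def cs(4) field_simps power2_eq_square)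
  have q_D: "coeff q D = (1 - of_nat m + of_nat r) / fact D"
    by (simp add: q_def coeff_sum cs(2) field_simps)
  \<comment> \<open>Both \<open>q\<close> and \<open>ci - q\<close> are eventually nonnegative and
    \<open>ci\<close> has no terms above \<open>E\<close>. So the coefficient of \<open>q\<close> at
    \<open>D\<close>, and then that at \<open>Suc E\<close>, is nonnegative with nonnegative
    negative, hence zero.\<close>
  have "coeff q D \<ge> 0" by (rule coeff_nonneg_if_eventually_nonneg[OF ev_q]) (rule q_hi)
  moreover have "coeff (ci - q) D \<ge> 0"
    by (rule coeff_nonneg_if_eventually_nonneg[OF ev_ci]) (simp add: q_hi ci_hi D_def)
  ultimately have "coeff q D = 0" by (simp add: ci_hi D_def)
  then have "(of_nat m :: rat) = of_nat (Suc r)" by (simp add: q_D)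
  then show m: "m = Suc r" by (simp only: of_nat_eq_iff)
  have q_hi1: "coeff q i = 0" if "i > Suc E" for i
    using q_hi[of i] \<open>coeff q D = 0\<close> that by (cases "i = D") (auto simp: D_def)
  have q_1: "coeff q (Suc E) = of_nat D / fact D * (of_nat (\<Sum>i<m. a i) - of_nat (\<Sum>l<r. b l))"
    by (simp add: q_def coeff_sum cs(3) sum_subtractf m sum_distrib_left algebra_simps)
  have "coeff q (Suc E) \<ge> 0" by (rule coeff_nonneg_if_eventually_nonneg[OF ev_q]) (rule q_hi1)
  moreover have "coeff (ci - q) (Suc E) \<ge> 0"
    by (rule coeff_nonneg_if_eventually_nonneg[OF ev_ci]) (simp add: q_hi1 ci_hi)
  ultimately have q10: "coeff q (Suc E) = 0" by (simp add: ci_1)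
  then have "(of_nat (\<Sum>i<m. a i) :: rat) = of_nat (\<Sum>l<r. b l)" unfolding q_1 by (auto simp: D_def)
  then show ab: "(\<Sum>i<m. a i) = (\<Sum>l<r. b l)" by (simp only: of_nat_eq_iff)
  have q_hi0: "coeff q i = 0" if "i > E" for i
    using q_hi1[of i] q10 that by (cases "i = Suc E") auto
  have ab': "(\<Sum>i<m. of_nat (a i)) = (\<Sum>l<r. of_nat (b l) :: rat)"
    using ab by (metis of_nat_sum)
  have q_0: "coeff q E = (of_nat (\<Sum>l<r. (b l)\<^sup>2) - of_nat (\<Sum>i<m. (a i)\<^sup>2)) / (2 * fact E)"
  proof -
    \<comment> \<open>The coefficient of the terms linear in the shifts; these terms cancel because
      the degree sums agree.\<close>
    let ?c = "of_nat (Suc E) * coeff (binom_poly D) (Suc E)"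
    have s: "(\<Sum>i<k. coeff (shift_poly D (x i)) E) = of_nat k * coeff (binom_poly D) E - ?c * (\<Sum>i<k. of_nat (x i))
        + of_nat (\<Sum>i<k. (x i)\<^sup>2) / (2 * fact E)" for k and x :: "nat \<Rightarrow> nat"
      unfolding cs(4) sum.distrib sum_subtractf by (simp add: sum_distrib_left sum_divide_distrib)
    have "coeff q E = coeff (shift_poly D 0) E - (\<Sum>i<m. coeff (shift_poly D (a i)) E) + (\<Sum>l<r. coeff (shift_poly D (b l)) E)"
      by (simp add: q_def coeff_sum)
    also have "\<dots> = coeff (binom_poly D) E - of_nat m * coeff (binom_poly D) E + of_nat r * coeff (binom_poly D) E
       + (of_nat (\<Sum>l<r. (b l)\<^sup>2) - of_nat (\<Sum>i<m. (a i)\<^sup>2)) / (2 * fact E)"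
      unfolding s cs(4)[of 0] ab' by (simp add: diff_divide_distrib)
    also have "\<dots> = (of_nat (\<Sum>l<r. (b l)\<^sup>2) - of_nat (\<Sum>i<m. (a i)\<^sup>2)) / (2 * fact E)"
      by (simp add: m algebra_simps)
    finally show ?thesis .
  qed
  have ci_hi0: "coeff ci i = 0" if "i > E" for i
    using ci_hi[of i] ci_1 that by (cases "i = Suc E") auto
  have "coeff (ci - q) E \<ge> 0"
    by (rule coeff_nonneg_if_eventually_nonneg[OF ev_ci]) (simp add: q_hi0 ci_hi0)
  then have "(of_nat (\<Sum>l<r. (b l)\<^sup>2) - of_nat (\<Sum>i<m. (a i)\<^sup>2)) / (2 * fact E :: rat) \<le> 2 * of_nat (e\<^sup>2) / (2 * fact E)"
    by (simp add: ci_0 q_0)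
  then have "(of_nat (\<Sum>l<r. (b l)\<^sup>2) :: rat) - of_nat (\<Sum>i<m. (a i)\<^sup>2) \<le> 2 * of_nat (e\<^sup>2)"
    by (subst (asm) divide_le_cancel) auto
  then have "(of_nat (\<Sum>l<r. (b l)\<^sup>2) :: rat) \<le> of_nat ((\<Sum>i<m. (a i)\<^sup>2) + 2 * e\<^sup>2)"
    unfolding of_nat_add of_nat_mult of_nat_numeral by linarith
  then show "(\<Sum>l<r. (b l)\<^sup>2) \<le> (\<Sum>i<m. (a i)\<^sup>2) + 2 * e\<^sup>2" by (simp only: of_nat_le_iff)
  assume ne: "(\<Sum>l<r. (b l)\<^sup>2) \<noteq> (\<Sum>i<m. (a i)\<^sup>2)"
  have "hilbert_polynomial I = q"
    unfolding hilbert_polynomial_def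
  proof (rule the_equality)
    show q_ev: "\<forall>\<^sub>F j in sequentially. poly q (of_nat j) = of_nat (hilbert_function I j)"
      using eventually_ge_at_top[of N] by eventually_elim (simp add: q_val)
    fix q' :: "rat poly" assume "\<forall>\<^sub>F j in sequentially. poly q' (of_nat j) = of_nat (hilbert_function I j)"
    with q_ev have "\<forall>\<^sub>F j in sequentially. poly q' (of_nat j) = poly q (of_nat j)" by eventually_elim simp
    then show "q' = q" by (rule rat_poly_eqI_eventually)
  qed
  moreover have "coeff q E \<noteq> 0"
  proof -
    have "(of_nat (\<Sum>l<r. (b l)\<^sup>2) :: rat) \<noteq> of_nat (\<Sum>i<m. (a i)\<^sup>2)" using ne by (simp only: of_nat_eq_iff not_False_eq_True)
    then show ?thesis unfolding q_0 by simp
  qed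
  \<comment> \<open>With the degree equal to \<open>E\<close>, the factor \<open>fact E\<close> in
    the multiplicity cancels the one in \<open>q_0\<close>.\<close>
  moreover from this have "degree q = E"
    using q_hi0 by (metis le_antisym le_degree leading_coeff_0_iff not_less coeff_0)
  ultimately show "multiplicity_quot I = (of_nat (\<Sum>l<r. (b l)\<^sup>2) - of_nat (\<Sum>i<m. (a i)\<^sup>2)) / 2"
    unfolding multiplicity_quot_def Let_def by (cases "q = 0") (simp_all add: q_0)
qed

text \<open>Put b_l = a_(l+1) + u_l with u_l at least 1; the u_l add up to a_0. Each square b_l^2
  exceeds that of a_(l+1) by 2 a_(l+1) u_l + u_l^2, at least (2 a_0 + 1) u_l. Summing gives 2 a_0^2
  + a_0, from which the unpaired a_0^2 is subtracted.\<close>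

lemma sum_squares_gap:
  fixes a b :: "nat \<Rightarrow> nat"
  assumes sum: "(\<Sum>i<Suc r. a i) = (\<Sum>l<r. b l)" and gap: "\<And>l. l < r \<Longrightarrow> a (Suc l) < b l"
    and mono: "\<And>i. i \<le> r \<Longrightarrow> a 0 \<le> a i"
  shows "(\<Sum>i<Suc r. (a i)\<^sup>2) + a 0 * (a 0 + 1) \<le> (\<Sum>l<r. (b l)\<^sup>2)"
proof -
  define u where "u l = b l - a (Suc l)" for l
  have b: "b l = a (Suc l) + u l" "u l \<ge> 1" if "l < r" for l using gap[OF that] by (auto simp: u_def)
  have "(\<Sum>l<r. b l) = (\<Sum>l<r. a (Suc l)) + (\<Sum>l<r. u l)"
    unfolding sum.distrib[symmetric] using b by (intro sum.cong) auto
  moreover have "(\<Sum>i<Suc r. a i) = a 0 + (\<Sum>l<r. a (Suc l))" by (rule sum.lessThan_Suc_shift)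
  ultimately have su: "(\<Sum>l<r. u l) = a 0" using sum by simp
  have "(b l)\<^sup>2 \<ge> (a (Suc l))\<^sup>2 + 2 * a 0 * u l + u l" if "l < r" for l
  proof -
    have "a 0 * u l \<le> a (Suc l) * u l" using mono[of "Suc l"] that by (intro mult_right_mono) auto
    moreover have "u l \<le> u l * u l" using b(2)[OF that] by simp
    moreover have "(b l)\<^sup>2 = (a (Suc l))\<^sup>2 + 2 * (a (Suc l) * u l) + u l * u l"
      unfolding b(1)[OF that] power2_eq_square by (simp add: algebra_simps)
    ultimately show ?thesis unfolding mult.assoc[of 2] by linarith
  qed
  then have "(\<Sum>l<r. (a (Suc l))\<^sup>2 + 2 * a 0 * u l + u l) \<le> (\<Sum>l<r. (b l)\<^sup>2)" by (intro sum_mono) auto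
  moreover have "(\<Sum>l<r. (a (Suc l))\<^sup>2 + 2 * a 0 * u l + u l) = (\<Sum>l<r. (a (Suc l))\<^sup>2) + 2 * a 0 * a 0 + a 0"
    by (simp add: sum.distrib su flip: sum_distrib_left)
  moreover have "(\<Sum>i<Suc r. (a i)\<^sup>2) = (a 0)\<^sup>2 + (\<Sum>l<r. (a (Suc l))\<^sup>2)" by (rule sum.lessThan_Suc_shift)
  ultimately show ?thesis by (simp add: power2_eq_square algebra_simps)
qed


section \<open>Ranks and generators\<close>

text \<open>More than q vectors of length q over a domain are dependent, by elimination of the last
  coordinate without fractions.\<close>

lemma idom_dependent:
  fixes v :: "'l \<Rightarrow> nat \<Rightarrow> 'a::idom"
  assumes "finite L" "card L > q"
  shows "\<exists>w. (\<exists>l\<in>L. w l \<noteq> 0) \<and> (\<forall>i<q. (\<Sum>l\<in>L. w l * v l i) = 0)"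
  using assms
proof (induction q arbitrary: L v)
  case 0
  then have "L \<noteq> {}" by auto
  then show ?case by (intro exI[of _ "\<lambda>_. 1"]) auto
next
  case (Suc q)
  show ?case
  proof (cases "\<forall>l\<in>L. v l q = 0")
    case True
    from Suc.IH[of L v] Suc.prems obtain w where w: "\<exists>l\<in>L. w l \<noteq> 0" "\<forall>i<q. (\<Sum>l\<in>L. w l * v l i) = 0" by auto
    have "(\<Sum>l\<in>L. w l * v l i) = 0" if "i < Suc q" for i
      using w(2) True that by (cases "i = q") auto
    then show ?thesis using w(1) by blast
  next
    case False
    then obtain l0 where l0: "l0 \<in> L" "v l0 q \<noteq> 0" by blast
    let ?L = "L - {l0}"
    have "finite ?L" "card ?L > q" using Suc.prems l0 by auto
    \<comment> \<open>Each vector is multiplied by the pivot entry before the multiple of the pivot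
      vector is subtracted, so that coordinate \<open>q\<close> becomes 0.\<close>
    from Suc.IH[OF this, of "\<lambda>l i. v l0 q * v l i - v l q * v l0 i"] obtain w where
      w: "\<exists>l\<in>?L. w l \<noteq> 0" "\<And>i. i < q \<Longrightarrow> (\<Sum>l\<in>?L. w l * (v l0 q * v l i - v l q * v l0 i)) = 0" by blast
    define w' where "w' l = (if l = l0 then - (\<Sum>l\<in>?L. w l * v l q) else w l * v l0 q)" for l
    have expand: "(\<Sum>l\<in>L. w' l * v l i) = (\<Sum>l\<in>?L. w l * (v l0 q * v l i - v l q * v l0 i))" for i
    proof -
      have "(\<Sum>l\<in>L. w' l * v l i) = w' l0 * v l0 i + (\<Sum>l\<in>?L. w' l * v l i)"
        using Suc.prems(1) l0(1) by (rule sum.remove)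
      also have "(\<Sum>l\<in>?L. w' l * v l i) = (\<Sum>l\<in>?L. w l * v l0 q * v l i)"
        by (intro sum.cong) (auto simp: w'_def)
      also have "w' l0 * v l0 i = - (\<Sum>l\<in>?L. w l * v l q * v l0 i)"
        by (simp add: w'_def sum_distrib_right)
      finally show ?thesis by (simp add: right_diff_distrib sum_subtractf mult.assoc)
    qed
    have "(\<Sum>l\<in>L. w' l * v l i) = 0" if "i < Suc q" for i
    proof (cases "i = q")
      case True
      then show ?thesis unfolding expand by (simp add: mult.commute)
    next
      case False
      then show ?thesis unfolding expand using that by (intro w(2)) auto
    qed
    moreover have "\<exists>l\<in>L. w' l \<noteq> 0" using w(1) l0(2) by (auto simp: w'_def)
    ultimately show ?thesis by blast
  qed
qed

text \<open>From q relations a nontrivial combination can be formed whose coordinates 1, ..., q - 1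
  vanish. Being a relation too, it has coordinate 0 annihilating the nonzero \<open>g 0\<close>, so
  it is zero.\<close>

lemma independent_relations_less:
  fixes g :: "nat \<Rightarrow> 'r::idom" and k :: "nat \<Rightarrow> (nat \<Rightarrow>\<^sub>0 'r)"
  assumes "g 0 \<noteq> 0" "q > 0" and k: "\<And>l. l < c \<Longrightarrow> k l \<in> free q"
    "\<And>l. l < c \<Longrightarrow> (\<Sum>i<q. Poly_Mapping.lookup (k l) i * g i) = 0"
    and indep: "\<And>w l. (\<Sum>l<c. fscale (w l) (k l)) = 0 \<Longrightarrow> l < c \<Longrightarrow> w l = 0"
  shows "c < q"
proof (rule ccontr)
  assume "\<not> c < q"
  then have "card {..<c} > q - 1" using assms(2) by simp
  from idom_dependent[OF finite_lessThan this, of "\<lambda>l i. Poly_Mapping.lookup (k l) (Suc i)"]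
  obtain w where w: "\<exists>l<c. w l \<noteq> 0" "\<And>i. i < q - 1 \<Longrightarrow> (\<Sum>l<c. w l * Poly_Mapping.lookup (k l) (Suc i)) = 0"
    by blast
  let ?u = "\<Sum>l<c. fscale (w l) (k l)"
  have lu: "Poly_Mapping.lookup ?u i = (\<Sum>l<c. w l * Poly_Mapping.lookup (k l) i)" for i
    by (simp add: lookup_sum lookup_fscale)
  have pos: "Poly_Mapping.lookup ?u i = 0" if "i > 0" for i
  proof (cases "i < q")
    case True
    then show ?thesis using w(2)[of "i - 1"] that by (simp add: lu)
  next
    case False
    then show ?thesis using k(1) by (auto simp: lu mem_free_iff intro!: sum.neutral)
  qed
  have "(\<Sum>i<q. Poly_Mapping.lookup ?u i * g i) = (\<Sum>l<c. w l * (\<Sum>i<q. Poly_Mapping.lookup (k l) i * g i))"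
    unfolding lu sum_distrib_right sum_distrib_left mult.assoc by (rule sum.swap)
  also have "\<dots> = 0" using k(2) by simp
  also have "(\<Sum>i<q. Poly_Mapping.lookup ?u i * g i) = Poly_Mapping.lookup ?u 0 * g 0"
    using assms(2) pos by (subst sum.remove[of _ 0]) (auto intro!: sum.neutral)
  finally have "Poly_Mapping.lookup ?u 0 = 0" using assms(1) by simp
  with pos have "Poly_Mapping.lookup ?u i = 0" for i by (cases "i = 0") auto
  then have "?u = 0" by (intro poly_mapping_eqI) simp
  then show False using indep w(1) by blast
qed

lemma homogeneous_ideal_hpart:
  assumes "homogeneous_ideal I" "p \<in> I"
  shows "hpart 0 j p \<in> I"
proof -
  interpret R: module "(*) :: ('a, 'b) mpoly \<Rightarrow> _" by (rule module_times)
  obtain G where G: "\<And>g. g \<in> G \<Longrightarrow> \<exists>i. homogeneous i g" "I = R.span G"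
    using assms(1) by (auto simp: homogeneous_ideal_def)
  obtain S u where S: "finite S" "S \<subseteq> G" "p = (\<Sum>g\<in>S. u g * g)"
    using assms(2) unfolding G(2) R.span_explicit by auto
  have "hpart 0 j (u g * g) \<in> R.span G" if gS: "g \<in> S" for g
  proof -
    obtain i where "homogeneous i g" using gS S(2) G(1) by blast
    then have "hpart 0 j (u g * g) = hpart i j (u g) * g" by (intro hpart_mult) (auto simp: homogeneous_def)
    then show ?thesis using gS S(2) by (auto intro: R.span_scale R.span_base)
  qed
  then show ?thesis unfolding G(2) S(3) hpart_sum by (intro R.span_sum)
qed

text \<open>An ideal is treated as a graded submodule of the free module of rank one.\<close>

lemma homogeneous_ideal_minimal_generators:
  fixes I :: "('n::{finite,linorder}, 'k::field) mpoly set"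
  assumes I: "homogeneous_ideal I"
  obtains m :: nat and g a where "\<And>i. i < m \<Longrightarrow> g i \<in> I" "\<And>i. i < m \<Longrightarrow> homogeneous (a i) (g i)"
    "\<And>i i'. i \<le> i' \<Longrightarrow> i' < m \<Longrightarrow> a i \<le> a i'"
    "\<And>p. p \<in> I \<Longrightarrow> \<exists>c. p = (\<Sum>i<m. c i * g i)"
    "\<And>c i. (\<Sum>i<m. c i * g i) = 0 \<Longrightarrow> i < m \<Longrightarrow> Poly_Mapping.lookup (c i) 0 = (0 :: 'k)"
proof -
  interpret R: module "(*) :: ('n, 'k) mpoly \<Rightarrow> _" by (rule module_times)
  have sI: "R.subspace I" using I by (auto simp: homogeneous_ideal_def)
  define M where "M = {v \<in> free 1. Poly_Mapping.lookup v 0 \<in> I}"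
  have M_eq: "v = Poly_Mapping.single 0 (Poly_Mapping.lookup v 0)" if "v \<in> M" for v
    using that by (intro poly_mapping_eqI) (auto simp: M_def mem_free_iff lookup_single when_def)
  have gr: "graded_submodule (\<lambda>_. 0) 1 M"
    unfolding graded_submodule_def
  proof (intro conjI ballI allI)
    show "fmod.subspace M"
      using R.subspace_0[OF sI] R.subspace_add[OF sI] R.subspace_scale[OF sI] subspace_free[of 1]
      by (auto simp: M_def fmod.subspace_def lookup_add lookup_fscale)
    show "M \<subseteq> free 1" by (auto simp: M_def)
    fix v j assume "v \<in> M"
    then show "vpart (\<lambda>_. 0) j v \<in> M"
      using homogeneous_ideal_hpart[OF I] by (auto simp: M_def mem_free_iff lookup_vpart)
  qed
  show ?thesis
  proof (rule minimal_homogeneous_generators[OF gr])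
    fix m :: nat and k a
    assume k: "\<And>l. l < m \<Longrightarrow> k l \<in> M" "\<And>l. l < m \<Longrightarrow> hvec (\<lambda>_. 0) (a l) (k l)"
    "\<And>l l'. l \<le> l' \<Longrightarrow> l' < m \<Longrightarrow> a l \<le> a l'"
    "\<And>v. v \<in> M \<Longrightarrow> \<exists>c. v = (\<Sum>l<m. fscale (c l) (k l))"
    "\<And>c l. (\<Sum>l<m. fscale (c l) (k l)) = 0 \<Longrightarrow> l < m \<Longrightarrow> Poly_Mapping.lookup (c l) 0 = (0::'k)"
    define g where "g l = Poly_Mapping.lookup (k l) 0" for l
    have kg: "k l = Poly_Mapping.single 0 (g l)" if "l < m" for l
      unfolding g_def using M_eq[OF k(1)[OF that]] .
    have lin: "(\<Sum>l<m. fscale (c l) (k l)) = Poly_Mapping.single 0 (\<Sum>l<m. c l * g l)" for c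
    proof (rule poly_mapping_eqI)
      fix i
      show "Poly_Mapping.lookup (\<Sum>l<m. fscale (c l) (k l)) i = Poly_Mapping.lookup (Poly_Mapping.single 0 (\<Sum>l<m. c l * g l)) i"
        by (auto simp: lookup_sum lookup_fscale kg lookup_single when_def)
    qed
    show ?thesis
    proof (rule that[of m g a])
      show "g i \<in> I" if "i < m" for i using k(1)[OF that] by (simp add: M_def g_def)
      show "homogeneous (a i) (g i)" if "i < m" for i using k(2)[OF that] by (auto simp: hvec_def g_def homogeneous_def)
      show "a i \<le> a i'" if "i \<le> i'" "i' < m" for i i' using k(3) that by blast
      show "\<exists>c. p = (\<Sum>i<m. c i * g i)" if p: "p \<in> I" for p
      proof -
        have "Poly_Mapping.single 0 p \<in> M" using p by (simp add: M_def single_in_free)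
        from k(4)[OF this] obtain c where "Poly_Mapping.single 0 p = (\<Sum>l<m. fscale (c l) (k l))" ..
        then have "p = (\<Sum>l<m. c l * g l)" unfolding lin by (rule injD[OF inj_single])
        then show ?thesis by (rule exI[of _ c])
      qed
      show "Poly_Mapping.lookup (c i) 0 = (0 :: 'k)" if "(\<Sum>i<m. c i * g i) = 0" "i < m" for c i
        using k(5)[of c i] that lin[of c] by simp
    qed
  qed
qed

text \<open>Resolutions live in the countable free module, so triples must be copied to
  \<open>free 3\<close>. The order 1, 2, 3 is that of \<open>sum_3\<close> and
  \<open>forall_3\<close>; in the type \<open>3\<close> the numeral 3 denotes 0.\<close>

definition idx3 :: "nat \<Rightarrow> 3" where
  "idx3 i = (if i = 0 then 1 else if i = 1 then 2 else 3)"

definition enc3 :: "'r::comm_ring_1 ^ 3 \<Rightarrow> (nat \<Rightarrow>\<^sub>0 'r)" where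
  "enc3 x = vec_of 3 (\<lambda>i. x $ idx3 i)"

lemma lessThan_3: "{..<3::nat} = {0, 1, 2}"
  by auto

lemma lookup_enc3: "Poly_Mapping.lookup (enc3 x) i = (if i < 3 then x $ idx3 i else 0)"
  by (simp add: enc3_def lookup_vec_of)

lemma enc3_hom: "module_hom_on (*s) fscale UNIV (free 3) enc3"
  by (auto simp: module_hom_on_def enc3_def vec_of_in_free lookup_vec_of lookup_add lookup_fscale
      intro!: poly_mapping_eqI)

lemma enc3_eq_0_iff: "enc3 x = 0 \<longleftrightarrow> x = 0"
proof
  assume "enc3 x = 0"
  then have "Poly_Mapping.lookup (enc3 x) i = 0" for i by simp
  from this[of 0] this[of 1] this[of 2] show "x = 0"
    by (simp add: lookup_enc3 idx3_def vec_eq_iff forall_3)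
qed (auto intro!: poly_mapping_eqI simp: lookup_enc3)

lemma enc3_surj:
  assumes "v \<in> free 3"
  obtains x where "v = enc3 x"
proof
  show "v = enc3 (vector [Poly_Mapping.lookup v 0, Poly_Mapping.lookup v 1, Poly_Mapping.lookup v 2])"
  proof (rule poly_mapping_eqI)
    fix i :: nat
    consider "i = 0" | "i = 1" | "i = 2" | "i \<ge> 3" by linarith
    then show "Poly_Mapping.lookup v i
      = Poly_Mapping.lookup (enc3 (vector [Poly_Mapping.lookup v 0, Poly_Mapping.lookup v 1, Poly_Mapping.lookup v 2])) i"
      using assms by cases (auto simp: lookup_enc3 idx3_def mem_free_iff)
  qed
qed

lemma subspace_Syz: "module.subspace (*s) (Syz f)"
proof -
  interpret V: module "(*s) :: 'a \<Rightarrow> 'a ^ 3 \<Rightarrow> _" by (rule module_vec)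
  show ?thesis
    by (auto simp: V.subspace_def Syz_def sum_3 algebra_simps) (metis distrib_left mult_zero_right)
qed

lemma ideal_of_eq: "ideal_of f = {\<Sum>i\<in>UNIV. x $ i * f $ i | x. True}"
proof -
  interpret R: module "(*) :: 'a \<Rightarrow> 'a \<Rightarrow> _" by (rule module_times)
  have "{f $ i | i. True} = (\<lambda>i. f $ i) ` UNIV" by auto
  have "R.span {f $ i | i. True} = {\<Sum>i\<in>UNIV. x $ i * f $ i | x. True}"
  proof (rule R.span_unique)
    show "{f $ i | i. True} \<subseteq> {\<Sum>i\<in>UNIV. x $ i * f $ i | x. True}"
    proof clarsimp
      fix i
      show "\<exists>x. f $ i = (\<Sum>j\<in>UNIV. x $ j * f $ j)"
        by (rule exI[of _ "axis i 1"]) (simp add: axis_def if_distrib[of "\<lambda>u. u * _"] cong: if_cong)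
    qed
    show "R.subspace {\<Sum>i\<in>UNIV. x $ i * f $ i | x. True}"
      unfolding R.subspace_def
    proof (intro conjI ballI allI)
      show "0 \<in> {\<Sum>i\<in>UNIV. x $ i * f $ i | x. True}" by (auto intro!: exI[of _ 0])
    next
      fix p q assume "p \<in> {\<Sum>i\<in>UNIV. x $ i * f $ i | x. True}" "q \<in> {\<Sum>i\<in>UNIV. x $ i * f $ i | x. True}"
      then obtain x y where "p = (\<Sum>i\<in>UNIV. x $ i * f $ i)" "q = (\<Sum>i\<in>UNIV. y $ i * f $ i)" by auto
      then show "p + q \<in> {\<Sum>i\<in>UNIV. x $ i * f $ i | x. True}"
        by (auto intro!: exI[of _ "x + y"] simp: distrib_right sum.distrib)
    next
      fix c p assume "p \<in> {\<Sum>i\<in>UNIV. x $ i * f $ i | x. True}"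
      then obtain x where "p = (\<Sum>i\<in>UNIV. x $ i * f $ i)" by auto
      then show "c * p \<in> {\<Sum>i\<in>UNIV. x $ i * f $ i | x. True}"
        by (intro CollectI exI[of _ "c *s x"] conjI TrueI) (simp only: sum_distrib_left mult.assoc vector_smult_component)
    qed
  next
    fix T' assume T': "{f $ i | i. True} \<subseteq> T'" "R.subspace T'"
    show "{\<Sum>i\<in>UNIV. x $ i * f $ i | x. True} \<subseteq> T'"
      using T' by (auto intro!: R.subspace_sum[OF T'(2)] R.subspace_scale[OF T'(2)])
  qed
  then show ?thesis by (simp add: ideal_of_def)
qed


section \<open>The resolution of a Bourbaki ideal\<close>

lemma module_hom_on_range: "module_hom_on s t M UNIV h \<Longrightarrow> h ` M \<subseteq> N \<Longrightarrow> module_hom_on s t M N h"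
  by (simp add: module_hom_on_def)

text \<open>The mapping cone argument. The presentation of I is spliced with \<nu> into an exact
  sequence of free modules resolving J up to the kernel of \<open>d2\<close>. This kernel is the
  module of relations among the \<open>k l\<close>, so \<open>resolution_retract\<close> and
  \<open>retract_into_irrelevant_zero\<close> show that there are none.\<close>

lemma bourbaki_presentation:
  fixes f :: "('n::{finite,linorder}, 'k::field) mpoly ^ 3" and m r l :: nat
  assumes phi: "module_hom_on (*s) (*) (Syz f) I \<phi>" "\<phi> ` Syz f = I"
    and ker: "{x \<in> Syz f. \<phi> x = 0} = module.span (*s) {\<nu>}" and nu: "\<nu> \<noteq> 0"
    and res: "has_projective_resolution (*) (ideal_of f) 2"
    and g: "\<And>i. i < m \<Longrightarrow> g i \<in> I" "\<And>p. p \<in> I \<Longrightarrow> \<exists>c. p = (\<Sum>i<m. c i * g i)"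
    and k: "\<And>l. l < r \<Longrightarrow> k l \<in> free m" "\<And>l. l < r \<Longrightarrow> (\<Sum>i<m. Poly_Mapping.lookup (k l) i * g i) = 0"
      "\<And>v. v \<in> free m \<Longrightarrow> (\<Sum>i<m. Poly_Mapping.lookup v i * g i) = 0 \<Longrightarrow> \<exists>c. v = (\<Sum>l<r. fscale (c l) (k l))"
      "\<And>c l. (\<Sum>l<r. fscale (c l) (k l)) = 0 \<Longrightarrow> l < r \<Longrightarrow> Poly_Mapping.lookup (c l) 0 = (0 :: 'k)"
    and rel: "(\<Sum>l<r. fscale (c l) (k l)) = 0" and l: "l < r"
  shows "c l = 0"
proof -
  interpret V: module "(*s) :: ('n, 'k) mpoly \<Rightarrow> _ ^ 3 \<Rightarrow> _" by (rule module_vec)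
  let ?S = "Syz f"
  note sS = subspace_Syz[of f]
  have nuS: "\<nu> \<in> ?S" "\<phi> \<nu> = 0"
    using ker V.span_base[of \<nu> "{\<nu>}"] by auto
  have kerD: "\<exists>c. x = c *s \<nu>" if "x \<in> ?S" "\<phi> x = 0" for x
  proof -
    have "x \<in> V.span {\<nu>}" using ker that by blast
    then show ?thesis by (auto simp: V.span_singleton)
  qed
  have phi_sum: "\<phi> (\<Sum>i\<in>A. u i *s y i) = (\<Sum>i\<in>A. u i * \<phi> (y i))" if "\<And>i. i \<in> A \<Longrightarrow> y i \<in> ?S" for A and u :: "nat \<Rightarrow> _" and y
    using that by (rule module_hom_on_sum[OF module_vec phi(1) sS])
  have sumS: "(\<Sum>i\<in>A. u i *s y i) \<in> ?S" if "\<And>i. i \<in> A \<Longrightarrow> y i \<in> ?S" for A and u :: "nat \<Rightarrow> _" and y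
    using that by (intro V.subspace_sum[OF sS] V.subspace_scale[OF sS])
  have "\<forall>i. \<exists>y. i < m \<longrightarrow> y \<in> ?S \<and> \<phi> y = g i" using g(1) phi(2) by (metis image_iff)
  then obtain \<mu> where \<mu>: "\<And>i. i < m \<Longrightarrow> \<mu> i \<in> ?S" "\<And>i. i < m \<Longrightarrow> \<phi> (\<mu> i) = g i" by metis
  have "\<exists>c. (\<Sum>i<m. Poly_Mapping.lookup v i *s \<mu> i) = c *s \<nu>" if "(\<Sum>i<m. Poly_Mapping.lookup v i * g i) = 0" for v
  proof (rule kerD)
    show "(\<Sum>i<m. Poly_Mapping.lookup v i *s \<mu> i) \<in> ?S" using \<mu>(1) by (intro sumS) auto
    have "\<phi> (\<Sum>i<m. Poly_Mapping.lookup v i *s \<mu> i) = (\<Sum>i<m. Poly_Mapping.lookup v i * \<phi> (\<mu> i))"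
      using \<mu>(1) by (intro phi_sum) auto
    then show "\<phi> (\<Sum>i<m. Poly_Mapping.lookup v i *s \<mu> i) = 0" using that \<mu>(2) by simp
  qed
  then have "\<forall>l. \<exists>c. l < r \<longrightarrow> (\<Sum>i<m. Poly_Mapping.lookup (k l) i *s \<mu> i) = c *s \<nu>" using k(2) by meson
  then obtain \<rho> where \<rho>: "\<And>l. l < r \<Longrightarrow> (\<Sum>i<m. Poly_Mapping.lookup (k l) i *s \<mu> i) = \<rho> l *s \<nu>" by metis
  define e where "e v = (\<Sum>i<3. Poly_Mapping.lookup v i * f $ idx3 i)" for v
  define \<mu>' where "\<mu>' i = (if i < m then \<mu> i else \<nu>)" for i
  define d1' where "d1' v = (\<Sum>i<Suc m. Poly_Mapping.lookup v i *s \<mu>' i)" for v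
  define d1 where "d1 v = enc3 (d1' v)" for v
  \<comment> \<open>Coordinate \<open>m\<close> belongs to \<nu>. The relation \<open>k l\<close>
    among the \<open>g i\<close> lifts to the \<mu>'s only up to a multiple \<open>\<rho> l\<close>
    of \<nu>, which is subtracted there.\<close>
  define \<kappa> where "\<kappa> l = k l - Poly_Mapping.single m (\<rho> l)" for l
  define d2 where "d2 w = (\<Sum>l<r. fscale (Poly_Mapping.lookup w l) (\<kappa> l))" for w
  have d1'_eq: "d1' v = (\<Sum>i<m. Poly_Mapping.lookup v i *s \<mu> i) + Poly_Mapping.lookup v m *s \<nu>" for v
    by (simp add: d1'_def \<mu>'_def)
  have d1'S: "d1' v \<in> ?S" for v
    unfolding d1'_eq using \<mu>(1) nuS by (intro V.subspace_add[OF sS] sumS V.subspace_scale[OF sS]) auto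
  have d1'_hom: "module_hom_on fscale (*s) (free (Suc m)) UNIV d1'"
    unfolding d1'_def[abs_def] by (rule module_hom_on_lincomb[OF module_vec])
  have d1_hom: "module_hom_on fscale fscale (free (Suc m)) (free 3) d1"
    unfolding d1_def[abs_def] by (rule module_hom_on_comp[OF d1'_hom enc3_hom])
  have d1'_eq0: "d1 v = 0 \<longleftrightarrow> d1' v = 0" for v by (simp add: d1_def enc3_eq_0_iff)
  have e_enc: "e (enc3 x) = (\<Sum>i\<in>UNIV. x $ i * f $ i)" for x
    by (simp add: e_def lessThan_3 lookup_enc3 idx3_def sum_3 add.assoc)
  have e_img: "e ` free 3 = ideal_of f"
  proof (intro equalityI subsetI)
    fix p assume "p \<in> e ` free 3"
    then obtain v where "v \<in> free 3" "p = e v" by auto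
    then show "p \<in> ideal_of f" using e_enc by (auto simp: ideal_of_eq elim!: enc3_surj)
  next
    fix p assume "p \<in> ideal_of f"
    then obtain x where "p = e (enc3 x)" by (auto simp: ideal_of_eq e_enc)
    then show "p \<in> e ` free 3" by (auto simp: enc3_def vec_of_in_free)
  qed
  have e_hom: "module_hom_on fscale (*) (free 3) (ideal_of f) e"
  proof (rule module_hom_on_range)
    show "module_hom_on fscale (*) (free 3) UNIV e"
      unfolding e_def[abs_def] by (rule module_hom_on_lincomb[OF module_times])
  qed (simp add: e_img)
  have d1_img: "d1 ` free (Suc m) = {x \<in> free 3. e x = 0}"
  proof (intro equalityI subsetI)
    fix x assume "x \<in> d1 ` free (Suc m)"
    then obtain v where "x = enc3 (d1' v)" by (auto simp: d1_def)
    then show "x \<in> {x \<in> free 3. e x = 0}" using d1'S[of v] by (simp add: e_enc Syz_def) (simp add: enc3_def vec_of_in_free)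
  next
    fix x assume "x \<in> {x \<in> free 3. e x = 0}"
    then have x: "x \<in> free 3" "e x = 0" by auto
    obtain y where y: "x = enc3 y" using enc3_surj[OF x(1)] .
    have yS: "y \<in> ?S" using x(2) y by (simp add: e_enc Syz_def)
    then have "\<phi> y \<in> I" using phi(2) by auto
    then obtain u where u: "\<phi> y = (\<Sum>i<m. u i * g i)" using g(2) by blast
    let ?z = "\<Sum>i<m. u i *s \<mu> i"
    have zS: "?z \<in> ?S" using \<mu>(1) by (intro sumS) auto
    have "\<phi> ?z = (\<Sum>i<m. u i * \<phi> (\<mu> i))" using \<mu>(1) by (intro phi_sum) auto
    then have "\<phi> ?z = \<phi> y" using u \<mu>(2) by simp
    then have "\<phi> (y - ?z) = 0" using module_hom_on_diff[OF module_vec phi(1) sS yS zS] by simp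
    then obtain c where c: "y - ?z = c *s \<nu>" using kerD V.subspace_diff[OF sS yS zS] by blast
    let ?v = "vec_of (Suc m) (\<lambda>i. if i < m then u i else c)"
    have "d1' ?v = ?z + c *s \<nu>" by (simp add: d1'_eq lookup_vec_of)
    then have "d1' ?v = y" using c by (simp add: diff_eq_eq add.commute)
    then show "x \<in> d1 ` free (Suc m)" using y by (intro image_eqI[of _ _ ?v]) (simp_all add: d1_def vec_of_in_free)
  qed
  have \<kappa>_free: "\<kappa> l \<in> free (Suc m)" if "l < r" for l
    using k(1)[OF that] by (auto simp: \<kappa>_def mem_free_iff lookup_minus lookup_single when_def)
  have \<kappa>_lookup: "Poly_Mapping.lookup (\<kappa> l) i = Poly_Mapping.lookup (k l) i" if "i < m" for l i
    using that by (simp add: \<kappa>_def lookup_minus lookup_single when_def)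
  have \<kappa>_m: "Poly_Mapping.lookup (\<kappa> l) m = - \<rho> l" if "l < r" for l
    using k(1)[OF that] by (simp add: \<kappa>_def lookup_minus mem_free_iff)
  have d1\<kappa>: "d1' (\<kappa> l) = 0" if "l < r" for l
  proof -
    have "(\<Sum>i<m. Poly_Mapping.lookup (\<kappa> l) i *s \<mu> i) = \<rho> l *s \<nu>"
      using \<rho>[OF that] \<kappa>_lookup by simp
    then show ?thesis unfolding d1'_eq \<kappa>_m[OF that] by simp
  qed
  have d2_hom: "module_hom_on fscale fscale (free r) (free (Suc m)) d2"
  proof (rule module_hom_on_range)
    show "module_hom_on fscale fscale (free r) UNIV d2"
      unfolding d2_def[abs_def] by (rule module_hom_on_lincomb[OF module_fscale])
    show "d2 ` free r \<subseteq> free (Suc m)" unfolding d2_def using \<kappa>_free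
      by (auto intro!: fmod.subspace_sum[OF subspace_free] fmod.subspace_scale[OF subspace_free])
  qed
  have d1d2: "d1' (d2 w) = 0" for w
  proof -
    have "d1' (d2 w) = (\<Sum>l<r. Poly_Mapping.lookup w l *s d1' (\<kappa> l))"
      unfolding d2_def using \<kappa>_free by (intro module_hom_on_sum[OF module_fscale d1'_hom subspace_free]) auto
    then show ?thesis using d1\<kappa> by simp
  qed
  \<comment> \<open>As \<nu> is nonzero over a domain, an element of the kernel of
    \<open>d1'\<close> is determined by its first \<open>m\<close> coordinates.\<close>
  have only_m: "v = 0" if "v \<in> free (Suc m)" "\<And>i. i < m \<Longrightarrow> Poly_Mapping.lookup v i = 0" "d1' v = 0" for v
  proof -
    have "Poly_Mapping.lookup v m *s \<nu> = 0" using that(2,3) by (simp add: d1'_eq)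
    then have "Poly_Mapping.lookup v m = 0" using nu by (auto simp: vec_eq_iff)
    then have "Poly_Mapping.lookup v i = 0" for i
      using that(1,2) by (cases "i < m"; cases "i = m") (auto simp: mem_free_iff)
    then show ?thesis by (intro poly_mapping_eqI) simp
  qed
  have d2_lookup: "Poly_Mapping.lookup (d2 w) i = (\<Sum>l<r. Poly_Mapping.lookup w l * Poly_Mapping.lookup (k l) i)" if "i < m" for w i
    using that by (simp add: d2_def lookup_sum lookup_fscale \<kappa>_lookup)
  have d2_img: "d2 ` free r = {x \<in> free (Suc m). d1 x = 0}"
  proof (intro equalityI subsetI)
    fix x assume "x \<in> d2 ` free r"
    then obtain w where w: "w \<in> free r" "x = d2 w" by auto
    then show "x \<in> {x \<in> free (Suc m). d1 x = 0}"
      using d1d2 module_hom_on_in[OF d2_hom] by (simp add: d1'_eq0)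
  next
    fix x assume "x \<in> {x \<in> free (Suc m). d1 x = 0}"
    then have x: "x \<in> free (Suc m)" "d1' x = 0" by (auto simp: d1'_eq0)
    let ?y = "vec_of m (Poly_Mapping.lookup x)"
    \<comment> \<open>Applying \<phi> removes the \<nu>-term and leaves a relation among the
      \<open>g i\<close>.\<close>
    have "0 = \<phi> (d1' x)" using x(2) module_hom_on_zero[OF phi(1) V.subspace_0[OF sS]] by simp
    also have "d1' x = (\<Sum>i<Suc m. Poly_Mapping.lookup x i *s \<mu>' i)" by (simp add: d1'_def)
    also have "\<phi> \<dots> = (\<Sum>i<Suc m. Poly_Mapping.lookup x i * \<phi> (\<mu>' i))"
      using \<mu>(1) nuS by (intro phi_sum) (auto simp: \<mu>'_def)
    also have "\<dots> = (\<Sum>i<m. Poly_Mapping.lookup x i * g i)"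
      using \<mu>(2) nuS by (simp add: \<mu>'_def)
    finally have "(\<Sum>i<m. Poly_Mapping.lookup ?y i * g i) = 0" by (simp add: lookup_vec_of)
    then obtain c where c: "?y = (\<Sum>l<r. fscale (c l) (k l))" using k(3)[OF vec_of_in_free] by blast
    let ?w = "vec_of r c"
    have "x - d2 ?w = 0"
    proof (rule only_m)
      show "x - d2 ?w \<in> free (Suc m)"
        using x(1) module_hom_on_in[OF d2_hom vec_of_in_free] by (intro fmod.subspace_diff[OF subspace_free])
      show "d1' (x - d2 ?w) = 0"
        using module_hom_on_diff[OF module_fscale d1'_hom subspace_free x(1) module_hom_on_in[OF d2_hom vec_of_in_free]] x(2) d1d2
        by simp
      fix i assume i: "i < m"
      have "Poly_Mapping.lookup x i = Poly_Mapping.lookup ?y i" using i by (simp add: lookup_vec_of)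
      also have "\<dots> = (\<Sum>l<r. c l * Poly_Mapping.lookup (k l) i)" unfolding c by (simp add: lookup_sum lookup_fscale)
      finally show "Poly_Mapping.lookup (x - d2 ?w) i = 0"
        using i by (simp add: lookup_minus d2_lookup lookup_vec_of)
    qed
    then show "x \<in> d2 ` free r" by (intro image_eqI[of _ _ ?w]) (simp_all add: vec_of_in_free)
  qed
  \<comment> \<open>On the first \<open>m\<close> coordinates \<open>d2\<close> is the relation
    matrix of I, so its kernel consists of relations among the \<open>k l\<close>; by minimality
    these have no constant terms.\<close>
  have ker_d2: "(\<Sum>l<r. fscale (Poly_Mapping.lookup w l) (k l)) = 0" if "d2 w = 0" for w
  proof (rule poly_mapping_eqI)
    fix i
    show "Poly_Mapping.lookup (\<Sum>l<r. fscale (Poly_Mapping.lookup w l) (k l)) i = Poly_Mapping.lookup 0 i"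
    proof (cases "i < m")
      case True
      then show ?thesis using d2_lookup[OF True, of w] that by (simp add: lookup_sum lookup_fscale)
    next
      case False
      then show ?thesis using k(1) by (simp add: lookup_sum lookup_fscale mem_free_iff)
    qed
  qed
  obtain \<Lambda> where \<Lambda>: "module_hom_on fscale fscale (free r) (free r) \<Lambda>" "\<forall>x\<in>free r. d2 (\<Lambda> x) = 0"
      "\<forall>x\<in>free r. d2 x = 0 \<longrightarrow> \<Lambda> x = x"
    using resolution_retract[OF projective_free projective_free projective_free e_hom e_img d1_hom d1_img d2_hom d2_img res]
    by blast
  have zero: "x = 0" if x: "x \<in> {x \<in> free r. d2 x = 0}" for x
  proof (rule retract_into_irrelevant_zero[OF \<Lambda>(1), where L = "{x \<in> free r. d2 x = 0}"])
    show "\<Lambda> y \<in> {x \<in> free r. d2 x = 0}" if "y \<in> free r" for y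
      using \<Lambda>(2) that module_hom_on_in[OF \<Lambda>(1)] by simp
    show "Poly_Mapping.lookup (Poly_Mapping.lookup y l) 0 = 0" if "y \<in> {x \<in> free r. d2 x = 0}" "l < r" for y l
    proof -
      have "d2 y = 0" using that(1) by simp
      from k(4)[OF ker_d2[OF this] that(2)] show ?thesis .
    qed
  qed (use \<Lambda>(3) x in auto)
  let ?w = "vec_of r c"
  have "d2 ?w = 0"
  proof (rule only_m)
    show "d2 ?w \<in> free (Suc m)" using module_hom_on_in[OF d2_hom vec_of_in_free] .
    show "d1' (d2 ?w) = 0" by (rule d1d2)
    fix i assume i: "i < m"
    have "Poly_Mapping.lookup (\<Sum>l<r. fscale (c l) (k l)) i = 0" using rel by simp
    then show "Poly_Mapping.lookup (d2 ?w) i = 0"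
      using i by (simp add: d2_lookup lookup_vec_of lookup_sum lookup_fscale)
  qed
  then have "?w = 0" using zero vec_of_in_free by blast
  then have "Poly_Mapping.lookup ?w l = 0" by simp
  then show ?thesis using l by (simp add: lookup_vec_of)
qed

text \<open>The last inequality compares sorted degrees. If b_l were at most a_(l+1), the relations
  0, ..., l could involve only the generators 0, ..., l, which is too many independent
  relations.\<close>

lemma bourbaki_resolution:
  fixes f :: "('n::{finite,linorder}, 'k::field) mpoly ^ 3"
  assumes I: "homogeneous_ideal I" "I \<noteq> {0}"
    and phi: "module_hom_on (*s) (*) (Syz f) I \<phi>" "\<phi> ` Syz f = I"
    and ker: "{x \<in> Syz f. \<phi> x = 0} = module.span (*s) {\<nu>}" and nu: "\<nu> \<noteq> 0"
    and res: "has_projective_resolution (*) (ideal_of f) 2"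
  obtains m r :: nat and a b :: "nat \<Rightarrow> nat" where
    "\<And>j. kspace.dim {p \<in> I. homogeneous j p} + (\<Sum>l<r. nmonom TYPE('n) j (b l)) = (\<Sum>i<m. nmonom TYPE('n) j (a i))"
    "\<And>i i'. i \<le> i' \<Longrightarrow> i' < m \<Longrightarrow> a i \<le> a i'"
    "\<And>l. l < r \<Longrightarrow> Suc l < m \<and> a (Suc l) < b l"
    "\<exists>p\<in>I. p \<noteq> 0 \<and> homogeneous (a 0) p"
proof (rule homogeneous_ideal_minimal_generators[OF I(1)])
  fix m :: nat and g a
  assume g: "\<And>i. i < m \<Longrightarrow> g i \<in> I" "\<And>i. i < m \<Longrightarrow> homogeneous (a i) (g i)"
    and a: "\<And>i i'. i \<le> i' \<Longrightarrow> i' < m \<Longrightarrow> a i \<le> a i'"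
    and gen: "\<And>p. p \<in> I \<Longrightarrow> \<exists>c. p = (\<Sum>i<m. c i * g i)"
    and ming: "\<And>c i. (\<Sum>i<m. c i * g i) = 0 \<Longrightarrow> i < m \<Longrightarrow> Poly_Mapping.lookup (c i) 0 = (0 :: 'k)"
  interpret R: module "(*) :: ('n, 'k) mpoly \<Rightarrow> _" by (rule module_times)
  have sI: "R.subspace I" using I(1) by (auto simp: homogeneous_ideal_def)
  have m: "m > 0"
  proof (rule ccontr)
    assume "\<not> m > 0"
    then have "p = 0" if "p \<in> I" for p using gen[OF that] by simp
    then show False using I(2) R.subspace_0[OF sI] by blast
  qed
  have g0: "g 0 \<noteq> 0"
  proof
    assume "g 0 = 0"
    then have "(\<Sum>i<m. (if i = 0 then 1 else 0) * g i) = 0" by (intro sum.neutral) auto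
    from ming[OF this m] show False by simp
  qed
  let ?K = "{v \<in> free m. (\<Sum>i<m. Poly_Mapping.lookup v i * g i) = 0}"
  have "graded_submodule a m ?K"
    unfolding graded_submodule_def
  proof (intro conjI ballI allI)
    show "fmod.subspace ?K"
      unfolding fmod.subspace_def
    proof (intro conjI ballI allI)
      note hom = module_hom_on_lincomb[OF module_times, of m g]
      show "0 \<in> ?K" by (simp add: mem_free_iff)
      show "x + y \<in> ?K" if "x \<in> ?K" "y \<in> ?K" for x y
        using that module_hom_on_add[OF hom, of x y] fmod.subspace_add[OF subspace_free, of x m y] by auto
      show "fscale c x \<in> ?K" if "x \<in> ?K" for c x
        using that module_hom_on_scale[OF hom, of x c] fmod.subspace_scale[OF subspace_free, of x m c] by auto
    qed
    fix v j assume v: "v \<in> ?K"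
    have "(\<Sum>i<m. hpart (a i) j (Poly_Mapping.lookup v i) * g i) = (\<Sum>i<m. hpart 0 j (Poly_Mapping.lookup v i * g i))"
      using g(2) by (intro sum.cong refl hpart_mult[symmetric]) (auto simp: homogeneous_def)
    also have "\<dots> = hpart 0 j (\<Sum>i<m. Poly_Mapping.lookup v i * g i)" by (simp add: hpart_sum)
    also have "\<dots> = 0" using v by simp
    finally show "vpart a j v \<in> ?K" using v by (simp add: lookup_vpart mem_free_iff)
  qed auto
  then show thesis
  proof (rule minimal_homogeneous_generators)
    fix r :: nat and k b
    assume kK: "\<And>l. l < r \<Longrightarrow> k l \<in> ?K" and kh: "\<And>l. l < r \<Longrightarrow> hvec a (b l) (k l)"
      and b: "\<And>l l'. l \<le> l' \<Longrightarrow> l' < r \<Longrightarrow> b l \<le> b l'"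
      and kgen: "\<And>v. v \<in> ?K \<Longrightarrow> \<exists>c. v = (\<Sum>l<r. fscale (c l) (k l))"
      and mink: "\<And>c l. (\<Sum>l<r. fscale (c l) (k l)) = 0 \<Longrightarrow> l < r \<Longrightarrow> Poly_Mapping.lookup (c l) 0 = (0 :: 'k)"
    have k: "k l \<in> free m" "(\<Sum>i<m. Poly_Mapping.lookup (k l) i * g i) = 0" if "l < r" for l
      using kK[OF that] by auto
    have kgen': "\<exists>c. v = (\<Sum>l<r. fscale (c l) (k l))" if "v \<in> free m" "(\<Sum>i<m. Poly_Mapping.lookup v i * g i) = 0" for v
      using that by (intro kgen) auto
    have indep: "c l = 0" if "(\<Sum>l<r. fscale (c l) (k l)) = 0" "l < r" for c l
      by (rule bourbaki_presentation[where m = m and r = r and g = g and k = k and c = c and l = l and f = f and I = I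
            and \<phi> = \<phi> and \<nu> = \<nu>]; fact phi ker nu res g gen k kgen' mink that)
    \<comment> \<open>Independence passes to initial segments by padding the coefficients with
      zeros.\<close>
    have indep': "w l = 0" if w: "(\<Sum>l<c. fscale (w l) (k l)) = 0" "l < c" and c: "c \<le> r" for w l c
    proof -
      have "(\<Sum>l<r. fscale (if l < c then w l else 0) (k l)) = (\<Sum>l<c. fscale (w l) (k l))"
        using c by (intro sum.mono_neutral_cong_right) auto
      then show ?thesis using indep[of "\<lambda>l. if l < c then w l else 0" l] w c by simp
    qed
    show thesis
    proof (rule that[of b r a m])
      show "kspace.dim {p \<in> I. homogeneous j p} + (\<Sum>l<r. nmonom TYPE('n) j (b l)) = (\<Sum>i<m. nmonom TYPE('n) j (a i))" for j
      proof -
        have "(\<Sum>i<m. c i * g i) \<in> I" for c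
          using g(1) by (intro R.subspace_sum[OF sI] R.subspace_scale[OF sI]) auto
        then have eq: "{p \<in> I. homogeneous j p} = {p. homogeneous j p \<and> (\<exists>c. p = (\<Sum>i<m. c i * g i))}"
          using gen by auto
        show ?thesis unfolding eq by (rule dim_presentation[where k = k]; fact g k kh kgen' indep)
      qed
      show "a i \<le> a i'" if "i \<le> i'" "i' < m" for i i' using a that .
      show "\<exists>p\<in>I. p \<noteq> 0 \<and> homogeneous (a 0) p" using g m g0 by blast
      fix l assume l: "l < r"
      show "Suc l < m \<and> a (Suc l) < b l"
      proof (cases "Suc l < m")
        case False
        then have mr: "m \<le> r" using l by simp
        \<comment> \<open>Otherwise the first \<open>m\<close> relations would be \<open>m\<close>
          independent relations among \<open>m\<close> generators.\<close>
        have "m < m"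
          by (rule independent_relations_less[where g = g and k = k, OF g0 m]) (use k mr indep' in auto)
        then show ?thesis by simp
      next
        case True
        have "a (Suc l) < b l"
        proof (rule ccontr)
          assume "\<not> a (Suc l) < b l"
          then have le: "b l \<le> a (Suc l)" by simp
          \<comment> \<open>The entry of \<open>k i\<close> at a later generator would have degree
            at most 0, and minimality of the generators forbids nonzero constants.\<close>
          have kf: "k i \<in> free (Suc l)" if i: "i < Suc l" for i
            unfolding mem_free_iff
          proof (intro allI impI)
            fix i' assume i': "i' \<ge> Suc l"
            show "Poly_Mapping.lookup (k i) i' = 0"
            proof (cases "i' < m")
              case False
              then show ?thesis using k(1)[of i] i l by (simp add: mem_free_iff)
            next
              case im: True
              have ir: "i < r" using i l by simp
              have "t \<notin> Poly_Mapping.keys (Poly_Mapping.lookup (k i) i')" for t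
              proof
                assume t: "t \<in> Poly_Mapping.keys (Poly_Mapping.lookup (k i) i')"
                have "monomial_degree t + a i' = b i" using kh[OF ir] t by (auto simp: hvec_def)
                moreover have "b i \<le> b l" using b[of i l] i l by simp
                moreover have "a (Suc l) \<le> a i'" using a i' im by blast
                ultimately have "monomial_degree t = 0" using le by linarith
                then have "t = 0" by (simp add: monomial_degree_eq_0_iff)
                then show False using ming[OF k(2)[OF ir] im] t by (simp add: in_keys_iff)
              qed
              then show ?thesis by (metis all_not_in_conv keys_eq_empty)
            qed
          qed
          have "Suc l < Suc l"
          proof (rule independent_relations_less[where g = g and k = k, OF g0 zero_less_Suc kf])
            fix i assume i: "i < Suc l"
            have "(\<Sum>i'<Suc l. Poly_Mapping.lookup (k i) i' * g i') = (\<Sum>i'<m. Poly_Mapping.lookup (k i) i' * g i')"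
              using True kf[OF i] by (intro sum.mono_neutral_left) (auto simp: mem_free_iff)
            then show "(\<Sum>i'<Suc l. Poly_Mapping.lookup (k i) i' * g i') = 0" using k(2)[of i] i l by simp
          next
            fix w i assume "(\<Sum>l<Suc l. fscale (w l) (k l)) = 0" "i < Suc l"
            then show "w i = 0" using l by (intro indep'[of w "Suc l" i]) auto
          qed
          then show False by simp
        qed
        then show ?thesis using True by simp
      qed
    qed
  qed
qed


section \<open>Heights, cross products and coprime forms\<close>

lemma not_dvd_one_of_tdeg_pos:
  fixes p :: "('n::{finite,linorder}, 'k::field) mpoly"
  assumes "tdeg p > 0"
  shows "\<not> p dvd 1"
proof
  assume "p dvd 1"
  then obtain q where q: "1 = p * q" by (elim dvdE)
  then have "p \<noteq> 0" "q \<noteq> 0" by auto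
  then have "tdeg (1 :: ('n, 'k) mpoly) = tdeg p + tdeg q" using tdeg_mult q by metis
  moreover have "tdeg (1 :: ('n, 'k) mpoly) \<le> 0" by (rule tdeg_leI) (auto split: if_splits)
  ultimately show False using assms by simp
qed

lemma tdeg_prime_pos:
  fixes p :: "('n::{finite,linorder}, 'k::field) mpoly"
  assumes "prime_elem p"
  shows "tdeg p > 0"
  using assms tdeg_0_dvd_one[of p] by (auto simp: prime_elem_def)

lemma prime_elem_mpoly_exists: "\<exists>p :: ('n::{finite,linorder}, 'k::field) mpoly. prime_elem p"
proof -
  let ?x = "Poly_Mapping.single (Poly_Mapping.single undefined 1) 1 :: ('n, 'k) mpoly"
  have nz: "?x \<noteq> 0" by (metis lookup_single_eq lookup_zero zero_neq_one)
  have "homogeneous 1 ?x" by (simp add: homogeneous_def)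
  then have "tdeg ?x > 0" using tdeg_homogeneous[OF _ nz] by fastforce
  then show ?thesis using mpoly_prime_divisor_exists[OF nz not_dvd_one_of_tdeg_pos] by metis
qed

text \<open>Here \<open>q\<close> is not in \<open>P\<close>. An element x = q y of \<open>P\<close>
  therefore has its cofactor y in \<open>P\<close>, of smaller degree; by descent x = 0.\<close>

lemma prime_ideal_subset_principal:
  fixes q :: "('n::{finite,linorder}, 'k::field) mpoly"
  assumes q: "prime_elem q" and P: "prime_ideal P" "P \<subset> {x. q dvd x}"
  shows "P = {0}"
proof -
  interpret R: module "(*) :: ('n, 'k) mpoly \<Rightarrow> _" by (rule module_times)
  have sP: "R.subspace P" and pP: "\<And>a b. a * b \<in> P \<Longrightarrow> a \<in> P \<or> b \<in> P" using P(1) by (auto simp: prime_ideal_def)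
  have "q \<notin> P"
  proof
    assume "q \<in> P"
    then have "q * c \<in> P" for c using R.subspace_scale[OF sP, of q c] by (simp add: mult.commute)
    then have "{x. q dvd x} \<subseteq> P" by (auto elim!: dvdE)
    then show False using P(2) by blast
  qed
  have "x = 0" if "x \<in> P" for x
    using that
  proof (induction "tdeg x" arbitrary: x rule: less_induct)
    case less
    show ?case
    proof (rule ccontr)
      assume nz: "x \<noteq> 0"
      obtain y where y: "x = q * y" using less.prems P(2) by (auto elim!: dvdE)
      then have "y \<in> P" using pP[of q y] less.prems \<open>q \<notin> P\<close> by auto
      have "q \<noteq> 0" "y \<noteq> 0" using nz y by auto
      then have "tdeg x = tdeg q + tdeg y" unfolding y by (rule tdeg_mult)
      then have "y = 0" using less.hyps \<open>y \<in> P\<close> tdeg_prime_pos[OF q] by simp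
      then show False using \<open>y \<noteq> 0\<close> by simp
    qed
  qed
  then show ?thesis using R.subspace_0[OF sP] by blast
qed

text \<open>The multiples of \<open>q\<close> form a prime ideal containing \<open>I\<close>. A
  chain of two steps below it would have the zero ideal in the middle and the empty set
  underneath.\<close>

lemma height_le_1_if_prime_divides:
  fixes q :: "('n::{finite,linorder}, 'k::field) mpoly"
  assumes q: "prime_elem q" and I: "\<And>x. x \<in> I \<Longrightarrow> q dvd x"
  shows "height I \<le> 1"
proof -
  interpret R: module "(*) :: ('n, 'k) mpoly \<Rightarrow> _" by (rule module_times)
  let ?Q = "{x. q dvd x}"
  have "prime_ideal ?Q"
    using q by (auto simp: prime_ideal_def R.subspace_def prime_elem_def)
  moreover have "prime_height ?Q \<le> 1"
    unfolding prime_height_def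
  proof (rule Sup_least, clarify)
    fix m and C :: "nat \<Rightarrow> ('n, 'k) mpoly set"
    assume C: "\<forall>i\<le>m. prime_ideal (C i)" "\<forall>i<m. C i \<subset> C (Suc i)" "C m = ?Q"
    show "enat m \<le> 1"
    proof (rule ccontr)
      assume "\<not> enat m \<le> 1"
      then have "m \<ge> 2" by (simp add: one_enat_def)
      then obtain k where k: "m = Suc (Suc k)" by (metis add_2_eq_Suc le_Suc_ex)
      have "C (Suc k) \<subset> C m" "prime_ideal (C (Suc k))" using C(1,2) k by auto
      then have "C (Suc k) = {0}" using C(3) by (intro prime_ideal_subset_principal[OF q]) auto
      moreover have "C k \<subset> C (Suc k)" "prime_ideal (C k)" using C(1,2) k by auto
      ultimately have "C k = {}" "R.subspace (C k)" by (auto simp: prime_ideal_def)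
      then show False using R.subspace_0 by blast
    qed
  qed
  moreover have "I \<subseteq> ?Q" using I by auto
  ultimately show ?thesis unfolding height_def by (intro Inf_lower2[of "prime_height ?Q"]) auto
qed

lemma height_UNIV: "height (UNIV :: 'r::comm_ring_1 set) = \<infinity>"
proof -
  have "{prime_height P | P. prime_ideal P \<and> (UNIV :: 'r set) \<subseteq> P} = {}" by (auto simp: prime_ideal_def)
  then show ?thesis unfolding height_def by (simp only: Inf_empty top_enat_def)
qed

text \<open>For a nonzero entry y_k, every x_k y_j is a multiple of y_k; as the entries of y have no
  common prime, y_k divides x_k, and the quotient is the factor.\<close>

lemma parallel_multiple:
  fixes x y :: "('n::{finite,linorder}, 'k::field) mpoly ^ 3"
  assumes par: "\<And>i j. x $ i * y $ j = x $ j * y $ i" and y: "y \<noteq> 0"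
    and prim: "\<And>p. prime_elem p \<Longrightarrow> \<exists>i. \<not> p dvd y $ i"
  obtains p where "x = p *s y"
proof -
  obtain k where k: "y $ k \<noteq> 0" using y by (auto simp: vec_eq_iff)
  have "y $ k dvd x $ k"
  proof (rule mpoly_primitive_dvd[OF k, of "range (($) y)"])
    show "\<exists>z\<in>range (($) y). \<not> p dvd z" if "prime_elem p" for p using prim[OF that] by auto
    fix z assume "z \<in> range (($) y)"
    then obtain j where "z = y $ j" by auto
    then show "y $ k dvd x $ k * z" using par[of k j] by simp
  qed
  then obtain p where p: "x $ k = y $ k * p" by (elim dvdE)
  have "x $ j = p * y $ j" for j
  proof -
    have "y $ k * x $ j = y $ k * (p * y $ j)"
      using par[of j k] by (simp only: p mult.assoc mult.commute[of "x $ j"])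
    then show ?thesis using k by simp
  qed
  then show ?thesis by (intro that[of p]) (simp add: vec_eq_iff)
qed

section \<open>Cross products of syzygies and Koszul syzygies\<close>

definition cross :: "'r::comm_ring_1 ^ 3 \<Rightarrow> 'r ^ 3 \<Rightarrow> 'r ^ 3" where
  "cross a b = vector [a $ 2 * b $ 3 - a $ 3 * b $ 2, a $ 3 * b $ 1 - a $ 1 * b $ 3, a $ 1 * b $ 2 - a $ 2 * b $ 1]"

lemma cross_nth [simp]:
  "cross a b $ 1 = a $ 2 * b $ 3 - a $ 3 * b $ 2"
  "cross a b $ 2 = a $ 3 * b $ 1 - a $ 1 * b $ 3"
  "cross a b $ 3 = a $ 1 * b $ 2 - a $ 2 * b $ 1"
  by (simp_all add: cross_def)

text \<open>Both s x n and f are orthogonal to s and n, hence parallel. This is one of the three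
  minors; the others arise by cyclic permutation.\<close>

lemma cross_identities:
  fixes s1 s2 s3 n1 n2 n3 f1 f2 f3 :: "'r::comm_ring_1"
  assumes "s1 * f1 + s2 * f2 + s3 * f3 = 0" "n1 * f1 + n2 * f2 + n3 * f3 = 0"
  shows "(s2 * n3 - s3 * n2) * f2 = (s3 * n1 - s1 * n3) * f1"
proof -
  have "(s2 * n3 - s3 * n2) * f2 - (s3 * n1 - s1 * n3) * f1
      = n3 * (s1 * f1 + s2 * f2 + s3 * f3) - s3 * (n1 * f1 + n2 * f2 + n3 * f3)"
    by (simp add: algebra_simps)
  then show ?thesis using assms by simp
qed

lemma cross_parallel:
  assumes "s \<in> Syz f" "\<nu> \<in> Syz f"
  shows "cross s \<nu> $ i * f $ j = cross s \<nu> $ j * f $ i"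
proof -
  have s: "s $ 1 * f $ 1 + s $ 2 * f $ 2 + s $ 3 * f $ 3 = 0" "\<nu> $ 1 * f $ 1 + \<nu> $ 2 * f $ 2 + \<nu> $ 3 * f $ 3 = 0"
    using assms by (simp_all add: Syz_def sum_3)
  then have s': "s $ 2 * f $ 2 + s $ 3 * f $ 3 + s $ 1 * f $ 1 = 0" "\<nu> $ 2 * f $ 2 + \<nu> $ 3 * f $ 3 + \<nu> $ 1 * f $ 1 = 0"
    "s $ 3 * f $ 3 + s $ 1 * f $ 1 + s $ 2 * f $ 2 = 0" "\<nu> $ 3 * f $ 3 + \<nu> $ 1 * f $ 1 + \<nu> $ 2 * f $ 2 = 0"
    by (simp_all add: ac_simps)
  have "cross s \<nu> $ 1 * f $ 2 = cross s \<nu> $ 2 * f $ 1"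
    "cross s \<nu> $ 2 * f $ 3 = cross s \<nu> $ 3 * f $ 2"
    "cross s \<nu> $ 3 * f $ 1 = cross s \<nu> $ 1 * f $ 3"
    unfolding cross_nth by (rule cross_identities[OF s] cross_identities[OF s'(1,2)] cross_identities[OF s'(3,4)])+
  then show ?thesis using exhaust_3[of i] exhaust_3[of j] by auto
qed

lemma cross_zero_parallel: "cross s \<nu> = 0 \<Longrightarrow> s $ i * \<nu> $ j = s $ j * \<nu> $ i"
  using exhaust_3[of i] exhaust_3[of j] by (auto simp: vec_eq_iff forall_3)

lemma cross_linear: "cross (a *s x - b *s y) z = a *s cross x z - b *s cross y z"
  by (simp add: vec_eq_iff forall_3 algebra_simps)

text \<open>The syzygy f x e_i, where e_i is the i-th unit vector.\<close>

definition koszul3 :: "'r::comm_ring_1 ^ 3 \<Rightarrow> 3 \<Rightarrow> 'r ^ 3" where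
  "koszul3 f i = (if i = 1 then vector [0, f $ 3, - f $ 2]
     else if i = 2 then vector [- f $ 3, 0, f $ 1] else vector [f $ 2, - f $ 1, 0])"

lemma koszul3_in_Syz: "koszul3 f i \<in> Syz f"
  using exhaust_3[of i] by (auto simp: koszul3_def Syz_def sum_3 mult.commute)

text \<open>The triple product identity (f x e_i) x \<nu> = (f . \<nu>) e_i - \<nu>_i f, in which f
  . \<nu> = 0.\<close>

lemma cross_koszul3:
  assumes "\<nu> \<in> Syz f"
  shows "cross (koszul3 f i) \<nu> = (- \<nu> $ i) *s f"
proof -
  have s: "\<nu> $ 1 * f $ 1 + \<nu> $ 2 * f $ 2 + \<nu> $ 3 * f $ 3 = 0" using assms by (simp add: Syz_def sum_3)
  have "\<nu> $ 1 * f $ 1 + \<nu> $ 2 * f $ 2 = - (\<nu> $ 3 * f $ 3)"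
    by (rule eq_neg_iff_add_eq_0[THEN iffD2]) (rule s)
  moreover have "\<nu> $ 1 * f $ 1 + \<nu> $ 3 * f $ 3 = - (\<nu> $ 2 * f $ 2)"
    by (rule eq_neg_iff_add_eq_0[THEN iffD2]) (use s in \<open>simp only: ac_simps\<close>)
  moreover have "\<nu> $ 2 * f $ 2 + \<nu> $ 3 * f $ 3 = - (\<nu> $ 1 * f $ 1)"
    by (rule eq_neg_iff_add_eq_0[THEN iffD2]) (use s in \<open>simp only: ac_simps\<close>)
  ultimately show ?thesis
    using exhaust_3[of i] by (auto simp: vec_eq_iff forall_3 koszul3_def algebra_simps)
qed

lemma hpart_Syz:
  fixes f :: "('n::{finite,linorder}, 'k::field) mpoly ^ 3"
  assumes f: "\<And>i. homogeneous d (f $ i)" and s: "s \<in> Syz f"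
  shows "(\<chi> i. hpart 0 j (s $ i)) \<in> Syz f"
proof -
  have "(\<Sum>i\<in>UNIV. hpart 0 j (s $ i) * f $ i) = (\<Sum>i\<in>UNIV. hpart d (j + d) (s $ i) * f $ i)"
    by (simp add: hpart_shift[of d])
  also have "\<dots> = (\<Sum>i\<in>UNIV. hpart 0 (j + d) (s $ i * f $ i))"
    using f by (intro sum.cong refl hpart_mult[symmetric]) (auto simp: homogeneous_def)
  also have "\<dots> = hpart 0 (j + d) (\<Sum>i\<in>UNIV. s $ i * f $ i)" by (simp add: hpart_sum)
  finally show ?thesis using s by (simp add: Syz_def)
qed

lemma indeg_le: "s \<in> M \<Longrightarrow> s \<noteq> 0 \<Longrightarrow> homogeneous_vec j s \<Longrightarrow> indeg M \<le> j"
  unfolding indeg_def by (rule Least_le) blast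

lemma prime_elem_dvd_prod_list:
  fixes q :: "'a::comm_semiring_1"
  assumes "prime_elem q" "q dvd u * prod_list ps" "\<not> q dvd u"
  shows "\<exists>p\<in>set ps. q dvd p"
  using assms
proof (induction ps arbitrary: u)
  case (Cons p ps)
  then show ?case
    using prime_elem_dvd_multD[of q "u * p" "prod_list ps"] prime_elem_dvd_multD[of q u p]
    by (metis list.set_intros(1,2) mult.assoc prime_elem_dvd_multD prod_list.Cons)
qed simp

text \<open>Each prime factor p of x excludes at most one scalar t: two bad scalars would force p to
  divide z and then y. Finitely many t are excluded from an infinite field.\<close>

lemma generic_combination_coprime:
  fixes x y z :: "('n::{finite,linorder}, 'k::{field, ring_char_0}) mpoly"
  assumes x: "x \<noteq> 0" and prim: "\<And>p. prime_elem p \<Longrightarrow> \<not> (p dvd x \<and> p dvd y \<and> p dvd z)"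
  obtains t where "\<And>p. prime_elem p \<Longrightarrow> \<not> (p dvd x \<and> p dvd y + Poly_Mapping.single 0 t * z)"
proof -
  obtain u ps where ps: "u dvd 1" "\<And>q. q \<in> set ps \<Longrightarrow> prime_elem q" "x = u * prod_list ps"
    using mpoly_prime_factorization[OF x] by blast
  define bad where "bad p = {t :: 'k. p dvd y + Poly_Mapping.single 0 t * z}" for p
  have "finite (bad p)" if p: "p \<in> set ps" for p
  proof -
    have px: "p dvd x" unfolding ps(3) using split_list[OF p] by auto
    have "t = t'" if "t \<in> bad p" "t' \<in> bad p" for t t'
    proof (rule ccontr)
      assume ne: "t \<noteq> t'"
      have "p dvd (y + Poly_Mapping.single 0 t * z) - (y + Poly_Mapping.single 0 t' * z)"
        using that by (intro dvd_diff) (auto simp: bad_def)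
      also have "\<dots> = Poly_Mapping.single 0 (t - t') * z" by (simp add: single_diff left_diff_distrib)
      finally have "p dvd Poly_Mapping.single 0 (t - t') * z" .
      moreover have "\<not> p dvd Poly_Mapping.single 0 (t - t')"
      proof
        assume "p dvd Poly_Mapping.single 0 (t - t')"
        then have "p dvd 1" using const_dvd_one[of "t - t'"] ne dvd_trans by (metis right_minus_eq)
        then show False using ps(2)[OF p] by (simp add: prime_elem_def)
      qed
      ultimately have pz: "p dvd z" using prime_elem_dvd_multD[OF ps(2)[OF p]] by blast
      have "p dvd y + Poly_Mapping.single 0 t * z" using that by (simp add: bad_def)
      then have "p dvd y" using pz by (simp add: dvd_add_left_iff)
      then show False using prim[OF ps(2)[OF p]] px pz by blast
    qed
    then have "\<exists>t. bad p \<subseteq> {t}" by blast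
    then show ?thesis using finite_subset by blast
  qed
  then have "finite (\<Union>p\<in>set ps. bad p)" by blast
  moreover have "infinite (UNIV :: 'k set)" by (rule infinite_UNIV_char_0)
  ultimately obtain t where t: "t \<notin> (\<Union>p\<in>set ps. bad p)" using ex_new_if_finite by blast
  show ?thesis
  proof (rule that[of t])
    fix q :: "('n, 'k) mpoly" assume q: "prime_elem q"
    show "\<not> (q dvd x \<and> q dvd y + Poly_Mapping.single 0 t * z)"
    proof
      assume dv: "q dvd x \<and> q dvd y + Poly_Mapping.single 0 t * z"
      have "\<not> q dvd u" using q ps(1) dvd_trans by (auto simp: prime_elem_def)
      then obtain p where p: "p \<in> set ps" "q dvd p"
        using prime_elem_dvd_prod_list[OF q] dv ps(3) by blast
      then obtain w where w: "p = q * w" by (elim dvdE)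
      have pp: "prime_elem p" using ps(2) p(1) .
      have "p dvd q \<or> p dvd w" using prime_elem_dvd_multD[OF pp, of q w] w by simp
      \<comment> \<open>The prime \<open>q\<close> is associated to a listed factor
        \<open>p\<close>, so \<open>t\<close> is bad for \<open>p\<close> if it is bad for
        \<open>q\<close>.\<close>
      then have "p dvd q"
      proof
        assume "p dvd w"
        then obtain w' where "w = p * w'" by (elim dvdE)
        then have "p * 1 = p * (q * w')" using w by (simp add: mult_ac)
        then have "1 = q * w'" using pp by (metis mult_cancel_left prime_elem_def)
        then have "q dvd 1" by (rule dvdI)
        then show "p dvd q" using q by (simp add: prime_elem_def)
      qed
      then have "p dvd y + Poly_Mapping.single 0 t * z" using dv dvd_trans by blast
      then show False using t p(1) by (auto simp: bad_def)
    qed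
  qed
qed

lemma coprime_forms_exist:
  fixes \<nu> :: "('n::{finite,linorder}, 'k::{field, ring_char_0}) mpoly ^ 3"
  assumes I: "is_ideal I" "\<And>i. \<nu> $ i \<in> I" and hom: "\<And>i. homogeneous e (\<nu> $ i)" and nu: "\<nu> \<noteq> 0"
    and prim: "\<And>p. prime_elem p \<Longrightarrow> \<exists>i. \<not> p dvd \<nu> $ i"
  obtains g1 g2 where "homogeneous e g1" "homogeneous e g2" "g1 \<in> I" "g2 \<in> I" "g1 \<noteq> 0"
    "\<And>p. prime_elem p \<Longrightarrow> \<not> (p dvd g1 \<and> p dvd g2)"
proof -
  interpret R: module "(*) :: ('n, 'k) mpoly \<Rightarrow> _" by (rule module_times)
  obtain k where k: "\<nu> $ k \<noteq> 0" using nu by (auto simp: vec_eq_iff)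
  obtain i j :: 3 where ij: "{i, j, k} = UNIV"
  proof -
    consider "k = 1" | "k = 2" | "k = 3" using exhaust_3[of k] by blast
    then show ?thesis
    proof cases
      case 1
      then show ?thesis by (intro that[of 2 3]) (auto simp: UNIV_3)
    next
      case 2
      then show ?thesis by (intro that[of 1 3]) (auto simp: UNIV_3)
    next
      case 3
      then show ?thesis by (intro that[of 1 2]) (auto simp: UNIV_3)
    qed
  qed
  have "\<not> (p dvd \<nu> $ k \<and> p dvd \<nu> $ i \<and> p dvd \<nu> $ j)" if "prime_elem p" for p
    using prim[OF that] ij by (metis UNIV_I empty_iff insert_iff)
  then obtain t where t: "\<And>p. prime_elem p \<Longrightarrow> \<not> (p dvd \<nu> $ k \<and> p dvd \<nu> $ i + Poly_Mapping.single 0 t * \<nu> $ j)"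
    using generic_combination_coprime[OF k] by metis
  show ?thesis
  proof (rule that[of "\<nu> $ k" "\<nu> $ i + Poly_Mapping.single 0 t * \<nu> $ j"])
    have "homogeneous (0 + e) (Poly_Mapping.single 0 t * \<nu> $ j)"
      using hom by (intro homogeneous_mult) (auto simp: homogeneous_def)
    then show "homogeneous e (\<nu> $ i + Poly_Mapping.single 0 t * \<nu> $ j)" using hom by (simp add: homogeneous_add)
    show "\<nu> $ i + Poly_Mapping.single 0 t * \<nu> $ j \<in> I"
      using I by (intro R.subspace_add R.subspace_scale) auto
  qed (use I hom k t in auto)
qed


section \<open>Bounds for the Bourbaki degree\<close>

lemma unit_homogeneous:
  fixes p :: "('n::{finite,linorder}, 'k::field) mpoly"
  assumes "p dvd 1"
  shows "homogeneous 0 p"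
proof -
  have "tdeg p = 0" using not_dvd_one_of_tdeg_pos assms by blast
  then show ?thesis using monomial_degree_le_tdeg[of _ p] by (auto simp: homogeneous_def)
qed

text \<open>Dividing \<nu> by a common prime gives a syzygy of smaller degree. The quotient is not
  known to be homogeneous, so one of its homogeneous parts is compared with the initial
  degree.\<close>

lemma indeg_syzygy_primitive:
  fixes f \<nu> :: "('n::{finite,linorder}, 'k::field) mpoly ^ 3"
  assumes f: "\<And>i. homogeneous d (f $ i)" and nu: "\<nu> \<in> Syz f" "homogeneous_vec (indeg (Syz f)) \<nu>" "\<nu> \<noteq> 0"
    and p: "prime_elem p"
  shows "\<exists>i. \<not> p dvd \<nu> $ i"
proof (rule ccontr)
  assume "\<not> ?thesis"
  then have "\<forall>i. \<exists>c. \<nu> $ i = p * c" by (auto elim: dvdE)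
  then obtain c where c: "\<And>i. \<nu> $ i = p * c i" by metis
  have pnz: "p \<noteq> 0" using p by auto
  let ?c = "\<chi> i. c i"
  have "p * (\<Sum>i\<in>UNIV. c i * f $ i) = (\<Sum>i\<in>UNIV. \<nu> $ i * f $ i)"
    by (simp only: c sum_distrib_left mult.assoc)
  then have cS: "?c \<in> Syz f" using nu(1) pnz by (simp add: Syz_def)
  obtain i where i: "\<nu> $ i \<noteq> 0" using nu(3) by (auto simp: vec_eq_iff)
  then have ci: "c i \<noteq> 0" using c by auto
  let ?s = "\<chi> l. hpart 0 (tdeg (c i)) (?c $ l)"
  have "?s \<in> Syz f" using hpart_Syz[OF f cS] .
  moreover have "?s \<noteq> 0" using hpart_tdeg_nonzero[OF ci] by (auto simp: vec_eq_iff)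
  moreover have "homogeneous_vec (tdeg (c i)) ?s" by (simp add: homogeneous_vec_def homogeneous_hpart)
  ultimately have "indeg (Syz f) \<le> tdeg (c i)" by (rule indeg_le)
  moreover have "tdeg (\<nu> $ i) = indeg (Syz f)" using nu(2) i by (intro tdeg_homogeneous) (auto simp: homogeneous_vec_def)
  moreover have "tdeg (\<nu> $ i) = tdeg p + tdeg (c i)" unfolding c using pnz ci by (rule tdeg_mult)
  ultimately show False using tdeg_prime_pos[OF p] by simp
qed

text \<open>Let s x \<nu> = \<psi>(s) f. Both \<phi> and \<psi> kill the multiples of \<nu>, so A
  \<phi> = B \<psi> for their values A and B at one Koszul syzygy. Since \<psi> takes the values
  -\<nu>_i and \<nu> is primitive, A divides B. The quotient divides all of I, which has no common
  prime factor, so it is a unit.\<close>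

lemma bourbaki_map_canonical:
  fixes f \<nu> :: "('n::{finite,linorder}, 'k::field) mpoly ^ 3"
  assumes f: "f \<noteq> 0" "\<And>p. prime_elem p \<Longrightarrow> \<exists>i. \<not> p dvd f $ i"
    and nu: "\<nu> \<in> Syz f" "\<nu> \<noteq> 0" "\<And>p. prime_elem p \<Longrightarrow> \<exists>i. \<not> p dvd \<nu> $ i"
    and phi: "module_hom_on (*s) (*) (Syz f) I \<phi>" "\<phi> ` Syz f = I"
    and ker: "{x \<in> Syz f. \<phi> x = 0} = module.span (*s) {\<nu>}"
    and ht: "\<And>p. prime_elem p \<Longrightarrow> \<exists>x\<in>I. \<not> p dvd x"
  obtains u where "u dvd 1" "\<And>s. s \<in> Syz f \<Longrightarrow> \<phi> s *s f = u *s cross s \<nu>"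
proof -
  interpret V: module "(*s) :: ('n, 'k) mpoly \<Rightarrow> _ ^ 3 \<Rightarrow> _" by (rule module_vec)
  note sS = subspace_Syz[of f]
  have "\<exists>p. cross s \<nu> = p *s f" if "s \<in> Syz f" for s
    using parallel_multiple[OF cross_parallel[OF that nu(1)] f] by blast
  then obtain \<psi> where \<psi>: "\<And>s. s \<in> Syz f \<Longrightarrow> cross s \<nu> = \<psi> s *s f" by metis
  have f_cancel: "a = b" if "a *s f = b *s f" for a b
  proof -
    obtain i where "f $ i \<noteq> 0" using f(1) by (auto simp: vec_eq_iff)
    moreover have "a * f $ i = b * f $ i" using that by (metis vector_smult_component)
    ultimately show ?thesis by simp
  qed
  have \<psi>_kos: "\<psi> (koszul3 f i) = - \<nu> $ i" for i
    using \<psi>[OF koszul3_in_Syz] cross_koszul3[OF nu(1), of i] by (intro f_cancel) simp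
  obtain k where k: "\<nu> $ k \<noteq> 0" using nu(2) by (auto simp: vec_eq_iff)
  define A where "A = \<psi> (koszul3 f k)"
  define B where "B = \<phi> (koszul3 f k)"
  have A: "A \<noteq> 0" using k by (simp add: A_def \<psi>_kos)
  have AB: "A * \<phi> s = B * \<psi> s" if s: "s \<in> Syz f" for s
  proof -
    \<comment> \<open>The combination is chosen so that \<psi> vanishes on it; then it is parallel
      to the primitive vector \<nu>, hence a multiple of it, and \<phi> vanishes as well.\<close>
    let ?t = "A *s s - \<psi> s *s koszul3 f k"
    have tS: "A *s s \<in> Syz f" "\<psi> s *s koszul3 f k \<in> Syz f"
      using s koszul3_in_Syz by (auto intro: V.subspace_scale[OF sS])
    have "cross ?t \<nu> = A *s cross s \<nu> - \<psi> s *s cross (koszul3 f k) \<nu>" by (rule cross_linear)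
    also have "\<dots> = 0" unfolding \<psi>[OF s] \<psi>[OF koszul3_in_Syz] A_def by (simp add: mult.commute)
    finally have "\<And>i j. ?t $ i * \<nu> $ j = ?t $ j * \<nu> $ i" by (rule cross_zero_parallel)
    then obtain c where "?t = c *s \<nu>" using parallel_multiple[OF _ nu(2,3)] by blast
    then have "?t \<in> V.span {\<nu>}" by (simp add: V.span_base V.span_scale)
    then have "\<phi> ?t = 0" using ker by blast
    then have "\<phi> (A *s s) = \<phi> (\<psi> s *s koszul3 f k)" using module_hom_on_diff[OF module_vec phi(1) sS tS] by simp
    then show ?thesis
      using module_hom_on_scale[OF phi(1) s] module_hom_on_scale[OF phi(1) koszul3_in_Syz] by (simp add: B_def mult.commute)
  qed
  have "A dvd B"
  proof (rule mpoly_primitive_dvd[OF A, of "range (($) \<nu>)"])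
    show "\<exists>y\<in>range (($) \<nu>). \<not> p dvd y" if "prime_elem p" for p using nu(3)[OF that] by auto
    fix y assume "y \<in> range (($) \<nu>)"
    then obtain i where i: "y = \<nu> $ i" by auto
    have "A * \<phi> (koszul3 f i) = - (B * y)" using AB[OF koszul3_in_Syz[of f i]] by (simp add: \<psi>_kos i)
    then have "A dvd - (B * y)" by (metis dvd_triv_left)
    then show "A dvd B * y" by simp
  qed
  then obtain u where u: "B = A * u" by (elim dvdE)
  have phi_u: "\<phi> s = u * \<psi> s" if "s \<in> Syz f" for s
    using AB[OF that] A by (simp add: u mult.assoc)
  have I_u: "u dvd x" if "x \<in> I" for x
    using that phi(2) phi_u by auto
  have "u dvd 1"
  proof (rule ccontr)
    assume nunit: "\<not> u dvd 1"
    have "\<exists>q. prime_elem q \<and> (\<forall>x\<in>I. q dvd x)"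
    proof (cases "u = 0")
      case True
      obtain q :: "('n, 'k) mpoly" where "prime_elem q" using prime_elem_mpoly_exists by blast
      moreover have "q dvd x" if "x \<in> I" for x using I_u[OF that] True by simp
      ultimately show ?thesis by blast
    next
      case False
      then obtain q where "prime_elem q" "q dvd u" using mpoly_prime_divisor_exists nunit by blast
      then show ?thesis using I_u dvd_trans by blast
    qed
    then show False using ht by blast
  qed
  moreover have "\<phi> s *s f = u *s cross s \<nu>" if "s \<in> Syz f" for s
    unfolding \<psi>[OF that] phi_u[OF that] by simp
  ultimately show ?thesis using that by blast
qed

lemma cross_hpart:
  fixes s \<nu> :: "('n::{finite,linorder}, 'k::field) mpoly ^ 3"
  assumes "homogeneous_vec e \<nu>"
  shows "cross (\<chi> i. hpart e N (s $ i)) \<nu> $ j = hpart 0 N (cross s \<nu> $ j)"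
proof -
  have m: "hpart 0 N (s $ i * \<nu> $ k) = hpart e N (s $ i) * \<nu> $ k" for i k
    using assms by (intro hpart_mult) (auto simp: homogeneous_vec_def homogeneous_def)
  have diff: "hpart 0 N (p - q) = hpart 0 N p - hpart 0 N q" for p q :: "('n, 'k) mpoly"
    by (intro poly_mapping_eqI) (simp add: lookup_hpart lookup_minus when_def)
  show ?thesis using exhaust_3[of j] by (auto simp: diff m)
qed

text \<open>The vector g f has degree a + d and equals s x \<nu> up to a unit. Hence the part of s
  of degree a + d - e is a nonzero syzygy, and its degree is at least e.\<close>

lemma bourbaki_ideal_degrees:
  fixes f \<nu> :: "('n::{finite,linorder}, 'k::field) mpoly ^ 3"
  assumes f: "\<And>i. homogeneous d (f $ i)" "f \<noteq> 0"
    and nu: "homogeneous_vec (indeg (Syz f)) \<nu>"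
    and u: "u dvd 1" "s \<in> Syz f" "g *s f = u *s cross s \<nu>"
    and g: "g \<noteq> 0" "homogeneous a g"
  shows "2 * indeg (Syz f) \<le> a + d"
proof -
  let ?e = "indeg (Syz f)"
  obtain v where v: "1 = u * v" using u(1) by (elim dvdE)
  then have "v dvd 1" by (metis dvd_triv_right)
  then have hv: "homogeneous 0 v" by (rule unit_homogeneous)
  have cr: "cross s \<nu> $ j = v * (g * f $ j)" for j
  proof -
    have "g * f $ j = u * cross s \<nu> $ j" using u(3) by (metis vector_smult_component)
    then have "v * (g * f $ j) = u * v * cross s \<nu> $ j" by (simp only: mult.assoc mult.left_commute)
    then show ?thesis using v by simp
  qed
  have hom: "homogeneous (a + d) (cross s \<nu> $ j)" for j
    using homogeneous_mult[OF hv homogeneous_mult[OF g(2) f(1)[of j]]] by (simp add: cr)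
  obtain j where j: "f $ j \<noteq> 0" using f(2) by (auto simp: vec_eq_iff)
  have "v \<noteq> 0" using v by auto
  then have nz: "cross s \<nu> $ j \<noteq> 0" using g(1) j by (simp add: cr)
  let ?s = "\<chi> i. hpart ?e (a + d) (s $ i)"
  have "cross ?s \<nu> $ j = cross s \<nu> $ j" unfolding cross_hpart[OF nu] using hpart_homogeneous[OF hom[of j]] by simp
  then have snz: "?s \<noteq> 0" using nz exhaust_3[of j] by auto
  \<comment> \<open>For a + d below the degree of \<nu> the shifted part \<open>?s\<close> would be
    zero; this also makes the subtraction below exact.\<close>
  then have le: "?e \<le> a + d" by (rule contrapos_np) (simp add: hpart_shift[of ?e] vec_eq_iff)
  then have eq: "?s = (\<chi> i. hpart 0 (a + d - ?e) (s $ i))" by (simp add: hpart_shift[of ?e])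
  have "?s \<in> Syz f" unfolding eq using hpart_Syz[OF f(1) u(2)] .
  moreover have "homogeneous_vec (a + d - ?e) ?s" unfolding eq by (simp add: homogeneous_vec_def homogeneous_hpart)
  ultimately have "?e \<le> a + d - ?e" using snz by (intro indeg_le) auto
  then show ?thesis using le by linarith
qed

text \<open>A finite value excludes the empty infimum, and a nonempty infimum in \<open>enat\<close>
  is attained.\<close>

lemma projective_dimension_attained:
  assumes "projective_dimension s M = enat m"
  shows "has_projective_resolution s M m"
proof -
  let ?A = "{enat m | m. has_projective_resolution s M m}"
  have ne: "?A \<noteq> {}"
  proof
    assume "?A = {}"
    then have "Inf ?A = \<infinity>" unfolding Inf_enat_def by simp
    then show False using assms by (simp add: projective_dimension_def)
  qed
  then have "\<exists>x. x \<in> ?A" by blast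
  then have "(LEAST x. x \<in> ?A) \<in> ?A" by (rule LeastI_ex)
  then have "Inf ?A \<in> ?A" using ne by (simp only: Inf_enat_def if_False)
  then show ?thesis using assms by (auto simp: projective_dimension_def)
qed

text \<open>The witness \<alpha> is the least degree a_0 of a minimal generator of the Bourbaki
  ideal.\<close>

theorem Bourbaki_degree_bounds:
  fixes f :: "('n::{finite,linorder}, 'k::field_char_0) mpoly ^ 3"
  assumes n: "CARD('n) \<ge> 3" and aci: "equigenerated_strict_aci2 d f"
    and pd: "projective_dimension (*) (ideal_of f) = 2" and Bour: "has_Bourbaki_degree f \<beta>"
  defines "e \<equiv> indeg (Syz f)"
  obtains \<alpha> :: nat where "\<alpha> \<ge> 1" "2 * e \<le> \<alpha> + d" "e \<le> d"
    "of_nat (\<alpha> * (\<alpha> + 1)) / 2 \<le> \<beta>" "\<beta> \<le> of_nat (e\<^sup>2)"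
proof -
  interpret R: module "(*) :: ('n, 'k) mpoly \<Rightarrow> _" by (rule module_times)
  interpret V: module "(*s) :: ('n, 'k) mpoly \<Rightarrow> _ ^ 3 \<Rightarrow> _" by (rule module_vec)
  have f: "\<And>i. homogeneous d (f $ i)" "inj (\<lambda>i. f $ i)" "height (ideal_of f) = 2"
    using aci by (auto simp: equigenerated_strict_aci2_def)
  have prim_of_height: "\<exists>x\<in>J. \<not> p dvd x" if J: "height J = 2" and p: "prime_elem p" for J and p :: "('n, 'k) mpoly"
  proof (rule ccontr)
    assume "\<not> ?thesis"
    then have "height J \<le> 1" using p by (intro height_le_1_if_prime_divides) auto
    then show False using J by simp
  qed
  have f0: "f \<noteq> 0"
  proof
    assume "f = 0"
    then have "(\<lambda>i. f $ i) (1 :: 3) = (\<lambda>i. f $ i) 2" by simp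
    then have "(1 :: 3) = 2" by (rule injD[OF f(2)])
    then show False by simp
  qed
  have fprim: "\<exists>i. \<not> p dvd f $ i" if p: "prime_elem p" for p
  proof (rule ccontr)
    assume "\<not> ?thesis"
    then have "p dvd x" if "x \<in> ideal_of f" for x using that by (auto simp: ideal_of_eq intro!: dvd_sum)
    then show False using prim_of_height[OF f(3) p] by blast
  qed
  obtain \<nu> I where bi: "bourbaki_ideal f \<nu> I" and \<beta>: "\<beta> = multiplicity_quot I"
    using Bour by (auto simp: has_Bourbaki_degree_def)
  have nuh: "homogeneous_vec e \<nu>" and I: "homogeneous_ideal I" "height I = 2"
    using bi by (auto simp: bourbaki_ideal_def e_def)
  have sI: "R.subspace I" using I(1) by (auto simp: homogeneous_ideal_def)
  obtain G where G: "\<nu> \<in> G" "minimal_generating_set (*s) G (Syz f)"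
    using bi by (auto simp: bourbaki_ideal_def minimal_generator_def)
  have nuS: "\<nu> \<in> Syz f" using G V.span_base by (auto simp: minimal_generating_set_def)
  \<comment> \<open>A zero element could be dropped from a generating set, against
    minimality.\<close>
  have nu0: "\<nu> \<noteq> 0"
  proof
    assume "\<nu> = 0"
    then have "G - {0} \<subset> G" using G(1) by auto
    moreover have "V.span (G - {0}) = V.span G"
    proof -
      have "x \<in> V.span (G - {0})" if "x \<in> G" for x
        using that V.span_base[of x "G - {0}"] V.span_zero by (cases "x = 0") auto
      then show ?thesis unfolding V.span_eq using V.span_superset[of G] by blast
    qed
    ultimately show False using G(2) by (metis minimal_generating_set_def)
  qed
  have nuprim: "\<exists>i. \<not> p dvd \<nu> $ i" if "prime_elem p" for p
    using indeg_syzygy_primitive[OF f(1) nuS nuh[unfolded e_def] nu0 that] .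
  obtain \<phi> where phi: "module_hom_on (*s) (*) (Syz f) I \<phi>" "\<phi> ` Syz f = I"
    and ker: "{x \<in> Syz f. \<phi> x = 0} = V.span {\<nu>}"
    using bi unfolding bourbaki_ideal_def quotient_iso_up_to_shift_def by blast
  obtain u where u: "u dvd 1" "\<And>s. s \<in> Syz f \<Longrightarrow> \<phi> s *s f = u *s cross s \<nu>"
    using bourbaki_map_canonical[OF f0 fprim nuS nu0 nuprim phi ker prim_of_height[OF I(2)]] by blast
  \<comment> \<open>A unit would make \<open>I\<close> the unit ideal, whose height is
    infinite.\<close>
  have I_not_one: "\<not> x dvd 1" if x: "x \<in> I" for x
  proof
    assume "x dvd 1"
    then obtain y where "1 = x * y" by (elim dvdE)
    then have "1 \<in> I" using R.subspace_scale[OF sI x, of y] by (simp add: mult.commute)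
    then have "I = UNIV" using R.subspace_scale[OF sI, of 1] by auto
    then show False using I(2) height_UNIV[where 'r = "('n, 'k) mpoly"] by simp
  qed
  have I0: "I \<noteq> {0}"
  proof
    assume I0: "I = {0}"
    obtain q :: "('n, 'k) mpoly" where "prime_elem q" using prime_elem_mpoly_exists by blast
    then show False using prim_of_height[OF I(2), of q] I0 by simp
  qed
  have nuI: "\<nu> $ i \<in> I" for i
  proof -
    obtain j where j: "f $ j \<noteq> 0" using f0 by (auto simp: vec_eq_iff)
    have smult: "\<phi> (koszul3 f i) *s f = u *s ((- \<nu> $ i) *s f)"
      using u(2)[OF koszul3_in_Syz[of f i]] cross_koszul3[OF nuS, of i] by simp
    have "\<phi> (koszul3 f i) * f $ j = u * (- \<nu> $ i) * f $ j"
      using arg_cong[OF smult, of "\<lambda>v. v $ j"] by (simp only: vector_smult_component mult.assoc)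
    then have eq: "\<phi> (koszul3 f i) = u * (- \<nu> $ i)" by (rule mult_right_cancel[OF j, THEN iffD1])
    obtain v where v: "1 = u * v" using u(1) by (elim dvdE)
    have "(- v) * \<phi> (koszul3 f i) \<in> I" using phi(2) koszul3_in_Syz by (intro R.subspace_scale[OF sI]) blast
    also have "(- v) * \<phi> (koszul3 f i) = u * v * \<nu> $ i"
      unfolding eq by (simp only: mult_minus_left mult_minus_right minus_minus mult.left_commute mult.assoc)
    also have "\<dots> = \<nu> $ i" by (simp only: v[symmetric] mult_1)
    finally show ?thesis .
  qed
  have ed: "e \<le> d"
  proof -
    obtain j where j: "f $ j \<noteq> 0" using f0 by (auto simp: vec_eq_iff)
    obtain i where "koszul3 f i \<noteq> 0"
    proof -
      consider "j = 1" | "j = 2" | "j = 3" using exhaust_3[of j] by blast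
      then show ?thesis
      proof cases
        case 1
        then show ?thesis using j by (intro that[of 2]) (auto simp: koszul3_def vec_eq_iff forall_3)
      next
        case 2
        then show ?thesis using j by (intro that[of 1]) (auto simp: koszul3_def vec_eq_iff forall_3)
      next
        case 3
        then show ?thesis using j by (intro that[of 1]) (auto simp: koszul3_def vec_eq_iff forall_3)
      qed
    qed
    moreover have "homogeneous_vec d (koszul3 f i)"
      using f(1) by (auto simp: homogeneous_vec_def koszul3_def forall_3)
    ultimately show ?thesis unfolding e_def using koszul3_in_Syz by (intro indeg_le) auto
  qed
  have res: "has_projective_resolution (*) (ideal_of f) 2"
    by (rule projective_dimension_attained) (simp add: pd numeral_eq_enat)
  obtain g1 g2 where g12: "homogeneous e g1" "homogeneous e g2" "g1 \<in> I" "g2 \<in> I" "g1 \<noteq> 0"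
    "\<And>p. prime_elem p \<Longrightarrow> \<not> (p dvd g1 \<and> p dvd g2)"
    using coprime_forms_exist[OF sI nuI nuh[unfolded homogeneous_vec_def, rule_format] nu0 nuprim] by metis
  \<comment> \<open>A prime factor of the non-unit \<open>g1\<close> would otherwise divide both
    forms.\<close>
  have g2: "g2 \<noteq> 0"
  proof
    assume "g2 = 0"
    obtain q where "prime_elem q" "q dvd g1" using mpoly_prime_divisor_exists[OF g12(5) I_not_one[OF g12(3)]] by blast
    then show False using g12(6)[of q] \<open>g2 = 0\<close> by simp
  qed
  show ?thesis
  proof (rule bourbaki_resolution[OF I(1) I0 phi ker nu0 res])
    fix m r :: nat and a b :: "nat \<Rightarrow> nat"
    assume hilb: "\<And>j. kspace.dim {p \<in> I. homogeneous j p} + (\<Sum>l<r. nmonom TYPE('n) j (b l)) = (\<Sum>i<m. nmonom TYPE('n) j (a i))"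
      and mono: "\<And>i i'. i \<le> i' \<Longrightarrow> i' < m \<Longrightarrow> a i \<le> a i'"
      and gap: "\<And>l. l < r \<Longrightarrow> Suc l < m \<and> a (Suc l) < b l"
      and low: "\<exists>p\<in>I. p \<noteq> 0 \<and> homogeneous (a 0) p"
    have koszul: "2 * nmonom TYPE('n) j e \<le> kspace.dim {p \<in> I. homogeneous j p} + nmonom TYPE('n) j (2 * e)" for j
      using g12(6) by (rule koszul_dim_bound[OF g12(1,2,5) g2 _ sI g12(3,4)])
    note mr = multiplicity_from_resolution[OF n hilb koszul]
    obtain p where p: "p \<in> I" "p \<noteq> 0" "homogeneous (a 0) p" using low by blast
    have "a 0 \<noteq> 0"
    proof
      assume "a 0 = 0"
      then have "p dvd 1" using p by (intro tdeg_0_dvd_one) (simp_all add: tdeg_homogeneous)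
      then show False using I_not_one[OF p(1)] by simp
    qed
    then have a1: "a 0 \<ge> 1" by simp
    obtain s where s: "s \<in> Syz f" "\<phi> s = p" using p(1) phi(2) by auto
    have "2 * indeg (Syz f) \<le> a 0 + d"
      using bourbaki_ideal_degrees[OF f(1) f0 nuh[unfolded e_def] u(1) s(1) _ p(2,3)] u(2)[OF s(1)] s(2) by simp
    then have ea: "2 * e \<le> a 0 + d" by (simp add: e_def)
    have "(\<Sum>i<Suc r. (a i)\<^sup>2) + a 0 * (a 0 + 1) \<le> (\<Sum>l<r. (b l)\<^sup>2)"
      using mr(1,2) gap mono by (intro sum_squares_gap) auto
    then have lo: "(\<Sum>i<m. (a i)\<^sup>2) + a 0 * (a 0 + 1) \<le> (\<Sum>l<r. (b l)\<^sup>2)" by (simp add: mr(1))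
    have "a 0 * (a 0 + 1) > 0" using a1 by simp
    then have "(\<Sum>l<r. (b l)\<^sup>2) \<noteq> (\<Sum>i<m. (a i)\<^sup>2)" using lo by linarith
    from mr(4)[OF this] have \<beta>_eq: "\<beta> = (of_nat (\<Sum>l<r. (b l)\<^sup>2) - of_nat (\<Sum>i<m. (a i)\<^sup>2)) / 2" by (simp add: \<beta>)
    have "(of_nat (\<Sum>i<m. (a i)\<^sup>2) :: rat) + of_nat (a 0 * (a 0 + 1)) \<le> of_nat (\<Sum>l<r. (b l)\<^sup>2)"
      using lo by (simp only: of_nat_add[symmetric] of_nat_le_iff)
    then have b1: "of_nat (a 0 * (a 0 + 1)) / 2 \<le> \<beta>" unfolding \<beta>_eq by (intro divide_right_mono) linarith+
    have "(of_nat (\<Sum>l<r. (b l)\<^sup>2) :: rat) \<le> of_nat ((\<Sum>i<m. (a i)\<^sup>2) + 2 * e\<^sup>2)"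
      using mr(3) by (simp only: of_nat_le_iff)
    then have "(of_nat (\<Sum>l<r. (b l)\<^sup>2) :: rat) \<le> of_nat (\<Sum>i<m. (a i)\<^sup>2) + 2 * of_nat (e\<^sup>2)"
      by (simp only: of_nat_add of_nat_mult of_nat_numeral)
    moreover have "(x - y) / 2 \<le> z" if "x \<le> y + 2 * z" for x y z :: rat using that by simp
    ultimately have b2: "\<beta> \<le> of_nat (e\<^sup>2)" unfolding \<beta>_eq by blast
    show ?thesis using that[OF a1 ea ed b1 b2] .
  qed
qed

theorem theorem3p2:
  fixes f :: "('n::{finite,linorder}, 'k::{alg_closed_field,field_char_0}) mpoly ^ 3"
    and d :: nat
  assumes "CARD('n) \<ge> 3"
    and "equigenerated_strict_aci2 d f"
    and "projective_dimension (*) (ideal_of f) = 2"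
  shows "(d = 2 \<longrightarrow> \<not> has_Bourbaki_degree f 2) \<and>
         (d = 3 \<longrightarrow> \<not> has_Bourbaki_degree f 5)"
proof (intro conjI impI notI)
  assume d: "d = 2" and "has_Bourbaki_degree f 2"
  then obtain \<alpha> where \<alpha>: "2 * indeg (Syz f) \<le> \<alpha> + d" "indeg (Syz f) \<le> d"
    "of_nat (\<alpha> * (\<alpha> + 1)) / 2 \<le> (2 :: rat)" "2 \<le> (of_nat ((indeg (Syz f))\<^sup>2) :: rat)"
    using Bourbaki_degree_bounds[OF assms] by metis
  have "(of_nat (\<alpha> * (\<alpha> + 1)) :: rat) \<le> of_nat 4" using \<alpha>(3) by simp
  then have lo: "\<alpha> * (\<alpha> + 1) \<le> 4" by (simp only: of_nat_le_iff)
  have "(of_nat 2 :: rat) \<le> of_nat ((indeg (Syz f))\<^sup>2)" using \<alpha>(4) by simp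
  then have "2 \<le> (indeg (Syz f))\<^sup>2" by (simp only: of_nat_le_iff)
  \<comment> \<open>A value of 2 exceeds 1^2, so the initial degree must be exactly 2, which forces
    \<alpha> to be at least 2 * 2 - 2.\<close>
  then have "\<not> indeg (Syz f) \<le> 1" using power_mono[of "indeg (Syz f)" 1 2] by auto
  then have "\<alpha> \<ge> 2" using \<alpha>(1,2) d by simp
  then have "2 * 3 \<le> \<alpha> * (\<alpha> + 1)" by (intro mult_mono) auto
  then show False using lo by simp
next
  assume d: "d = 3" and "has_Bourbaki_degree f 5"
  then obtain \<alpha> where \<alpha>: "2 * indeg (Syz f) \<le> \<alpha> + d" "indeg (Syz f) \<le> d"
    "of_nat (\<alpha> * (\<alpha> + 1)) / 2 \<le> (5 :: rat)" "5 \<le> (of_nat ((indeg (Syz f))\<^sup>2) :: rat)"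
    using Bourbaki_degree_bounds[OF assms] by metis
  have "(of_nat (\<alpha> * (\<alpha> + 1)) :: rat) \<le> of_nat 10" using \<alpha>(3) by simp
  then have lo: "\<alpha> * (\<alpha> + 1) \<le> 10" by (simp only: of_nat_le_iff)
  have "(of_nat 5 :: rat) \<le> of_nat ((indeg (Syz f))\<^sup>2)" using \<alpha>(4) by simp
  then have "5 \<le> (indeg (Syz f))\<^sup>2" by (simp only: of_nat_le_iff)
  \<comment> \<open>Likewise 5 exceeds 2^2, so the initial degree is 3 and \<alpha> is at least 2 *
    3 - 3.\<close>
  then have "\<not> indeg (Syz f) \<le> 2" using power_mono[of "indeg (Syz f)" 2 2] by auto
  then have "\<alpha> \<ge> 3" using \<alpha>(1,2) d by simp
  then have "3 * 4 \<le> \<alpha> * (\<alpha> + 1)" by (intro mult_mono) auto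
  then show False using lo by simp
qed

end
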